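(* Let $(g(t),u(t))$ be a solution of the harmonic-Ricci flow on a compact manifold $M$ and let $\lambda(t)$ be an eigenvalue of the Laplacian $\Delta_{g(t)}$ with eigenfunction $f(t)$, i.e. $-\Delta_{g(t)}f(t)=\lambda(t)f(t)$. Then $$\begin{aligned}\frac{d}{dt}\lambda(t)\cdot\int_M f(t)^2\,dV_{g(t)}&=\lambda(t)\int_M S_{g(t),u(t)}f(t)^2\,dV_{g(t)}-\int_M S_{g(t),u(t)}|\nabla_{g(t)}f(t)|^2_{g(t)}\,dV_{g(t)}\\&\quad+2\int_M\langle\mathcal{S}_{g(t),u(t)},df(t)\otimes df(t)\rangle_{g(t)}\,dV_{g(t)}.\end{aligned}$$
   Context: A solution of the harmonic-Ricci flow on a compact manifold $M$ (without boundary) is a smooth family of Riemannian metrics $g(t)$ and smooth functions $u(t)$ on $M$ with $$\frac{\partial}{\partial t}g(t)=-2\,\mathrm{Ric}_{g(t)}+4\,du(t)\otimes du(t),\qquad \frac{\partial}{\partial t}u(t)=\Delta_{g(t)}u(t).$$ Here $\Delta_g=\mathrm{tr}_g\nabla^2_g$. The symmetric 2-tensor $\mathcal{S}_{g,u}$ is $\mathcal{S}_{g,u}=\mathrm{Ric}_g-2\,du\otimes du$ and its trace is $S_{g,u}=R_g-2|\nabla_g u|_g^2$, with $R_g$ the scalar curvature. The eigenvalue $\lambda(t)$ is a function of $t$ only, and $\lambda(t)$, $f(t)=f(x,t)$ are assumed to depend smoothly on $t$ (and $f$ on $x$). *)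

theory Defs
  imports "HOL-Analysis.Analysis"
begin

text \<open>
  A compact manifold without boundary is a compact Hausdorff type \<open>'m\<close> together with a smooth
  atlas of charts into \<open>real ^ 'n\<close>. Tensor fields are given classically, by their components in the
  charts of the atlas together with the transformation law. Covector fields have type
  \<open>('m, 'n) covector\<close> and tensor fields of type (0,2) have type \<open>('m, 'n) tensor2\<close>; the value
  \<open>T c p\<close> is meaningful only if \<open>c\<close> is a chart of the atlas and \<open>p\<close> is in its domain.
\<close>


section \<open>Smooth maps between Euclidean spaces\<close>

primrec C_on :: "nat \<Rightarrow> 'a::euclidean_space set \<Rightarrow> ('a \<Rightarrow> 'b::real_normed_vector) \<Rightarrow> bool" where
  "C_on 0 S f \<longleftrightarrow> continuous_on S f"
| "C_on (Suc k) S f \<longleftrightarrow> (\<forall>x\<in>S. f differentiable at x) \<and>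
     (\<forall>v. C_on k S (\<lambda>x. frechet_derivative f (at x) v))"

text \<open>
  On a set that need not be open (such as \<open>{0..<T} \<times> U\<close>), smoothness means that locally there are
  smooth extensions to open sets. On open sets this is the usual notion.
\<close>

definition smooth_on :: "'a::euclidean_space set \<Rightarrow> ('a \<Rightarrow> 'b::real_normed_vector) \<Rightarrow> bool" where
  "smooth_on S f \<longleftrightarrow>
     (\<forall>x\<in>S. \<exists>N F. open N \<and> x \<in> N \<and> (\<forall>k. C_on k N F) \<and> (\<forall>y\<in>S \<inter> N. F y = f y))"


section \<open>Charts and atlases\<close>

type_synonym ('m, 'n) chart = "'m set \<times> ('m \<Rightarrow> real ^ 'n)"

abbreviation dom_of :: "('m, 'n) chart \<Rightarrow> 'm set" where
  "dom_of c \<equiv> fst c"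

abbreviation coord :: "('m, 'n) chart \<Rightarrow> 'm \<Rightarrow> real ^ 'n" where
  "coord c \<equiv> snd c"

definition img_of :: "('m, 'n) chart \<Rightarrow> (real ^ 'n) set" where
  "img_of c = coord c ` dom_of c"

definition point :: "('m, 'n) chart \<Rightarrow> real ^ 'n \<Rightarrow> 'm" where
  "point c = inv_into (dom_of c) (coord c)"

definition is_chart :: "('m::topological_space, 'n::finite) chart \<Rightarrow> bool" where
  "is_chart c \<longleftrightarrow> open (dom_of c) \<and> open (img_of c) \<and>
     homeomorphism (dom_of c) (img_of c) (coord c) (point c)"

definition transition :: "('m, 'n) chart \<Rightarrow> ('m, 'n) chart \<Rightarrow> real ^ 'n \<Rightarrow> real ^ 'n" where
  "transition c d = coord d \<circ> point c"

definition smooth_atlas :: "('m::topological_space, 'n::finite) chart set \<Rightarrow> bool" where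
  "smooth_atlas A \<longleftrightarrow> (\<forall>c\<in>A. is_chart c) \<and> (\<Union>c\<in>A. dom_of c) = UNIV \<and>
     (\<forall>c\<in>A. \<forall>d\<in>A. smooth_on (coord c ` (dom_of c \<inter> dom_of d)) (transition c d))"

definition compact_manifold :: "('m::t2_space, 'n::finite) chart set \<Rightarrow> bool" where
  "compact_manifold A \<longleftrightarrow> compact (UNIV :: 'm set) \<and> smooth_atlas A"

definition smooth_fun :: "('m, 'n::finite) chart set \<Rightarrow> ('m \<Rightarrow> real) \<Rightarrow> bool" where
  "smooth_fun A h \<longleftrightarrow> (\<forall>c\<in>A. smooth_on (img_of c) (h \<circ> point c))"

text \<open>Some chart around \<open>p\<close>; it is used only to evaluate chart-independent local expressions.\<close>

definition chart_at :: "('m, 'n) chart set \<Rightarrow> 'm \<Rightarrow> ('m, 'n) chart" where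
  "chart_at A p = (SOME c. c \<in> A \<and> p \<in> dom_of c)"


section \<open>Tensor fields\<close>

type_synonym ('m, 'n) covector = "('m, 'n) chart \<Rightarrow> 'm \<Rightarrow> real ^ 'n"
type_synonym ('m, 'n) tensor2 = "('m, 'n) chart \<Rightarrow> 'm \<Rightarrow> real ^ 'n ^ 'n"

text \<open>The partial derivative of \<open>h\<close> with respect to the \<open>i\<close>-th coordinate of the chart \<open>c\<close>.\<close>

definition pd :: "('m, 'n::finite) chart \<Rightarrow> 'n \<Rightarrow> ('m \<Rightarrow> real) \<Rightarrow> 'm \<Rightarrow> real" where
  "pd c i h p = frechet_derivative (h \<circ> point c) (at (coord c p)) (axis i 1)"

definition differential :: "('m \<Rightarrow> real) \<Rightarrow> ('m, 'n::finite) covector" where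
  "differential h c p = (\<chi> i. pd c i h p)"

definition outer :: "('m, 'n) covector \<Rightarrow> ('m, 'n) covector \<Rightarrow> ('m, 'n::finite) tensor2" where
  "outer a b c p = (\<chi> i j. a c p $ i * b c p $ j)"

text \<open>
  The transformation law is \<open>T\<^sub>c = J\<^sup>T T\<^sub>d J\<close>, where \<open>J\<close> is the Jacobian matrix of the
  change of coordinates from \<open>c\<close> to \<open>d\<close>.
\<close>

definition is_tensor2 :: "('m, 'n::finite) chart set \<Rightarrow> ('m, 'n) tensor2 \<Rightarrow> bool" where
  "is_tensor2 A T \<longleftrightarrow> (\<forall>c\<in>A. \<forall>d\<in>A. \<forall>p\<in>dom_of c \<inter> dom_of d.
     let J = jacobian (transition c d) (at (coord c p))
     in T c p = transpose J ** T d p ** J)"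

definition riemannian_metric :: "('m, 'n::finite) chart set \<Rightarrow> ('m, 'n) tensor2 \<Rightarrow> bool" where
  "riemannian_metric A g \<longleftrightarrow> is_tensor2 A g \<and>
     (\<forall>c\<in>A. smooth_on (img_of c) (\<lambda>x. g c (point c x)) \<and>
       (\<forall>p\<in>dom_of c. transpose (g c p) = g c p \<and> (\<forall>v. v \<noteq> 0 \<longrightarrow> v \<bullet> (g c p *v v) > 0)))"


section \<open>Local expressions of Riemannian geometry\<close>

definition ginv :: "('m, 'n::finite) tensor2 \<Rightarrow> ('m, 'n) tensor2" where
  "ginv g c p = matrix_inv (g c p)"

text \<open>\<open>christoffel g c k i j p\<close> is \<open>\<Gamma>\<^sup>k\<^sub>i\<^sub>j\<close> at \<open>p\<close>.\<close>

definition christoffel ::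
  "('m, 'n::finite) tensor2 \<Rightarrow> ('m, 'n) chart \<Rightarrow> 'n \<Rightarrow> 'n \<Rightarrow> 'n \<Rightarrow> 'm \<Rightarrow> real" where
  "christoffel g c k i j p = (1/2) * (\<Sum>l\<in>UNIV. ginv g c p $ k $ l *
     (pd c i (\<lambda>q. g c q $ j $ l) p + pd c j (\<lambda>q. g c q $ i $ l) p - pd c l (\<lambda>q. g c q $ i $ j) p))"

text \<open>
  \<open>riemann g c i j k l p\<close> is the \<open>l\<close>-th component of \<open>R(\<partial>\<^sub>i, \<partial>\<^sub>j) \<partial>\<^sub>k\<close>, where
  \<open>R(X, Y) = [\<nabla>\<^sub>X, \<nabla>\<^sub>Y] - \<nabla>\<^bsub>[X, Y]\<^esub>\<close>; the Ricci tensor is \<open>Ric(Y, Z) = tr (X \<mapsto> R(X, Y) Z)\<close>,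
  which is positive definite on round spheres of dimension at least 2.
\<close>

definition riemann ::
  "('m, 'n::finite) tensor2 \<Rightarrow> ('m, 'n) chart \<Rightarrow> 'n \<Rightarrow> 'n \<Rightarrow> 'n \<Rightarrow> 'n \<Rightarrow> 'm \<Rightarrow> real" where
  "riemann g c i j k l p =
     pd c i (christoffel g c l j k) p - pd c j (christoffel g c l i k) p
     + (\<Sum>m\<in>UNIV. christoffel g c m j k p * christoffel g c l i m p
                 - christoffel g c m i k p * christoffel g c l j m p)"

definition ricci :: "('m, 'n::finite) tensor2 \<Rightarrow> ('m, 'n) tensor2" where
  "ricci g c p = (\<chi> j k. \<Sum>i\<in>UNIV. riemann g c i j k i p)"

definition hessian :: "('m, 'n::finite) tensor2 \<Rightarrow> ('m \<Rightarrow> real) \<Rightarrow> ('m, 'n) tensor2" where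
  "hessian g h c p =
     (\<chi> i j. pd c i (pd c j h) p - (\<Sum>k\<in>UNIV. christoffel g c k i j p * pd c k h p))"


section \<open>Scalar functions on the manifold\<close>

definition tr_g ::
  "('m, 'n::finite) chart set \<Rightarrow> ('m, 'n) tensor2 \<Rightarrow> ('m, 'n) tensor2 \<Rightarrow> 'm \<Rightarrow> real" where
  "tr_g A g T p = (let c = chart_at A p in \<Sum>i\<in>UNIV. \<Sum>j\<in>UNIV. ginv g c p $ i $ j * T c p $ i $ j)"

definition tensor_inner :: "('m, 'n::finite) chart set \<Rightarrow> ('m, 'n) tensor2 \<Rightarrow>
    ('m, 'n) tensor2 \<Rightarrow> ('m, 'n) tensor2 \<Rightarrow> 'm \<Rightarrow> real" where
  "tensor_inner A g T U p = (let c = chart_at A p in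
     \<Sum>i\<in>UNIV. \<Sum>j\<in>UNIV. \<Sum>k\<in>UNIV. \<Sum>l\<in>UNIV.
       ginv g c p $ i $ k * ginv g c p $ j $ l * T c p $ i $ j * U c p $ k $ l)"

text \<open>Components \<open>\<nabla>\<^sup>i h = g\<^sup>i\<^sup>j \<partial>\<^sub>j h\<close> of the gradient in the chart \<open>c\<close>.\<close>

definition gradient ::
  "('m, 'n::finite) tensor2 \<Rightarrow> ('m \<Rightarrow> real) \<Rightarrow> ('m, 'n) chart \<Rightarrow> 'm \<Rightarrow> real ^ 'n" where
  "gradient g h c p = ginv g c p *v differential h c p"

definition grad_norm_sq ::
  "('m, 'n::finite) chart set \<Rightarrow> ('m, 'n) tensor2 \<Rightarrow> ('m \<Rightarrow> real) \<Rightarrow> 'm \<Rightarrow> real" where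
  "grad_norm_sq A g h p =
     (let c = chart_at A p in gradient g h c p \<bullet> (g c p *v gradient g h c p))"

definition laplacian ::
  "('m, 'n::finite) chart set \<Rightarrow> ('m, 'n) tensor2 \<Rightarrow> ('m \<Rightarrow> real) \<Rightarrow> 'm \<Rightarrow> real" where
  "laplacian A g h = tr_g A g (hessian g h)"

definition scalar_curvature ::
  "('m, 'n::finite) chart set \<Rightarrow> ('m, 'n) tensor2 \<Rightarrow> 'm \<Rightarrow> real" where
  "scalar_curvature A g = tr_g A g (ricci g)"

definition S_tensor :: "('m, 'n::finite) tensor2 \<Rightarrow> ('m \<Rightarrow> real) \<Rightarrow> ('m, 'n) tensor2" where
  "S_tensor g u c p = ricci g c p - 2 *\<^sub>R outer (differential u) (differential u) c p"

definition S_scalar ::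
  "('m, 'n::finite) chart set \<Rightarrow> ('m, 'n) tensor2 \<Rightarrow> ('m \<Rightarrow> real) \<Rightarrow> 'm \<Rightarrow> real" where
  "S_scalar A g u p = scalar_curvature A g p - 2 * grad_norm_sq A g u p"


section \<open>Integration against the Riemannian volume\<close>

definition partition_of_unity :: "('m::topological_space, 'n::finite) chart set \<Rightarrow>
    nat \<Rightarrow> (nat \<Rightarrow> ('m, 'n) chart) \<Rightarrow> (nat \<Rightarrow> 'm \<Rightarrow> real) \<Rightarrow> bool" where
  "partition_of_unity A N c \<rho> \<longleftrightarrow>
     (\<forall>k<N. c k \<in> A \<and> smooth_fun A (\<rho> k) \<and> (\<forall>p. 0 \<le> \<rho> k p) \<and>
            closure {p. \<rho> k p \<noteq> 0} \<subseteq> dom_of (c k)) \<and>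
     (\<forall>p. (\<Sum>k<N. \<rho> k p) = 1)"

text \<open>
  The integral of \<open>\<phi>\<close> with respect to \<open>dV\<^sub>g\<close>, computed with a finite smooth partition of unity
  subordinate to the atlas. On a compact manifold one exists, and the value for continuous \<open>\<phi>\<close>
  does not depend on which one is used.
\<close>

definition integral_dV :: "('m::topological_space, 'n::finite) chart set \<Rightarrow>
    ('m, 'n) tensor2 \<Rightarrow> ('m \<Rightarrow> real) \<Rightarrow> real" where
  "integral_dV A g \<phi> =
     (let (N, c, \<rho>) = (SOME (N, c, \<rho>). partition_of_unity A N c \<rho>)
      in \<Sum>k<N. (LINT x:img_of (c k)|lborel.
           \<rho> k (point (c k) x) * \<phi> (point (c k) x) * sqrt (det (g (c k) (point (c k) x)))))"


section \<open>The harmonic-Ricci flow\<close>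

text \<open>Families indexed by \<open>t \<in> J\<close> that are smooth jointly in time and space.\<close>

definition smooth_fun_family ::
  "('m, 'n::finite) chart set \<Rightarrow> real set \<Rightarrow> (real \<Rightarrow> 'm \<Rightarrow> real) \<Rightarrow> bool" where
  "smooth_fun_family A J h \<longleftrightarrow> (\<forall>c\<in>A. smooth_on (J \<times> img_of c) (\<lambda>(t, x). h t (point c x)))"

definition smooth_metric_family ::
  "('m, 'n::finite) chart set \<Rightarrow> real set \<Rightarrow> (real \<Rightarrow> ('m, 'n) tensor2) \<Rightarrow> bool" where
  "smooth_metric_family A J g \<longleftrightarrow> (\<forall>t\<in>J. riemannian_metric A (g t)) \<and>
     (\<forall>c\<in>A. smooth_on (J \<times> img_of c) (\<lambda>(t, x). g t c (point c x)))"

text \<open>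
  The time interval \<open>J\<close> may contain its endpoints, where time derivatives are one-sided; at
  interior times \<open>at t within J\<close> is \<open>at t\<close>.
\<close>

definition harmonic_ricci_flow :: "('m, 'n::finite) chart set \<Rightarrow> real set \<Rightarrow>
    (real \<Rightarrow> ('m, 'n) tensor2) \<Rightarrow> (real \<Rightarrow> 'm \<Rightarrow> real) \<Rightarrow> bool" where
  "harmonic_ricci_flow A J g u \<longleftrightarrow>
     smooth_metric_family A J g \<and> smooth_fun_family A J u \<and>
     (\<forall>t\<in>J. \<forall>c\<in>A. \<forall>p\<in>dom_of c.
        ((\<lambda>s. g s c p) has_vector_derivative
           (-2) *\<^sub>R ricci (g t) c p + 4 *\<^sub>R outer (differential (u t)) (differential (u t)) c p)
        (at t within J)) \<and>
     (\<forall>t\<in>J. \<forall>p. ((\<lambda>s. u s p) has_real_derivative laplacian A (g t) (u t) p) (at t within J))"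

definition eigenfunction :: "('m, 'n::finite) chart set \<Rightarrow> ('m, 'n) tensor2 \<Rightarrow>
    real \<Rightarrow> ('m \<Rightarrow> real) \<Rightarrow> bool" where
  "eigenfunction A g \<mu> h \<longleftrightarrow> smooth_fun A h \<and> (\<exists>p. h p \<noteq> 0) \<and>
     (\<forall>p. - laplacian A g h p = \<mu> * h p)"


section \<open>The trace of the tensor S\<close>

lemma sum_mult_matrix_vector:
  fixes B :: "real ^ 'n ^ 'n"
  shows "(\<Sum>i\<in>UNIV. \<Sum>j\<in>UNIV. B $ i $ j * (a $ i * a $ j)) = a \<bullet> (B *v a)"
  by (simp add: inner_vec_def matrix_vector_mult_def sum_distrib_left mult_ac)

lemma S_scalar_eq_trace:
  assumes "invertible (g (chart_at A p) p)"
  shows "S_scalar A g u p = tr_g A g (S_tensor g u) p"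
proof -
  let ?c = "chart_at A p"
  have inv: "g ?c p ** matrix_inv (g ?c p) = mat 1"
    using someI_ex[OF assms[unfolded invertible_def]] by (simp add: matrix_inv_def)
  have "g ?c p *v (ginv g ?c p *v differential u ?c p) = differential u ?c p"
    by (simp add: inv ginv_def matrix_vector_mul_assoc)
  hence *: "grad_norm_sq A g u p = differential u ?c p \<bullet> (ginv g ?c p *v differential u ?c p)"
    by (simp add: grad_norm_sq_def gradient_def Let_def inner_commute)
  show ?thesis
    unfolding S_scalar_def * sum_mult_matrix_vector[symmetric]
    by (simp add: scalar_curvature_def tr_g_def S_tensor_def outer_def Let_def
        right_diff_distrib sum_subtractf sum_distrib_left mult_ac)
qed

end

theory Submission
  imports Defs
begin

text \<open>
  The two weak forms of the eigenvalue equation at the times \<open>s\<close> and \<open>t\<close> can be tested against each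
  other's eigenfunction. Integration by parts gives
  \<open>\<lambda>(s) \<integral> f(t) f(s) dV\<^sub>s = \<integral> \<langle>df(t), df(s)\<rangle>\<^sub>s dV\<^sub>s\<close> and
  \<open>\<lambda>(t) \<integral> f(s) f(t) dV\<^sub>t = \<integral> \<langle>df(s), df(t)\<rangle>\<^sub>t dV\<^sub>t\<close>. In the difference of the two identities
  the same pair of functions occurs at both metrics, so after division by \<open>s - t\<close> only \<open>\<lambda>\<close>, the
  volume density and the inverse metric are differentiated, while \<open>f(s)\<close> and its first spatial
  derivatives merely converge. This is the content of \<open>eigenvalue_variation\<close>; it avoids the time
  derivative of \<open>f\<close> and the exchange of mixed derivatives that the usual computation needs. The
  equation for the metric says \<open>\<partial>\<^sub>t g = - 2 \<S>\<close>, hence \<open>\<partial>\<^sub>t dV = - S dV\<close> and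
  \<open>\<partial>\<^sub>t g\<^sup>i\<^sup>j = 2 \<S>\<^sup>i\<^sup>j\<close>, and the limit is the asserted formula.

  The limit is taken under the integral in each chart, by dominated convergence on the compact support
  of a cut-off function. Coefficients that are smooth on time times chart are Lipschitz in time,
  uniformly on compact sets (\<open>smooth_on_Lipschitz_in_time\<close>), which bounds the difference quotients.

  The geometric ingredient is \<open>Green_identity\<close>, \<open>\<integral> b \<Delta>a dV = - \<integral> \<langle>db, da\<rangle> dV\<close> on a compact manifold. In
  a chart the Laplacian is a divergence (\<open>divergence_flux\<close>), and the integral of a derivative of a
  compactly supported function vanishes by translation invariance. Passing from charts to the manifold
  uses a partition of unity, built from bump functions, and the invariance of the chart integrals under
  a change of coordinates (\<open>chart_integral_change\<close>). The Laplacian is evaluated in an arbitrary chart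
  around each point; that the chart does not matter follows from integration by parts in the charts and
  testing against bump functions (\<open>chart_laplacian_change\<close>), without transforming Christoffel symbols.
\<close>

section \<open>Calculus of k times differentiable maps\<close>

lemma C_on_cong:
  assumes "open S" "\<And>x. x \<in> S \<Longrightarrow> f x = g x" "C_on k S f"
  shows "C_on k S g"
  using assms(2,3)
proof (induction k arbitrary: f g)
  case 0
  then show ?case by (simp cong: continuous_on_cong)
next
  case (Suc k)
  have d: "(g has_derivative frechet_derivative f (at x)) (at x)" if "x \<in> S" for x
  proof -
    have "(f has_derivative frechet_derivative f (at x)) (at x)"
      using Suc.prems that by (simp add: frechet_derivative_works[symmetric])
    then show ?thesis
      using has_derivative_transform_within_open[OF _ assms(1) that, of f _ UNIV g] Suc.prems(1) by auto
  qed
  then have e: "frechet_derivative g (at x) = frechet_derivative f (at x)" if "x \<in> S" for x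
    using frechet_derivative_at that by metis
  have "C_on k S (\<lambda>x. frechet_derivative g (at x) v)" for v
    by (rule Suc.IH[of "\<lambda>x. frechet_derivative f (at x) v"]) (use Suc.prems e in auto)
  then show ?case using d by (auto simp: differentiable_def)
qed

lemma C_on_subset: "C_on k S f \<Longrightarrow> T \<subseteq> S \<Longrightarrow> C_on k T f"
  by (induction k arbitrary: f) (auto intro: continuous_on_subset)

lemma C_on_imp_continuous_on:
  assumes "C_on k S f" shows "continuous_on S f"
proof (cases k)
  case (Suc m)
  then have "isCont f x" if "x \<in> S" for x
    using assms that by (simp add: differentiable_imp_continuous_within)
  then show ?thesis by (simp add: continuous_at_imp_continuous_on)
qed (use assms in simp)

lemma C_on_SucD: "C_on (Suc k) S f \<Longrightarrow> C_on k S f"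
proof (induction k arbitrary: f)
  case 0
  then show ?case using C_on_imp_continuous_on[of "Suc 0" S f] by simp
next
  case (Suc k)
  from Suc.prems have "C_on (Suc k) S (\<lambda>x. frechet_derivative f (at x) v)" for v
    unfolding C_on.simps(2)[of "Suc k"] by blast
  then have "C_on k S (\<lambda>x. frechet_derivative f (at x) v)" for v
    by (rule Suc.IH)
  with Suc.prems show ?case by simp
qed

lemma C_on_differentiable: "C_on (Suc k) S f \<Longrightarrow> x \<in> S \<Longrightarrow>
   (f has_derivative frechet_derivative f (at x)) (at x)"
  by (simp add: frechet_derivative_works[symmetric])

lemma C_on_SucI:
  assumes "open S" "\<And>x. x \<in> S \<Longrightarrow> (f has_derivative f' x) (at x)" "\<And>v. C_on k S (\<lambda>x. f' x v)"
  shows "C_on (Suc k) S f"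
proof -
  have "frechet_derivative f (at x) = f' x" if "x \<in> S" for x
    using assms(2)[OF that] frechet_derivative_at by metis
  then have "C_on k S (\<lambda>x. frechet_derivative f (at x) v)" for v
    by (intro C_on_cong[OF assms(1) _ assms(3)]) simp
  with assms(2) show ?thesis by (auto simp: differentiable_def)
qed

text \<open>
  Differentiability of order \<open>k\<close> is a local property. This is what makes functions that are given by
  different formulas on overlapping open sets smooth, such as a bump function extended by zero.
\<close>

lemma C_on_local:
  assumes "\<And>x. x \<in> S \<Longrightarrow> \<exists>N. open N \<and> x \<in> N \<and> C_on k N f"
  shows "C_on k S f"
  using assms
proof (induction k arbitrary: f)
  case 0
  show ?case unfolding C_on.simps
  proof (rule continuous_at_imp_continuous_on, rule ballI)
    fix x assume "x \<in> S"
    then obtain N where "open N" "x \<in> N" "continuous_on N f" using 0 by auto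
    then show "isCont f x" by (simp add: continuous_on_eq_continuous_at)
  qed
next
  case (Suc k)
  have "f differentiable at x" if "x \<in> S" for x using Suc.prems[OF that] by auto
  moreover have "C_on k S (\<lambda>x. frechet_derivative f (at x) v)" for v
    by (rule Suc.IH) (use Suc.prems in \<open>auto; blast\<close>)
  ultimately show ?case by auto
qed

lemma C_on_const [simp]: "C_on k S (\<lambda>x. c)"
  by (induction k arbitrary: c) (auto simp: frechet_derivative_const)

lemma C_on_bounded_linear:
  assumes "bounded_linear f" shows "C_on k S f"
proof (cases k)
  case 0
  then show ?thesis using assms by (simp add: linear_continuous_on)
next
  case (Suc m)
  have "(f has_derivative f) (at x)" for x
    by (rule bounded_linear_imp_has_derivative[OF assms])
  then have "frechet_derivative f (at x) = f" for x using frechet_derivative_at by metis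
  then show ?thesis using Suc assms by (simp add: bounded_linear_imp_differentiable)
qed

lemma C_on_add:
  assumes "open S" shows "C_on k S f \<Longrightarrow> C_on k S g \<Longrightarrow> C_on k S (\<lambda>x. f x + g x)"
proof (induction k arbitrary: f g)
  case (Suc k)
  show ?case
    by (rule C_on_SucI[OF assms has_derivative_add[OF C_on_differentiable[OF Suc.prems(1)] C_on_differentiable[OF Suc.prems(2)]]])
       (use Suc in auto)
qed (simp add: continuous_on_add)

lemma C_on_sum:
  assumes "open S" "finite I" "\<And>i. i \<in> I \<Longrightarrow> C_on k S (f i)"
  shows "C_on k S (\<lambda>x. \<Sum>i\<in>I. f i x)"
  using assms(2,3) by (induction I) (auto intro: C_on_add[OF assms(1)])

lemma (in bounded_bilinear) C_on_prod:
  fixes f :: "'d::euclidean_space \<Rightarrow> 'a" and g :: "'d \<Rightarrow> 'b"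
  assumes "open S" shows "C_on k S f \<Longrightarrow> C_on k S g \<Longrightarrow> C_on k S (\<lambda>x. f x ** g x)"
proof (induction k arbitrary: f g)
  case 0 then show ?case by (simp add: continuous_on)
next
  case (Suc k)
  have "C_on k S (\<lambda>x. f x ** frechet_derivative g (at x) v + frechet_derivative f (at x) v ** g x)" for v
    using Suc.prems by (intro C_on_add assms Suc.IH C_on_SucD[OF Suc.prems(1)] C_on_SucD[OF Suc.prems(2)]) auto
  from C_on_SucI[OF assms FDERIV[OF C_on_differentiable[OF Suc.prems(1)] C_on_differentiable[OF Suc.prems(2)]] this]
  show ?case by simp
qed

lemmas C_on_mult = bounded_bilinear.C_on_prod[OF bounded_bilinear_mult]
lemmas C_on_scaleR = bounded_bilinear.C_on_prod[OF bounded_bilinear_scaleR]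
lemmas C_on_inner = bounded_bilinear.C_on_prod[OF bounded_bilinear_inner]

lemma C_on_uminus:
  assumes "open S" "C_on k S f" shows "C_on k S (\<lambda>x. - f x)"
  using C_on_scaleR[OF assms(1) C_on_const[of k S "-1"] assms(2)] by simp

lemma C_on_diff:
  assumes "open S" "C_on k S f" "C_on k S g" shows "C_on k S (\<lambda>x. f x - g x)"
  using C_on_add[OF assms(1,2) C_on_uminus[OF assms(1,3)]] by simp

lemma C_on_prod_set:
  fixes f :: "'i \<Rightarrow> 'a::euclidean_space \<Rightarrow> real"
  assumes "open S" "finite I" "\<And>i. i \<in> I \<Longrightarrow> C_on k S (f i)"
  shows "C_on k S (\<lambda>x. \<Prod>i\<in>I. f i x)"
  using assms(2,3) by (induction I) (auto intro: C_on_mult[OF assms(1)])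

text \<open>
  By the chain rule, a directional derivative of \<open>f \<circ> g\<close> is the sum over a basis of the products of a
  component of the derivative of \<open>g\<close> with a partial derivative of \<open>f\<close> composed with \<open>g\<close>. Each factor
  is one degree less differentiable, so closure under sums and products carries the induction.
\<close>

lemma C_on_compose:
  fixes f :: "'b::euclidean_space \<Rightarrow> 'c::real_normed_vector" and g :: "'a::euclidean_space \<Rightarrow> 'b"
  assumes "open S" "open T" "g ` S \<subseteq> T"
  shows "C_on k T f \<Longrightarrow> C_on k S g \<Longrightarrow> C_on k S (\<lambda>x. f (g x))"
proof (induction k arbitrary: f)
  case 0
  then show ?case using assms(3) by (auto intro: continuous_on_compose2)
next
  case (Suc k)
  have d: "((\<lambda>x. f (g x)) has_derivative
    (\<lambda>v. \<Sum>b\<in>Basis. (frechet_derivative g (at x) v \<bullet> b) *\<^sub>R frechet_derivative f (at (g x)) b)) (at x)"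
    if "x \<in> S" for x
  proof -
    have gT: "g x \<in> T" using assms that by auto
    have df: "(f has_derivative frechet_derivative f (at (g x))) (at (g x))"
      using C_on_differentiable[OF Suc.prems(1) gT] .
    interpret bounded_linear "frechet_derivative f (at (g x))"
      using df by (rule has_derivative_bounded_linear)
    have "frechet_derivative f (at (g x)) w =
        (\<Sum>b\<in>Basis. (w \<bullet> b) *\<^sub>R frechet_derivative f (at (g x)) b)" for w
    proof -
      have "frechet_derivative f (at (g x)) (\<Sum>b\<in>Basis. (w \<bullet> b) *\<^sub>R b) =
        (\<Sum>b\<in>Basis. (w \<bullet> b) *\<^sub>R frechet_derivative f (at (g x)) b)" by (simp add: sum scaleR)
      then show ?thesis by (simp add: euclidean_representation)
    qed
    then have "(\<lambda>v. frechet_derivative f (at (g x)) (frechet_derivative g (at x) v)) =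
      (\<lambda>v. \<Sum>b\<in>Basis. (frechet_derivative g (at x) v \<bullet> b) *\<^sub>R frechet_derivative f (at (g x)) b)"
      by (intro ext)
    then show ?thesis
      using has_derivative_compose[OF C_on_differentiable[OF Suc.prems(2) that] df] by (simp only:)
  qed
  show ?case
  proof (rule C_on_SucI[OF assms(1) d])
    show "C_on k S (\<lambda>x. \<Sum>b\<in>Basis. (frechet_derivative g (at x) v \<bullet> b) *\<^sub>R
       frechet_derivative f (at (g x)) b)" for v
      using Suc.prems by (intro C_on_sum C_on_scaleR C_on_inner assms(1) finite_Basis C_on_const Suc.IH
        C_on_SucD[OF Suc.prems(2)]) auto
  qed
qed

text \<open>
  The derivatives of the reciprocal and of the square root are, up to constants, products of these
  functions themselves, so the induction on the order rests on closure under products.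
\<close>

lemma C_on_inverse: "C_on k {x::real. x \<noteq> 0} inverse"
proof (induction k)
  case 0 then show ?case by (auto intro!: continuous_intros)
next
  case (Suc k)
  have o: "open {x::real. x \<noteq> 0}" using open_delete[OF open_UNIV] by (simp add: Compl_eq_Diff_UNIV[symmetric] Collect_neg_eq)
  show ?case
    by (rule C_on_SucI[OF o, where f'="\<lambda>x v. - (inverse x * v * inverse x)"])
      (use Suc in \<open>auto intro!: has_derivative_inverse' C_on_uminus C_on_mult o\<close>)
qed

lemma C_on_sqrt: "C_on k {0::real<..} sqrt"
proof (induction k)
  case 0 then show ?case by (auto intro!: continuous_intros)
next
  case (Suc k)
  have "(sqrt has_derivative (\<lambda>v. (inverse 2 * (sqrt x * inverse x)) * v)) (at x)" if "x > 0" for x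
  proof -
    have "inverse 2 * (sqrt x * inverse x) = inverse (sqrt x) / 2"
      using that by (simp add: divide_simps)
    then show ?thesis using DERIV_real_sqrt[OF that] by (simp only: has_field_derivative_def)
  qed
  moreover have "C_on k {0<..} (inverse :: real \<Rightarrow> real)"
    by (rule C_on_subset[OF C_on_inverse]) auto
  ultimately show ?case
    by (intro C_on_SucI[where f'="\<lambda>x v. (inverse 2 * (sqrt x * inverse x)) * v"])
      (simp, simp only: greaterThan_iff, intro C_on_mult C_on_const Suc open_greaterThan)
qed

text \<open>
  For \<open>n = 0\<close> this is the classical smooth function that is flat at the origin. The other members are
  there because the family is closed under differentiation up to linear combinations, which makes
  smoothness an induction on the order for all \<open>n\<close> at once.
\<close>

definition flat_exp :: "nat \<Rightarrow> real \<Rightarrow> real" where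
  "flat_exp n x = (if x > 0 then inverse x ^ n * exp (- inverse x) else 0)"

lemma flat_exp_tendsto_0: "(flat_exp n \<longlongrightarrow> 0) (at 0)"
proof -
  have l: "((\<lambda>x. inverse x ^ n * exp (- inverse x)) \<longlongrightarrow> 0) (at_right (0::real))"
    using filterlim_compose[OF tendsto_power_div_exp_0[of n] filterlim_inverse_at_top_right]
    by (simp add: exp_minus divide_inverse)
  have "(flat_exp n \<longlongrightarrow> 0) (at_right 0)"
    by (rule tendsto_cong[THEN iffD1, OF _ l]) (auto simp: flat_exp_def eventually_at_filter)
  moreover have "(flat_exp n \<longlongrightarrow> 0) (at_left 0)"
    by (rule tendsto_cong[THEN iffD1, OF _ tendsto_const]) (auto simp: flat_exp_def eventually_at_filter)
  ultimately show ?thesis using filterlim_split_at by blast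
qed

lemma DERIV_flat_exp:
  "(flat_exp n has_real_derivative flat_exp (n + 2) x - n * flat_exp (Suc n) x) (at x)"
proof -
  consider "x > 0" | "x < 0" | "x = 0" by linarith
  then show ?thesis
  proof cases
    case 1
    have "((\<lambda>x. inverse x ^ n * exp (- inverse x)) has_real_derivative
       flat_exp (n + 2) x - n * flat_exp (Suc n) x) (at x)"
      using 1 by (cases n) (auto intro!: derivative_eq_intros simp: flat_exp_def algebra_simps power2_eq_square,
          metis One_nat_def Suc_pred neq0_conv power_Suc)
    moreover have "inverse y ^ n * exp (- inverse y) = flat_exp n y" if "y \<in> {0<..}" for y
      using that by (simp add: flat_exp_def)
    ultimately show ?thesis
      using has_field_derivative_transform_within_open[of _ _ x "{0<..}" "flat_exp n"] 1 by simp
  next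
    case 2
    have "((\<lambda>x. 0) has_real_derivative flat_exp (n + 2) x - n * flat_exp (Suc n) x) (at x)"
      using 2 by (simp add: flat_exp_def)
    moreover have "0 = flat_exp n y" if "y \<in> {..<0}" for y
      using that by (simp add: flat_exp_def)
    ultimately show ?thesis
      using has_field_derivative_transform_within_open[of _ _ x "{..<0}" "flat_exp n"] 2 by simp
  next
    case 3
    have "(flat_exp n (0 + h) - flat_exp n 0) / h = flat_exp (Suc n) h" for h
      by (simp add: flat_exp_def divide_inverse)
    moreover have "flat_exp (n + 2) 0 - n * flat_exp (Suc n) 0 = 0"
      by (simp add: flat_exp_def)
    ultimately show ?thesis
      unfolding DERIV_def 3 using flat_exp_tendsto_0[of "Suc n"] by presburger
  qed
qed

lemma C_on_flat_exp: "C_on k UNIV (flat_exp n)"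
proof (induction k arbitrary: n)
  case 0 then show ?case using DERIV_flat_exp by (auto intro!: continuous_at_imp_continuous_on DERIV_isCont)
next
  case (Suc k)
  show ?case
    by (rule C_on_SucI[OF open_UNIV DERIV_flat_exp[unfolded has_field_derivative_def]])
      (intro C_on_mult C_on_diff Suc C_on_const open_UNIV)
qed

lemma smooth_on_open:
  assumes "open S"
  shows "smooth_on S f \<longleftrightarrow> (\<forall>k. C_on k S f)"
proof
  assume L: "smooth_on S f"
  show "\<forall>k. C_on k S f"
  proof (intro allI C_on_local)
    fix k x assume "x \<in> S"
    then obtain N F where N: "open N" "x \<in> N" "\<forall>k. C_on k N F" "\<forall>y\<in>S \<inter> N. F y = f y"
      using L unfolding smooth_on_def by blast
    have "C_on k (S \<inter> N) f"
      by (rule C_on_cong[of _ F]) (use N assms in \<open>auto intro: C_on_subset\<close>)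
    then show "\<exists>N. open N \<and> x \<in> N \<and> C_on k N f" using N \<open>x \<in> S\<close> assms by blast
  qed
qed (use assms in \<open>auto simp: smooth_on_def\<close>)

text \<open>
  On sets that are not open, such as a time interval with end points times a chart, the outer function
  is composed with a local smooth extension; its domain is shrunk so that the extension still has
  values in \<open>V\<close>.
\<close>

lemma smooth_on_compose:
  fixes f :: "'a::euclidean_space \<Rightarrow> 'b::euclidean_space"
  assumes "smooth_on S f" "open V" "\<And>k. C_on k V \<Phi>" "f ` S \<subseteq> V"
  shows "smooth_on S (\<lambda>x. \<Phi> (f x))"
  unfolding smooth_on_def
proof
  fix x assume x: "x \<in> S"
  then obtain N F where N: "open N" "x \<in> N" "\<forall>k. C_on k N F" "\<forall>y\<in>S \<inter> N. F y = f y"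
    using assms(1) unfolding smooth_on_def by blast
  have c: "continuous_on N F" using N C_on.simps(1) by blast
  have o: "open (N \<inter> F -` V)" using continuous_open_preimage[OF c N(1) assms(2)] .
  have "C_on k (N \<inter> F -` V) (\<lambda>y. \<Phi> (F y))" for k
    by (rule C_on_compose[OF o assms(2) _ assms(3)]) (use N in \<open>auto intro: C_on_subset\<close>)
  moreover have "x \<in> N \<inter> F -` V" using x N assms(4) by auto
  ultimately show "\<exists>N F. open N \<and> x \<in> N \<and> (\<forall>k. C_on k N F) \<and> (\<forall>y\<in>S \<inter> N. F y = \<Phi> (f y))"
    using o N(4) by (intro exI[of _ "N \<inter> F -` V"] exI[of _ "\<lambda>y. \<Phi> (F y)"]) auto
qed

section \<open>Determinant and inverse of a matrix as functions of the matrix\<close>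

lemma C_on_entry: "C_on k S (\<lambda>A::real^'n^'m. A $ i $ j)"
  by (rule C_on_bounded_linear[OF bounded_linear_compose[OF bounded_linear_vec_nth bounded_linear_vec_nth]])

lemma C_on_det: 
  fixes f :: "'a::euclidean_space \<Rightarrow> real^'n^'n"
  assumes "open S" "\<And>i j. C_on k S (\<lambda>x. f x $ i $ j)"
  shows "C_on k S (\<lambda>x. det (f x))"
  unfolding det_def
  by (intro C_on_sum C_on_mult C_on_const C_on_prod_set assms finite_permutations finite) 

lemma matrix_inv_inverse:
  fixes A :: "real^'n^'n"
  assumes "det A \<noteq> 0"
  shows "A ** matrix_inv A = mat 1" "matrix_inv A ** A = mat 1"
proof -
  have "\<exists>B. A ** B = mat 1 \<and> B ** A = mat 1"
    using assms by (simp add: invertible_det_nz[symmetric] invertible_def)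
  from someI_ex[OF this] show "A ** matrix_inv A = mat 1" "matrix_inv A ** A = mat 1"
    unfolding matrix_inv_def by auto
qed

text \<open>
  Cramer's rule for the columns of the inverse. It exhibits the entries of the inverse as rational
  functions of the matrix, hence as smooth functions.
\<close>

lemma matrix_inv_entry:
  fixes A :: "real^'n^'n"
  assumes "det A \<noteq> 0"
  shows "matrix_inv A $ k $ j =
    det (\<chi> i l. if l = k then (if i = j then 1 else 0) else A $ i $ l) * inverse (det A)"
proof -
  have "A *v (matrix_inv A *v axis j 1) = axis j 1"
    by (simp add: matrix_vector_mul_assoc matrix_inv_inverse[OF assms])
  then have "matrix_inv A *v axis j 1 = (\<chi> k. det (\<chi> i l. if l = k then axis j 1 $ i else A $ i $ l) / det A)"
    using cramer[OF assms] by blast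
  then have 1: "(matrix_inv A *v axis j 1) $ k = det (\<chi> i l. if l = k then axis j 1 $ i else A $ i $ l) / det A"
    by simp
  have 2: "(matrix_inv A *v axis j 1) $ k = matrix_inv A $ k $ j"
    by (simp add: matrix_vector_mult_basis column_def)
  have 3: "axis j (1::real) $ i = (if i = j then 1 else 0)" for i
    by (simp add: axis_def)
  show ?thesis using 1 unfolding 2 3 divide_inverse .
qed

lemma open_det_pos: "open {A::real^'n^'n. det A > 0}"
  using open_Collect_less[OF continuous_on_const C_on_imp_continuous_on[OF C_on_det[OF open_UNIV C_on_entry]]] .

lemma open_nonzero: "open {x::real. x \<noteq> 0}"
  by (intro open_Collect_neq continuous_intros)

lemma C_on_matrix_inv:
  "C_on k {A::real^'n^'n. det A > 0} (\<lambda>A. matrix_inv A $ i $ j)"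
proof (rule C_on_cong[OF open_det_pos])
  fix A :: "real^'n^'n" assume "A \<in> {A. det A > 0}"
  then show "det (\<chi> m l. if l = i then (if m = j then 1 else 0) else A $ m $ l) * inverse (det A) =
    matrix_inv A $ i $ j" by (simp add: matrix_inv_entry)
next
  have "C_on k {A::real^'n^'n. det A > 0} (\<lambda>A. (\<chi> m l. if l = i then (if m = j then 1 else 0) else A $ m $ l) $ p $ q)"
    for p q by (cases "q = i") (simp_all add: C_on_entry)
  then show "C_on k {A::real^'n^'n. det A > 0}
    (\<lambda>A. det (\<chi> m l. if l = i then (if m = j then 1 else 0) else A $ m $ l) * inverse (det A))"
    by (intro C_on_mult open_det_pos C_on_det
        C_on_compose[OF open_det_pos open_nonzero _ C_on_inverse] C_on_entry) auto
qed

lemma C_on_sqrt_det: "C_on k {A::real^'n^'n. det A > 0} (\<lambda>A. sqrt (det A))"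
  by (rule C_on_compose[OF open_det_pos open_greaterThan _ C_on_sqrt])
     (auto intro!: C_on_det open_det_pos C_on_entry)

text \<open>
  The segment from the identity to a positive definite matrix consists of positive definite, hence
  invertible, matrices; the determinant does not vanish along it and starts at 1.
\<close>

lemma pos_def_det_pos:
  fixes A :: "real^'n^'n"
  assumes pd: "\<And>v. v \<noteq> 0 \<Longrightarrow> v \<bullet> (A *v v) > 0"
  shows "det A > 0"
proof -
  define B where "B s = s *\<^sub>R A + (1 - s) *\<^sub>R (mat 1 :: real^'n^'n)" for s :: real
  have nz: "det (B s) \<noteq> 0" if "0 \<le> s" "s \<le> 1" for s
  proof
    assume "det (B s) = 0"
    then have "\<not> invertible (B s)" by (simp add: invertible_det_nz)
    then obtain v where v: "v \<noteq> 0" "B s *v v = 0"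
      using invertible_left_inverse matrix_left_invertible_ker by metis
    have "v \<bullet> (B s *v v) = s * (v \<bullet> (A *v v)) + (1 - s) * (v \<bullet> v)"
      by (simp add: B_def matrix_vector_mult_add_rdistrib scaleR_matrix_vector_assoc[symmetric] inner_add_right)
    moreover have "\<dots> > 0"
    proof (cases "s = 0")
      case False
      then show ?thesis using pd[OF v(1)] that v by (intro add_pos_nonneg mult_pos_pos mult_nonneg_nonneg) auto
    qed (use v in simp)
    ultimately show False using v by simp
  qed
  have "continuous_on {0..1} (\<lambda>s. det (B s))"
    unfolding B_def det_def by (auto intro!: continuous_intros)
  moreover have "det (B 0) = 1" "det (B 1) = det A" by (simp_all add: B_def)
  ultimately show ?thesis
    using IVT2'[of "\<lambda>s. det (B s)" 1 0 0] nz by (force simp: not_less)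
qed

text \<open>
  A permutation other than the identity moves at least two indices. So each of its products contains
  an off-diagonal entry even after one factor has been differentiated, and vanishes at the identity
  matrix. The identity permutation contributes the trace.
\<close>

lemma det_derivative_at_mat_1:
  fixes B :: "real \<Rightarrow> real^'n^'n"
  assumes "\<And>i j. ((\<lambda>s. B s $ i $ j) has_real_derivative B' $ i $ j) (at t within J)" "B t = mat 1"
  shows "((\<lambda>s. det (B s)) has_real_derivative trace B') (at t within J)"
proof -
  let ?U = "UNIV :: 'n set"
  have "((\<lambda>s. det (B s)) has_derivative (\<lambda>h. \<Sum>p | p permutes ?U. of_int (sign p) *
      (\<Sum>i\<in>?U. (B' $ i $ p i * h) * (\<Prod>j\<in>?U - {i}. B t $ j $ p j)))) (at t within J)"
    unfolding det_def
    by (intro has_derivative_sum has_derivative_mult_right has_derivative_prod)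
       (use assms(1) in \<open>simp add: has_field_derivative_def\<close>)
  moreover have "(\<Sum>p | p permutes ?U. of_int (sign p) *
      (\<Sum>i\<in>?U. (B' $ i $ p i * h) * (\<Prod>j\<in>?U - {i}. B t $ j $ p j))) = trace B' * h" for h
  proof -
    have 0: "(\<Sum>i\<in>?U. (B' $ i $ p i * h) * (\<Prod>j\<in>?U - {i}. B t $ j $ p j)) = 0"
      if p: "p permutes ?U" "p \<noteq> id" for p
    proof (rule sum.neutral, rule ballI)
      fix i
      obtain a where a: "p a \<noteq> a" using p(2) by fastforce
      have "\<exists>j. j \<noteq> i \<and> p j \<noteq> j"
      proof (cases "a = i")
        case True
        have "p (p a) \<noteq> p a" using a permutes_inj[OF p(1)] by (metis injD)
        then show ?thesis using a True by metis
      qed (use a in auto)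
      then obtain j where "j \<noteq> i" "p j \<noteq> j" by blast
      then have "(\<Prod>j\<in>?U - {i}. B t $ j $ p j) = 0"
        by (intro prod_zero bexI[of _ j]) (auto simp: assms(2) mat_def)
      then show "(B' $ i $ p i * h) * (\<Prod>j\<in>?U - {i}. B t $ j $ p j) = 0" by simp
    qed
    have "(\<Sum>p | p permutes ?U. of_int (sign p) *
      (\<Sum>i\<in>?U. (B' $ i $ p i * h) * (\<Prod>j\<in>?U - {i}. B t $ j $ p j))) =
      (\<Sum>p\<in>{id}. of_int (sign p) *
      (\<Sum>i\<in>?U. (B' $ i $ p i * h) * (\<Prod>j\<in>?U - {i}. B t $ j $ p j)))"
      by (rule sum.mono_neutral_right) (auto simp: 0 permutes_id finite_permutations)
    also have "\<dots> = trace B' * h"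
      by (simp add: assms(2) mat_def trace_def sum_distrib_right sign_id)
    finally show ?thesis .
  qed
  ultimately show ?thesis by (simp add: has_field_derivative_def)
qed

text \<open>
  Jacobi's formula reduces to the identity matrix by factoring \<open>M t\<close> out of the determinant.
\<close>

lemma det_derivative:
  fixes M :: "real \<Rightarrow> real^'n^'n"
  assumes M: "\<And>i j. ((\<lambda>s. M s $ i $ j) has_real_derivative M' $ i $ j) (at t within J)"
    and nz: "det (M t) \<noteq> 0"
  shows "((\<lambda>s. det (M s)) has_real_derivative det (M t) * trace (matrix_inv (M t) ** M')) (at t within J)"
proof -
  define N where "N = matrix_inv (M t)"
  have N: "M t ** N = mat 1" "N ** M t = mat 1" using matrix_inv_inverse[OF nz] by (auto simp: N_def)
  have "((\<lambda>s. det (N ** M s)) has_real_derivative trace (N ** M')) (at t within J)"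
    by (rule det_derivative_at_mat_1)
       (auto simp: matrix_matrix_mult_def N[unfolded matrix_matrix_mult_def] mult.commute intro!: derivative_eq_intros M)
  then have "((\<lambda>s. det (M t) * det (N ** M s)) has_real_derivative det (M t) * trace (N ** M')) (at t within J)"
    by (rule DERIV_cmult)
  moreover have "det (M t) * det (N ** M s) = det (M s)" for s
    by (metis N(1) det_mul matrix_mul_assoc matrix_mul_lid)
  ultimately show ?thesis by (simp add: N_def)
qed

text \<open>
  The limit of the resolvent identity \<open>B\<inverse> - A\<inverse> = - B\<inverse> (B - A) A\<inverse>\<close>, divided by the increment of time.
\<close>

lemma matrix_inv_derivative:
  fixes M :: "real \<Rightarrow> real^'n^'n"
  assumes M: "\<And>i j. ((\<lambda>s. M s $ i $ j) has_real_derivative M' $ i $ j) (at t within J)"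
    and pos: "\<And>s. s \<in> J \<Longrightarrow> det (M s) > 0" and t: "t \<in> J"
  shows "((\<lambda>s. matrix_inv (M s) $ a $ b) has_real_derivative
     - (matrix_inv (M t) ** M' ** matrix_inv (M t)) $ a $ b) (at t within J)"
proof -
  let ?N = "\<lambda>s. matrix_inv (M s)"
  have cM: "continuous (at t within J) M"
  proof -
    have "((\<lambda>s. M s $ i $ j) \<longlongrightarrow> M t $ i $ j) (at t within J)" for i j
      using DERIV_continuous[OF M] by (simp add: continuous_within)
    then show ?thesis unfolding continuous_within by (intro vec_tendstoI) simp
  qed
  have cN: "((\<lambda>s. ?N s $ a $ l) \<longlongrightarrow> ?N t $ a $ l) (at t within J)" for l
  proof -
    have "continuous (at (M t)) (\<lambda>A. matrix_inv A $ a $ l)"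
      using C_on_imp_continuous_on[OF C_on_matrix_inv[of 0]] pos[OF t]
        continuous_on_eq_continuous_at[OF open_det_pos] by blast
    then show ?thesis
      using continuous_within_compose3[of M t "\<lambda>A. matrix_inv A $ a $ l" J, OF _ cM] 
      by (simp add: continuous_within)
  qed
  have eq: "?N s $ a $ b - ?N t $ a $ b =
     - (\<Sum>m\<in>UNIV. (\<Sum>l\<in>UNIV. ?N s $ a $ l * (M s $ l $ m - M t $ l $ m)) * ?N t $ m $ b)" if "s \<in> J" for s
  proof -
    have ml: "A ** (B - C) = A ** B - A ** C" and mr: "(B - C) ** A = B ** A - C ** A"
      for A B C :: "real^'n^'n"
      by (simp_all add: matrix_matrix_mult_def vec_eq_iff sum_subtractf right_diff_distrib left_diff_distrib)
    have "?N s ** (M s - M t) ** ?N t = ?N t - ?N s"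
      using matrix_inv_inverse[of "M s"] matrix_inv_inverse[of "M t"] pos[OF that] pos[OF t]
      by (simp add: ml mr matrix_mul_assoc[symmetric])
    then have "?N t $ a $ b - ?N s $ a $ b = (?N s ** (M s - M t) ** ?N t) $ a $ b" by simp
    then show ?thesis by (simp add: matrix_matrix_mult_def)
  qed
  have "((\<lambda>s. - (\<Sum>m\<in>UNIV. (\<Sum>l\<in>UNIV. ?N s $ a $ l * ((M s $ l $ m - M t $ l $ m) / (s - t))) * ?N t $ m $ b)) 
     \<longlongrightarrow> - (\<Sum>m\<in>UNIV. (\<Sum>l\<in>UNIV. ?N t $ a $ l * M' $ l $ m) * ?N t $ m $ b)) (at t within J)"
    by (intro tendsto_intros cN M[unfolded has_field_derivative_iff])
  then have "((\<lambda>s. (?N s $ a $ b - ?N t $ a $ b) / (s - t)) \<longlongrightarrow> 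
     - (\<Sum>m\<in>UNIV. (\<Sum>l\<in>UNIV. ?N t $ a $ l * M' $ l $ m) * ?N t $ m $ b)) (at t within J)"
    by (rule Lim_transform_eventually)
       (simp add: eventually_at_filter eq sum_divide_distrib sum_distrib_right)
  then show ?thesis
    by (simp add: has_field_derivative_iff matrix_matrix_mult_def)
qed

lemma sqrt_det_derivative:
  fixes M :: "real \<Rightarrow> real^'n^'n"
  assumes M: "\<And>i j. ((\<lambda>s. M s $ i $ j) has_real_derivative M' $ i $ j) (at t within J)"
    and pos: "det (M t) > 0"
  shows "((\<lambda>s. sqrt (det (M s))) has_real_derivative
     trace (matrix_inv (M t) ** M') / 2 * sqrt (det (M t))) (at t within J)"
proof -
  have "((\<lambda>s. sqrt (det (M s))) has_real_derivative
     inverse (sqrt (det (M t))) / 2 * (det (M t) * trace (matrix_inv (M t) ** M'))) (at t within J)"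
    by (rule DERIV_chain2[OF DERIV_real_sqrt det_derivative[OF M]]) (use pos in auto)
  moreover have "inverse (sqrt (det (M t))) / 2 * (det (M t) * trace (matrix_inv (M t) ** M')) =
    trace (matrix_inv (M t) ** M') / 2 * sqrt (det (M t))"
    using real_sqrt_mult_self[of "det (M t)"] pos by (simp add: divide_simps)
  ultimately show ?thesis by (simp only:)
qed

section \<open>Integrals of compactly supported functions\<close>

lemma continuous_on_extend_by_zero:
  fixes F :: "'a::euclidean_space \<Rightarrow> real"
  assumes "open U" "compact K" "K \<subseteq> U" "continuous_on U F" "\<And>x. x \<in> U - K \<Longrightarrow> F x = 0"
  shows "continuous_on UNIV (\<lambda>x. indicator U x *\<^sub>R F x)"
proof -
  have "continuous_on (U \<union> - K) (\<lambda>x. indicator U x *\<^sub>R F x)"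
  proof (rule continuous_on_open_Un)
    show "continuous_on U (\<lambda>x. indicator U x *\<^sub>R F x)"
      using assms(4) by (rule continuous_on_eq) auto
    show "continuous_on (- K) (\<lambda>x. indicator U x *\<^sub>R F x)"
      by (rule continuous_on_eq[OF continuous_on_const[of _ 0]]) (use assms(5) in \<open>auto simp: indicator_def\<close>)
  qed (use assms in \<open>auto intro: compact_imp_closed\<close>)
  moreover have "U \<union> - K = UNIV" using assms(3) by auto
  ultimately show ?thesis by simp
qed

lemma integrable_compact_support:
  fixes F :: "'a::euclidean_space \<Rightarrow> real"
  assumes "compact K" "continuous_on UNIV F" "\<And>x. x \<notin> K \<Longrightarrow> F x = 0"
  shows "integrable lborel F"
proof -
  have "integrable lborel (\<lambda>x. indicator K x *\<^sub>R F x)"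
    by (rule borel_integrable_compact[OF assms(1) continuous_on_subset[OF assms(2)]]) simp
  moreover have "(\<lambda>x. indicator K x *\<^sub>R F x) = F"
    by (rule ext) (use assms(3) in \<open>auto simp: indicator_def\<close>)
  ultimately show ?thesis by simp
qed

lemma set_integrable_compact_support:
  fixes F :: "'a::euclidean_space \<Rightarrow> real"
  assumes "open U" "compact K" "K \<subseteq> U" "continuous_on U F" "\<And>x. x \<in> U - K \<Longrightarrow> F x = 0"
  shows "set_integrable lborel U F"
  unfolding set_integrable_def
  by (rule integrable_compact_support[OF assms(2) continuous_on_extend_by_zero[OF assms]])
     (use assms in \<open>auto simp: indicator_def\<close>)

lemma integral_translation:
  fixes F :: "'a::euclidean_space \<Rightarrow> real"
  assumes "F \<in> borel_measurable lborel"
  shows "(\<integral>x. F (x + c) \<partial>lborel) = (\<integral>x. F x \<partial>lborel)"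
    and "integrable lborel F \<Longrightarrow> integrable lborel (\<lambda>x. F (x + c))"
proof -
  have "(\<integral>x. F x \<partial>lborel) = (\<integral>x. F x \<partial>distr lborel borel ((+) c))"
    by (simp add: lborel_distr_plus)
  also have "\<dots> = (\<integral>x. F (c + x) \<partial>lborel)"
    by (rule integral_distr) (use assms in auto)
  finally show "(\<integral>x. F (x + c) \<partial>lborel) = (\<integral>x. F x \<partial>lborel)" by (simp add: add.commute)
  assume "integrable lborel F"
  then have "integrable (distr lborel borel ((+) c)) F" by (simp add: lborel_distr_plus)
  from integrable_distr[OF _ this] show "integrable lborel (\<lambda>x. F (x + c))"
    by (simp add: add.commute)
qed

text \<open>
  By translation invariance the integral of \<open>(F (x + h v) - F x) / h\<close> vanishes for every \<open>h\<close>. The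
  integrands are bounded by the maximum of the derivative and live on a fixed bounded set, so the limit
  \<open>h \<rightarrow> 0\<close> may be taken under the integral.
\<close>

lemma integral_derivative_compact_support:
  fixes F :: "'a::euclidean_space \<Rightarrow> real"
  assumes d: "\<And>x. (F has_derivative F' x) (at x)"
    and c: "continuous_on UNIV (\<lambda>x. F' x v)"
    and K: "compact K" "\<And>x. x \<notin> K \<Longrightarrow> F x = 0"
  shows "(\<integral>x. F' x v \<partial>lborel) = 0"
proof -
  have F'0: "F' x v = 0" if "x \<notin> K" for x
  proof -
    have "(F has_derivative (\<lambda>_. 0)) (at x)"
      by (rule has_derivative_transform_within_open[of "\<lambda>_. 0" _ _ _ "- K"])
         (use K that in \<open>auto intro: compact_imp_closed\<close>)
    then have "F' x = (\<lambda>_. 0)" using has_derivative_unique d by blast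
    then show ?thesis by simp
  qed
  have "bounded ((\<lambda>x. F' x v) ` K)"
    by (rule compact_imp_bounded[OF compact_continuous_image[OF continuous_on_subset[OF c] K(1)]]) simp
  then obtain B where B: "B > 0" "\<And>x. x \<in> K \<Longrightarrow> \<bar>F' x v\<bar> \<le> B"
    by (force simp: bounded_pos)
  with F'0 have B': "\<bar>F' x v\<bar> \<le> B" for x by (cases "x \<in> K") auto
  obtain R where R: "\<And>x. x \<in> K \<Longrightarrow> norm x \<le> R"
    using compact_imp_bounded[OF K(1)] by (auto simp: bounded_iff)
  define h :: "nat \<Rightarrow> real" where "h n = inverse (real (Suc n))" for n
  have h: "0 < h n" "h n \<le> 1" for n by (auto simp: h_def field_simps)
  define q where "q n x = (F (x + h n *\<^sub>R v) - F x) / h n" for n x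
  have cF: "continuous_on UNIV F"
    using d by (auto intro!: continuous_at_imp_continuous_on has_derivative_continuous)
  have mF: "F \<in> borel_measurable borel" using cF by (rule borel_measurable_continuous_onI)
  have iF: "integrable lborel F" by (rule integrable_compact_support[OF K(1) cF K(2)])
  have curve: "((\<lambda>s. F (x + s *\<^sub>R v)) has_real_derivative F' (x + s *\<^sub>R v) v) (at s)" for x s
  proof -
    have "((\<lambda>s. x + s *\<^sub>R v) has_derivative (\<lambda>s. s *\<^sub>R v)) (at s)" by (auto intro!: derivative_eq_intros)
    from has_derivative_compose[OF this d]
    have "((\<lambda>s. F (x + s *\<^sub>R v)) has_derivative (\<lambda>h. F' (x + s *\<^sub>R v) (h *\<^sub>R v))) (at s)" .
    moreover have "F' (x + s *\<^sub>R v) (h *\<^sub>R v) = F' (x + s *\<^sub>R v) v * h" for h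
      using linear_cmul[OF has_derivative_linear[OF d]] by (simp add: mult.commute)
    ultimately show ?thesis by (simp add: has_field_derivative_def)
  qed
  have "(\<lambda>n. \<integral>x. q n x \<partial>lborel) \<longlonglongrightarrow> (\<integral>x. F' x v \<partial>lborel)"
  proof (rule integral_dominated_convergence)
    show "(\<lambda>x. F' x v) \<in> borel_measurable lborel"
      using borel_measurable_continuous_onI[OF c] by simp
    show "q n \<in> borel_measurable lborel" for n
      unfolding q_def using mF by measurable
    show "integrable lborel (\<lambda>x::'a. B * indicator (cball 0 (R + norm v)) x)"
      by (intro integrable_mult_right integrable_real_indicator)
         (use emeasure_lborel_cball_finite[of "0::'a" "R + norm v"] in simp_all)
    show "AE x in lborel. (\<lambda>n. q n x) \<longlonglongrightarrow> F' x v"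
    proof (rule AE_I2)
      fix x
      have "((\<lambda>s. (F (x + s *\<^sub>R v) - F x) / s) \<longlongrightarrow> F' x v) (at 0)"
        using curve[of x 0] by (simp add: has_field_derivative_iff)
      moreover have "filterlim h (at 0) sequentially"
        unfolding h_def using LIMSEQ_inverse_real_of_nat by (auto simp: filterlim_at)
      ultimately show "(\<lambda>n. q n x) \<longlonglongrightarrow> F' x v"
        unfolding q_def by (rule filterlim_compose)
    qed
    show "AE x in lborel. norm (q n x) \<le> B * indicator (cball 0 (R + norm v)) x" for n
    proof (rule AE_I2)
      fix x
      obtain z where "F (x + h n *\<^sub>R v) - F (x + 0 *\<^sub>R v) = (h n - 0) * F' (x + z *\<^sub>R v) v"
        using MVT2[of 0 "h n" "\<lambda>s. F (x + s *\<^sub>R v)" "\<lambda>s. F' (x + s *\<^sub>R v) v"] h curve by blast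
      then have "q n x = F' (x + z *\<^sub>R v) v" using h[of n] by (simp add: q_def)
      then have 1: "\<bar>q n x\<bar> \<le> B" using B' by simp
      have 2: "q n x = 0" if "x \<notin> cball 0 (R + norm v)"
      proof -
        have n: "norm x > R + norm v" using that by simp
        have "norm (h n *\<^sub>R v) \<le> norm v" using h[of n] by (simp add: mult_left_le_one_le)
        then have "norm (x + h n *\<^sub>R v) > R" using n norm_diff_ineq[of x "h n *\<^sub>R v"] by linarith
        moreover have "norm x > R" using n norm_ge_zero[of v] by linarith
        ultimately have "x \<notin> K" "x + h n *\<^sub>R v \<notin> K" using R by (auto simp: not_le[symmetric])
        then show ?thesis by (simp add: q_def K(2))
      qed
      show "norm (q n x) \<le> B * indicator (cball 0 (R + norm v)) x"
        using 1 2 by (auto simp: indicator_def)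
    qed
  qed
  moreover have "(\<integral>x. q n x \<partial>lborel) = 0" for n
  proof -
    have "integrable lborel (\<lambda>x. F (x + h n *\<^sub>R v))"
      using integral_translation(2)[OF _ iF] mF by simp
    then show ?thesis
      unfolding q_def using iF integral_translation(1)[of F "h n *\<^sub>R v"] mF by simp
  qed
  ultimately show ?thesis by (simp add: LIMSEQ_const_iff)
qed

lemma set_integral_derivative_compact_support:
  fixes F :: "'a::euclidean_space \<Rightarrow> real"
  assumes U: "open U" and K: "compact K" "K \<subseteq> U" "\<And>x. x \<in> U - K \<Longrightarrow> F x = 0"
    and F: "C_on (Suc 0) U F"
  shows "(LINT x:U|lborel. frechet_derivative F (at x) v) = 0"
proof -
  define G where "G x = indicator U x *\<^sub>R F x" for x
  define G' where "G' x w = indicator U x *\<^sub>R frechet_derivative F (at x) w" for x w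
  have z: "frechet_derivative F (at x) = (\<lambda>_. 0)" if "x \<in> U - K" for x
  proof -
    have "(F has_derivative (\<lambda>_. 0)) (at x)"
      by (rule has_derivative_transform_within_open[of "\<lambda>_. 0" _ _ _ "U - K"])
         (use U K that in \<open>auto intro: compact_imp_closed\<close>)
    then show ?thesis by (simp add: frechet_derivative_at[symmetric])
  qed
  have "(\<integral>x. G' x v \<partial>lborel) = 0"
  proof (rule integral_derivative_compact_support[of G _ v K])
    show "(G has_derivative G' x) (at x)" for x
    proof (cases "x \<in> U")
      case True
      have "(F has_derivative G' x) (at x)"
        using C_on_differentiable[OF F True] True by (simp add: G'_def[abs_def])
      then show ?thesis
        by (rule has_derivative_transform_within_open[OF _ U True]) (simp add: G_def)
    next
      case False
      then have "x \<notin> K" "G' x = (\<lambda>_. 0)" using K by (auto simp: G'_def)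
      then show ?thesis
        using has_derivative_transform_within_open[of "\<lambda>_. 0" "\<lambda>_. 0" x UNIV "- K" G] K
        by (auto simp: G_def compact_imp_closed open_Compl indicator_def)
    qed
    show "continuous_on UNIV (\<lambda>x. G' x v)"
      unfolding G'_def by (rule continuous_on_extend_by_zero[OF U K(1,2)]) (use F z in auto)
  qed (use K in \<open>auto simp: G_def indicator_def\<close>)
  then show ?thesis by (simp add: set_lebesgue_integral_def G'_def)
qed

lemma continuous_integral_eq_0D:
  fixes F :: "'a::euclidean_space \<Rightarrow> real"
  assumes "continuous_on UNIV F" "integrable lborel F" "\<And>x. F x \<ge> 0" "(\<integral>x. F x \<partial>lborel) = 0"
  shows "F x = 0"
proof (rule ccontr)
  assume "F x \<noteq> 0"
  then have x: "F x > 0" using assms(3)[of x] by linarith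
  have o: "open {y. 0 < F y}" by (rule open_Collect_less[OF continuous_on_const assms(1)])
  have "AE y in lborel. F y = 0"
    using integral_nonneg_eq_0_iff_AE[OF assms(2)] assms by simp
  then have "AE y in lborel. y \<notin> {y. 0 < F y}" by (rule AE_mp) simp
  then have "{y. 0 < F y} \<in> null_sets lborel"
    using o by (subst AE_iff_null_sets) auto
  then have "negligible {y. 0 < F y}"
    by (simp add: negligible_iff_null_sets null_sets_completionI)
  then show False using open_not_negligible[OF o] x by auto
qed

section \<open>Change of variables for an arbitrary finite index type\<close>

text \<open>
  The theorem \<open>integral_change_of_variables\<close> is stated for well-ordered index types. A finite type has no
  canonical order, so it is applied to a copy of the index type, ordered by an enumeration. Relabelling
  the coordinates preserves both Lebesgue measure and determinants.
\<close>

typedef 'a ordered_copy = "UNIV :: 'a set" by simp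

instance ordered_copy :: (finite) finite
proof
  have "(UNIV :: 'a::finite ordered_copy set) = range Abs_ordered_copy"
    by (metis (mono_tags) Abs_ordered_copy_cases surj_def)
  then show "finite (UNIV :: 'a::finite ordered_copy set)" by (metis finite_imageI finite)
qed

instantiation ordered_copy :: (finite) wellorder
begin

definition "x \<le> y \<longleftrightarrow> to_nat (Rep_ordered_copy x) \<le> to_nat (Rep_ordered_copy y)"
definition "x < y \<longleftrightarrow> to_nat (Rep_ordered_copy x) < to_nat (Rep_ordered_copy y)"

instance
proof (intro_classes, goal_cases)
  case (1 x y) show ?case unfolding less_eq_ordered_copy_def less_ordered_copy_def by linarith
next
  case (2 x) show ?case unfolding less_eq_ordered_copy_def by (rule order_refl)
next
  case (3 x y z) then show ?case unfolding less_eq_ordered_copy_def by (rule order_trans)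
next
  case (4 x y)
  then have "to_nat (Rep_ordered_copy x) = to_nat (Rep_ordered_copy y)"
    unfolding less_eq_ordered_copy_def by (rule order_antisym)
  then show ?case by (simp add: Rep_ordered_copy_inject)
next
  case (5 x y) show ?case unfolding less_eq_ordered_copy_def by (rule linear)
next
  case (6 P a)
  show ?case
  proof (induction "to_nat (Rep_ordered_copy a)" arbitrary: a rule: less_induct)
    case less
    show ?case by (rule 6) (rule less, simp add: less_ordered_copy_def)
  qed
qed

end

definition reindex :: "('a \<Rightarrow> 'b) \<Rightarrow> real^'b \<Rightarrow> real^'a" where
  "reindex \<rho> x = (\<chi> i. x $ \<rho> i)"

lemma linear_reindex: "linear (reindex \<rho>)"
  by (rule linearI) (simp_all add: reindex_def vec_eq_iff)

lemma prod_Basis_vec: "(\<Prod>b\<in>Basis. (x :: real^'n) \<bullet> b) = (\<Prod>i\<in>UNIV. x $ i)"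
proof -
  have B: "(Basis :: (real^'n) set) = (\<lambda>i. axis i 1) ` UNIV" by (auto simp: Basis_vec_def)
  have "inj (\<lambda>i. axis i (1::real) :: real^'n)" by (auto simp: inj_on_def axis_eq_axis)
  then show ?thesis unfolding B by (simp add: prod.reindex inner_axis)
qed

lemma distr_reindex:
  fixes \<rho> :: "'a::finite \<Rightarrow> 'b::finite"
  assumes "bij \<rho>"
  shows "distr lborel borel (reindex \<rho>) = lborel"
proof (rule lborel_eqI[symmetric])
  fix l u :: "real^'a" assume lu: "\<And>b. b \<in> Basis \<Longrightarrow> l \<bullet> b \<le> u \<bullet> b"
  have m: "reindex \<rho> \<in> borel_measurable lborel"
    using borel_measurable_continuous_onI[OF linear_continuous_on[OF linear_reindex[THEN linear_conv_bounded_linear[THEN iffD1]]]]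
    by simp
  let ?s = "inv \<rho>"
  have s: "\<rho> (?s j) = j" "?s (\<rho> i) = i" for i j
    using assms by (simp_all add: bij_is_surj surj_f_inv_f bij_is_inj)
  have eq: "reindex \<rho> -` box l u = box (reindex ?s l) (reindex ?s u)"
    by (auto simp: mem_box_cart reindex_def; metis s)
  have lu': "l $ i \<le> u $ i" for i using lu[of "axis i 1"] by (simp add: inner_axis axis_in_Basis_iff)
  have "emeasure (distr lborel borel (reindex \<rho>)) (box l u) = emeasure lborel (box (reindex ?s l) (reindex ?s u))"
    using m by (subst emeasure_distr) (auto simp: eq)
  also have "\<dots> = ennreal (\<Prod>b\<in>Basis. (reindex ?s u - reindex ?s l) \<bullet> b)"
    by (rule emeasure_lborel_box) (use lu' in \<open>auto simp: Basis_vec_def inner_axis reindex_def\<close>)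
  also have "(\<Prod>b\<in>Basis. (reindex ?s u - reindex ?s l) \<bullet> b) = (\<Prod>i\<in>UNIV. (u - l) $ ?s i)"
    unfolding prod_Basis_vec by (simp add: reindex_def)
  also have "\<dots> = (\<Prod>i\<in>UNIV. (u - l) $ i)"
    using prod.reindex_bij_betw[OF bij_imp_bij_inv[OF assms], of "\<lambda>i. (u - l) $ i"] by simp
  finally show "emeasure (distr lborel borel (reindex \<rho>)) (box l u) = (\<Prod>b\<in>Basis. (u - l) \<bullet> b)"
    by (simp add: prod_Basis_vec)
qed simp

lemma set_integral_reindex:
  fixes \<rho> :: "'a::finite \<Rightarrow> 'b::finite" and F :: "real^'a \<Rightarrow> real"
  assumes "bij \<rho>" "set_integrable lborel S F"
  shows "set_integrable lborel (reindex \<rho> -` S) (\<lambda>x. F (reindex \<rho> x))"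
    and "(LINT x:reindex \<rho> -` S|lborel. F (reindex \<rho> x)) = (LINT x:S|lborel. F x)"
proof -
  have m: "reindex \<rho> \<in> measurable lborel borel"
    using borel_measurable_continuous_onI[OF linear_continuous_on[OF linear_reindex[THEN linear_conv_bounded_linear[THEN iffD1]]]]
    by simp
  have i: "integrable (distr lborel borel (reindex \<rho>)) (\<lambda>x. indicator S x *\<^sub>R F x)"
    using assms(2) unfolding distr_reindex[OF assms(1)] by (simp add: set_integrable_def)
  have e: "indicator S (reindex \<rho> x) = (indicator (reindex \<rho> -` S) x :: real)" for x
    by (simp add: indicator_def)
  show "set_integrable lborel (reindex \<rho> -` S) (\<lambda>x. F (reindex \<rho> x))"
    using integrable_distr[OF m i] by (simp add: set_integrable_def e)
  show "(LINT x:reindex \<rho> -` S|lborel. F (reindex \<rho> x)) = (LINT x:S|lborel. F x)"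
    using integral_distr[OF m, of "\<lambda>x. indicator S x *\<^sub>R F x"] i
    unfolding distr_reindex[OF assms(1)] by (simp add: set_lebesgue_integral_def e)
qed

text \<open>
  Conjugation with the bijection maps permutations to permutations of the same sign, and this matches
  the terms of the two Leibniz expansions.
\<close>

lemma det_reindex:
  fixes \<rho> :: "'a::finite \<Rightarrow> 'b::finite" and A :: "real^'b^'b"
  assumes "bij \<rho>"
  shows "det (\<chi> i j. A $ \<rho> i $ \<rho> j) = det A"
proof -
  have bb: "bij_betw (map_permutation UNIV \<rho>) {p. p permutes UNIV} {p. p permutes UNIV}"
  proof (rule bij_betw_byWitness[where f'="map_permutation UNIV (inv \<rho>)"])
    have b: "bij_betw \<rho> UNIV UNIV" "bij_betw (inv \<rho>) UNIV UNIV" using assms bij_imp_bij_inv by auto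
    have s: "\<rho> (inv \<rho> j) = j" "inv \<rho> (\<rho> i) = i" for i j
      using assms by (simp_all add: bij_is_surj surj_f_inv_f bij_is_inj)
    show "\<forall>p\<in>{p. p permutes UNIV}. map_permutation UNIV (inv \<rho>) (map_permutation UNIV \<rho> p) = p"
      using map_permutation_compose_inv[OF b(1)] s by blast
    show "\<forall>p\<in>{p. p permutes UNIV}. map_permutation UNIV \<rho> (map_permutation UNIV (inv \<rho>) p) = p"
      using map_permutation_compose_inv[OF b(2)] s by blast
  qed (use map_permutation_permutes assms bij_imp_bij_inv in blast)+
  have "det A = (\<Sum>p | p permutes UNIV. of_int (sign (map_permutation UNIV \<rho> p)) *
      (\<Prod>i\<in>UNIV. A $ i $ map_permutation UNIV \<rho> p i))"
    unfolding det_def by (rule sum.reindex_bij_betw[OF bb, symmetric])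
  also have "\<dots> = (\<Sum>p | p permutes UNIV. of_int (sign p) * (\<Prod>i\<in>UNIV. A $ \<rho> i $ \<rho> (p i)))"
  proof (rule sum.cong[OF refl])
    fix p :: "'a \<Rightarrow> 'a" assume p: "p \<in> {p. p permutes UNIV}"
    have "(\<Prod>i\<in>UNIV. A $ i $ map_permutation UNIV \<rho> p i) =
        (\<Prod>i\<in>UNIV. A $ \<rho> i $ map_permutation UNIV \<rho> p (\<rho> i))"
      by (rule prod.reindex_bij_betw[OF assms, symmetric])
    then show "of_int (sign (map_permutation UNIV \<rho> p)) * (\<Prod>i\<in>UNIV. A $ i $ map_permutation UNIV \<rho> p i) =
       of_int (sign p) * (\<Prod>i\<in>UNIV. A $ \<rho> i $ \<rho> (p i))"
      using p assms by (simp add: sign_map_permutation bij_is_inj map_permutation_apply)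
  qed
  finally show ?thesis by (simp add: det_def)
qed

lemma set_integral_change_of_variables_ordered:
  fixes T :: "real^'n::{finite,wellorder} \<Rightarrow> real^'n::_" and F :: "real^'n::_ \<Rightarrow> real"
  assumes "open U" "\<And>x. x \<in> U \<Longrightarrow> (T has_derivative T' x) (at x)" "inj_on T U"
    and F: "set_integrable lborel (T ` U) F"
    and G: "set_integrable lborel U (\<lambda>x. \<bar>det (matrix (T' x))\<bar> * F (T x))"
  shows "(LINT y:T ` U|lborel. F y) = (LINT x:U|lborel. \<bar>det (matrix (T' x))\<bar> * F (T x))"
proof -
  let ?f = "\<lambda>y. vec (F y) :: real^1"
  have "F absolutely_integrable_on (T ` U)"
    using F unfolding set_integrable_def by (subst integrable_completion) auto
  then have "?f absolutely_integrable_on (T ` U)" by (simp add: absolutely_integrable_on_1_iff)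
  then have "integral (T ` U) ?f = integral U (\<lambda>x. \<bar>det (matrix (T' x))\<bar> *\<^sub>R ?f (T x))"
    by (intro integral_change_of_variables) (use assms in \<open>auto intro: has_derivative_at_withinI\<close>)
  then have "integral (T ` U) F = integral U (\<lambda>x. \<bar>det (matrix (T' x))\<bar> * F (T x))"
    by (simp add: integral_on_1_eq vec_eq_iff)
  then show ?thesis by (simp add: set_borel_integral_eq_integral[OF F] set_borel_integral_eq_integral[OF G])
qed

lemma set_integral_change_of_variables:
  fixes T :: "real^'n \<Rightarrow> real^'n" and F :: "real^'n \<Rightarrow> real"
  assumes U: "open U" and T: "\<And>x. x \<in> U \<Longrightarrow> (T has_derivative T' x) (at x)" and inj: "inj_on T U"
    and F: "set_integrable lborel (T ` U) F"
    and G: "set_integrable lborel U (\<lambda>x. \<bar>det (matrix (T' x))\<bar> * F (T x))"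
  shows "(LINT y:T ` U|lborel. F y) = (LINT x:U|lborel. \<bar>det (matrix (T' x))\<bar> * F (T x))"
proof -
  let ?A = "Abs_ordered_copy :: 'n \<Rightarrow> 'n ordered_copy" and ?R = "Rep_ordered_copy :: 'n ordered_copy \<Rightarrow> 'n"
  have bij: "bij ?A" "bij ?R"
    by (auto intro!: bijI' simp: Abs_ordered_copy_inject Rep_ordered_copy_inject)
       (metis Abs_ordered_copy_inverse Rep_ordered_copy_inverse UNIV_I)+
  let ?p = "reindex ?A" and ?q = "reindex ?R"
  have pq [simp]: "?p (?q x) = x" "?q (?p y) = y" for x y
    by (simp_all add: reindex_def vec_eq_iff Abs_ordered_copy_inverse Rep_ordered_copy_inverse)
  let ?T = "\<lambda>z. ?q (T (?p z))" and ?T' = "\<lambda>z w. ?q (T' (?p z) (?p w))"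
  have bl: "bounded_linear ?p" "bounded_linear ?q" using linear_reindex linear_conv_bounded_linear by blast+
  have oU: "open (?p -` U)"
    using continuous_open_vimage[OF U] linear_continuous_on[OF bl(1)] by (simp add: open_vimage U)
  have dT: "(?T has_derivative ?T' z) (at z)" if "z \<in> ?p -` U" for z
  proof -
    have "((\<lambda>z. T (?p z)) has_derivative (\<lambda>w. T' (?p z) (?p w))) (at z)"
      by (rule has_derivative_compose[OF bounded_linear_imp_has_derivative[OF bl(1)] T]) (use that in auto)
    from bounded_linear.has_derivative[OF bl(2) this] show ?thesis .
  qed
  have inj': "inj_on ?T (?p -` U)"
    by (rule inj_onI) (metis (no_types, lifting) inj inj_onD pq vimageE)
  have im: "?T ` (?p -` U) = ?p -` (T ` U)"
  proof (intro equalityI subsetI)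
    fix y assume "y \<in> ?p -` (T ` U)"
    then obtain x where "x \<in> U" "?p y = T x" by auto
    then have "?q x \<in> ?p -` U" "?T (?q x) = y" using pq(2)[of y] by auto
    then show "y \<in> ?T ` (?p -` U)" by (intro image_eqI[of _ _ "?q x"]) auto
  qed auto
  have det: "det (matrix (?T' z)) = det (matrix (T' (?p z)))" if "z \<in> ?p -` U" for z
  proof -
    have "?p (axis j 1) = axis (?R j) 1" for j
      by (auto simp: reindex_def axis_def vec_eq_iff Abs_ordered_copy_inverse Rep_ordered_copy_inverse)
    then have "matrix (?T' z) = (\<chi> i j. matrix (T' (?p z)) $ ?R i $ ?R j)"
      by (simp add: matrix_def reindex_def)
    then show ?thesis by (simp add: det_reindex[OF bij(2)])
  qed
  have G': "set_integrable lborel (?p -` U) (\<lambda>z. \<bar>det (matrix (?T' z))\<bar> * F (?p (?T z)))"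
    by (rule set_integrable_cong[THEN iffD1, OF refl refl _ set_integral_reindex(1)[OF bij(1) G]]) (simp add: det)
  have "(LINT y:T ` U|lborel. F y) = (LINT y:?T ` (?p -` U)|lborel. F (?p y))"
    unfolding im by (rule set_integral_reindex(2)[OF bij(1) F, symmetric])
  also have "\<dots> = (LINT z:?p -` U|lborel. \<bar>det (matrix (?T' z))\<bar> * F (?p (?T z)))"
    by (rule set_integral_change_of_variables_ordered[OF oU dT inj' _ G'])
       (use set_integral_reindex(1)[OF bij(1) F] im in auto)
  also have "\<dots> = (LINT z:?p -` U|lborel. \<bar>det (matrix (T' (?p z)))\<bar> * F (T (?p z)))"
    by (rule set_lebesgue_integral_cong) (use oU det in auto)
  also have "\<dots> = (LINT x:U|lborel. \<bar>det (matrix (T' x))\<bar> * F (T x))"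
    by (rule set_integral_reindex(2)[OF bij(1) G])
  finally show ?thesis .
qed

section \<open>Charts\<close>

lemma is_chartD:
  assumes "is_chart c"
  shows "open (dom_of c)" "open (img_of c)"
    "\<And>p. p \<in> dom_of c \<Longrightarrow> coord c p \<in> img_of c" "\<And>p. p \<in> dom_of c \<Longrightarrow> point c (coord c p) = p"
    "\<And>x. x \<in> img_of c \<Longrightarrow> point c x \<in> dom_of c" "\<And>x. x \<in> img_of c \<Longrightarrow> coord c (point c x) = x"
    "continuous_on (dom_of c) (coord c)" "continuous_on (img_of c) (point c)"
  using assms unfolding is_chart_def homeomorphism_def by auto

lemma coord_image_eq:
  assumes "is_chart c" "S \<subseteq> dom_of c"
  shows "coord c ` S = {x \<in> img_of c. point c x \<in> S}"
  using assms is_chartD[OF assms(1)] by (auto simp: image_iff) (metis subsetD)+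

lemma open_coord_image:
  assumes "is_chart c" "open W"
  shows "open (coord c ` (dom_of c \<inter> W))"
proof -
  have "open (img_of c \<inter> point c -` (dom_of c \<inter> W))"
    by (rule continuous_open_preimage) (use assms is_chartD(1,2,8)[OF assms(1)] in \<open>simp_all add: open_Int\<close>)
  moreover have "coord c ` (dom_of c \<inter> W) = img_of c \<inter> point c -` (dom_of c \<inter> W)"
    using coord_image_eq[OF assms(1), of "dom_of c \<inter> W"] by auto
  ultimately show ?thesis by simp
qed

section \<open>Invariance of contractions under congruence\<close>

text \<open>
  If \<open>G\<close> and \<open>H\<close> represent a metric in two charts and \<open>J\<close> is the Jacobian of the change of
  coordinates, then \<open>G = J\<^sup>T H J\<close>, covectors transform by \<open>J\<^sup>T\<close>, and tensors \<open>S\<close> of type (0,2) transform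
  like the metric. The identity \<open>J G\<inverse> J\<^sup>T = H\<inverse>\<close> makes all contractions with the inverse metric invariant:
  the inner product of covectors, the trace, and the value on raised covectors.
\<close>

lemma congruent_matrix_inv:
  fixes G H J :: "real^'n^'n"
  assumes G: "G = transpose J ** H ** J" and "det G \<noteq> 0"
  shows "J ** matrix_inv G ** transpose J = matrix_inv H" "det G = (det J)\<^sup>2 * det H"
proof -
  show d: "det G = (det J)\<^sup>2 * det H"
    by (simp add: G det_mul det_transpose power2_eq_square)
  with assms(2) have nz: "det J \<noteq> 0" "det H \<noteq> 0" by auto
  note J = matrix_inv_inverse[OF nz(1)] and H = matrix_inv_inverse[OF nz(2)] and Gi = matrix_inv_inverse[OF assms(2)]
  let ?J' = "matrix_inv J"
  have J': "transpose J ** transpose ?J' = mat 1" "transpose ?J' ** transpose J = mat 1"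
    using J by (simp_all add: matrix_transpose_mul[symmetric])
  have "transpose J ** (H ** (J ** matrix_inv G)) = mat 1"
    using Gi by (simp add: G matrix_mul_assoc)
  then have "transpose ?J' ** (transpose J ** (H ** (J ** matrix_inv G))) = transpose ?J'"
    by simp
  then have "H ** (J ** matrix_inv G) = transpose ?J'"
    by (simp add: matrix_mul_assoc J')
  then have "H ** (J ** matrix_inv G ** transpose J) = mat 1"
    by (metis matrix_mul_assoc J'(2))
  then have "matrix_inv H ** (H ** (J ** matrix_inv G ** transpose J)) = matrix_inv H"
    by simp
  then show "J ** matrix_inv G ** transpose J = matrix_inv H"
    by (simp add: matrix_mul_assoc H)
qed

lemma inner_transpose: "(transpose J *v a) \<bullet> w = a \<bullet> ((J :: real^'n^'m) *v w)"
  by (simp add: dot_lmul_matrix)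

lemma congruent_pairing:
  fixes G H J :: "real^'n^'n"
  assumes "G = transpose J ** H ** J" "det G \<noteq> 0"
  shows "(transpose J *v a) \<bullet> (matrix_inv G *v (transpose J *v b)) = a \<bullet> (matrix_inv H *v b)"
proof -
  have "(transpose J *v a) \<bullet> (matrix_inv G *v (transpose J *v b)) =
      a \<bullet> ((J ** matrix_inv G ** transpose J) *v b)"
    by (simp only: inner_transpose matrix_vector_mul_assoc matrix_mul_assoc)
  then show ?thesis by (simp only: congruent_matrix_inv[OF assms])
qed

lemma congruent_trace:
  fixes G H J :: "real^'n^'n"
  assumes "G = transpose J ** H ** J" "det G \<noteq> 0"
  shows "trace (matrix_inv G ** (transpose J ** S ** J)) = trace (matrix_inv H ** S)"
proof -
  have "trace (matrix_inv G ** (transpose J ** S ** J)) = trace ((matrix_inv G ** transpose J ** S) ** J)"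
    by (simp add: matrix_mul_assoc)
  also have "\<dots> = trace (J ** (matrix_inv G ** transpose J ** S))" by (rule trace_mul_sym)
  also have "\<dots> = trace ((J ** matrix_inv G ** transpose J) ** S)" by (simp add: matrix_mul_assoc)
  finally show ?thesis by (simp add: congruent_matrix_inv[OF assms])
qed

lemma congruent_quadratic:
  fixes G H J :: "real^'n^'n"
  assumes "G = transpose J ** H ** J" "det G \<noteq> 0"
  shows "(matrix_inv G *v (transpose J *v a)) \<bullet> ((transpose J ** S ** J) *v (matrix_inv G *v (transpose J *v b))) =
    (matrix_inv H *v a) \<bullet> (S *v (matrix_inv H *v b))"
proof -
  have t: "v \<bullet> ((transpose J ** S ** J) *v w) = (J *v v) \<bullet> (S *v (J *v w))" for v w
  proof -
    have "v \<bullet> ((transpose J ** S ** J) *v w) = v \<bullet> (transpose J *v (S *v (J *v w)))"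
      by (simp only: matrix_vector_mul_assoc matrix_mul_assoc)
    also have "\<dots> = (J *v v) \<bullet> (S *v (J *v w))" by (metis inner_transpose inner_commute)
    finally show ?thesis .
  qed
  have "J *v (matrix_inv G *v (transpose J *v b)) = matrix_inv H *v b" for b
    by (simp only: matrix_vector_mul_assoc matrix_mul_assoc congruent_matrix_inv[OF assms])
  then show ?thesis by (simp only: t)
qed

section \<open>Bump functions and partitions of unity\<close>

locale compact_mfd =
  fixes A :: "('m::t2_space, 'n::finite) chart set"
  assumes compact_manifold: "compact_manifold A"
begin

lemma compact_space: "compact (UNIV :: 'm set)"
  using compact_manifold by (simp add: compact_manifold_def)

lemma chart: "c \<in> A \<Longrightarrow> is_chart c"
  using compact_manifold by (auto simp: compact_manifold_def smooth_atlas_def)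

lemmas chartD = is_chartD[OF chart]

lemma ex_chart: "\<exists>c\<in>A. p \<in> dom_of c"
  using compact_manifold unfolding compact_manifold_def smooth_atlas_def by blast

lemma chart_at: "chart_at A p \<in> A" "p \<in> dom_of (chart_at A p)"
proof -
  have "chart_at A p \<in> A \<and> p \<in> dom_of (chart_at A p)"
    unfolding chart_at_def by (rule someI_ex) (use ex_chart in blast)
  then show "chart_at A p \<in> A" "p \<in> dom_of (chart_at A p)" by auto
qed

lemma compact_coord_image:
  assumes "c \<in> A" "closed K" "K \<subseteq> dom_of c"
  shows "compact (coord c ` K)"
proof (rule compact_continuous_image)
  show "continuous_on K (coord c)" using chartD(7)[OF assms(1)] assms(3) by (rule continuous_on_subset)
  show "compact K" using compact_Int_closed[OF compact_space assms(2)] by simp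
qed

lemma open_overlap:
  assumes "c \<in> A" "d \<in> A" shows "open (coord c ` (dom_of c \<inter> dom_of d))"
  using open_coord_image[OF chart[OF assms(1)] chartD(1)[OF assms(2)]] .

lemma C_on_transition:
  assumes "c \<in> A" "d \<in> A" shows "C_on k (coord c ` (dom_of c \<inter> dom_of d)) (transition c d)"
proof -
  have "smooth_on (coord c ` (dom_of c \<inter> dom_of d)) (transition c d)"
    using compact_manifold assms by (auto simp: compact_manifold_def smooth_atlas_def)
  then show ?thesis using smooth_on_open[OF open_overlap[OF assms]] by blast
qed

lemma transition_image:
  assumes "c \<in> A" "d \<in> A"
  shows "transition c d ` coord c ` (dom_of c \<inter> dom_of d) = coord d ` (dom_of c \<inter> dom_of d)"
  using chartD(4)[OF assms(1)] by (force simp: transition_def image_iff)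

lemma smooth_fun_iff: "smooth_fun A h \<longleftrightarrow> (\<forall>c\<in>A. \<forall>k. C_on k (img_of c) (\<lambda>x. h (point c x)))"
  using smooth_on_open[OF chartD(2)] by (auto simp: smooth_fun_def comp_def)

lemma smooth_funD: "smooth_fun A h \<Longrightarrow> c \<in> A \<Longrightarrow> C_on k (img_of c) (\<lambda>x. h (point c x))"
  using smooth_fun_iff by blast

lemma smooth_fun_mult: "smooth_fun A a \<Longrightarrow> smooth_fun A b \<Longrightarrow> smooth_fun A (\<lambda>p. a p * b p)"
  unfolding smooth_fun_iff by (intro ballI allI C_on_mult chartD(2)) auto

lemma smooth_fun_sum: "finite I \<Longrightarrow> (\<And>i. i \<in> I \<Longrightarrow> smooth_fun A (a i)) \<Longrightarrow> smooth_fun A (\<lambda>p. \<Sum>i\<in>I. a i p)"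
  unfolding smooth_fun_iff by (intro ballI allI C_on_sum chartD(2)) auto

lemma smooth_fun_inverse: "smooth_fun A a \<Longrightarrow> (\<And>p. a p \<noteq> 0) \<Longrightarrow> smooth_fun A (\<lambda>p. inverse (a p))"
  unfolding smooth_fun_iff
  by (intro ballI allI C_on_compose[OF chartD(2) open_nonzero _ C_on_inverse]) auto

lemma smooth_fun_continuous:
  assumes "smooth_fun A h" shows "continuous_on UNIV h"
proof (rule continuous_at_imp_continuous_on, rule ballI)
  fix p :: 'm
  obtain c where c: "c \<in> A" "p \<in> dom_of c" using ex_chart by blast
  have "continuous_on (img_of c) (\<lambda>x. h (point c x))"
    using smooth_funD[OF assms c(1)] by (rule C_on_imp_continuous_on)
  then have "continuous_on (dom_of c) (\<lambda>q. h (point c (coord c q)))"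
    using chartD(7)[OF c(1)] by (rule continuous_on_compose2) (use chartD(3)[OF c(1)] in auto)
  then have "continuous_on (dom_of c) h"
    by (rule continuous_on_eq) (simp add: chartD(4)[OF c(1)])
  then show "isCont h p" using c chartD(1)[OF c(1)] by (simp add: continuous_on_eq_continuous_at)
qed

text \<open>
  In a chart centred at \<open>p\<close> the function \<open>exp (- 1 / (r\<^sup>2 - |x|\<^sup>2))\<close> is supported in a small closed ball. The
  preimage of the ball in the manifold is compact and hence closed, because the manifold is Hausdorff, so
  the extension by zero is smooth: near each point either the chart formula or zero applies.
\<close>

lemma bump_function:
  assumes "open W" "p \<in> W"
  shows "\<exists>\<beta>. smooth_fun A \<beta> \<and> (\<forall>q. 0 \<le> \<beta> q) \<and> \<beta> p > 0 \<and> closure {q. \<beta> q \<noteq> 0} \<subseteq> W"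
proof -
  obtain c where c: "c \<in> A" "p \<in> dom_of c" using ex_chart by blast
  define V where "V = coord c ` (dom_of c \<inter> W)"
  have "open V" unfolding V_def by (rule open_coord_image[OF chart[OF c(1)] assms(1)])
  moreover have "coord c p \<in> V" using c assms by (auto simp: V_def)
  ultimately obtain r where r: "r > 0" "cball (coord c p) r \<subseteq> V" using open_contains_cball by blast
  define b where "b x = flat_exp 0 (r\<^sup>2 - (x - coord c p) \<bullet> (x - coord c p))" for x
  have Cb: "C_on k UNIV b" for k
    unfolding b_def
    by (intro C_on_compose[OF open_UNIV open_UNIV _ C_on_flat_exp] C_on_diff C_on_inner C_on_const
        open_UNIV C_on_bounded_linear[OF bounded_linear_ident]) auto
  have b0: "b x = 0" if "x \<notin> cball (coord c p) r" for x
  proof -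
    have "r < norm (x - coord c p)" using that by (simp add: dist_norm norm_minus_commute)
    then have "r\<^sup>2 < (norm (x - coord c p))\<^sup>2" using r by (intro power_strict_mono) auto
    then show ?thesis by (simp add: b_def flat_exp_def power2_norm_eq_inner)
  qed
  define \<beta> where "\<beta> q = (if q \<in> dom_of c then b (coord c q) else 0)" for q
  define K where "K = point c ` cball (coord c p) r"
  have Vi: "V \<subseteq> img_of c" "\<And>x. x \<in> V \<Longrightarrow> point c x \<in> W"
    using coord_image_eq[OF chart[OF c(1)], of "dom_of c \<inter> W"] by (auto simp: V_def)
  have KW: "K \<subseteq> W" using Vi r by (auto simp: K_def)
  have "compact K" unfolding K_def
    by (rule compact_continuous_image[OF continuous_on_subset[OF chartD(8)[OF c(1)]]]) (use r Vi in auto)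
  then have clK: "closed K" by (rule compact_imp_closed)
  have \<beta>0: "\<beta> q = 0" if "q \<notin> K" for q
  proof (cases "q \<in> dom_of c")
    case True
    have "coord c q \<notin> cball (coord c p) r"
    proof
      assume "coord c q \<in> cball (coord c p) r"
      then have "point c (coord c q) \<in> K" by (auto simp: K_def)
      then show False using that True chartD(4)[OF c(1)] by simp
    qed
    then show ?thesis by (simp add: \<beta>_def b0)
  qed (simp add: \<beta>_def)
  have "smooth_fun A \<beta>" unfolding smooth_fun_iff
  proof (intro ballI allI C_on_local)
    fix d k y assume d: "d \<in> A" and y: "y \<in> img_of d"
    show "\<exists>N. open N \<and> y \<in> N \<and> C_on k N (\<lambda>x. \<beta> (point d x))"
    proof (cases "point d y \<in> dom_of c")
      case True
      let ?N = "coord d ` (dom_of d \<inter> dom_of c)"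
      have "C_on k ?N (\<lambda>x. b (transition d c x))"
        by (rule C_on_compose[OF open_overlap[OF d c(1)] open_UNIV _ Cb C_on_transition[OF d c(1)]]) auto
      then have "C_on k ?N (\<lambda>x. \<beta> (point d x))"
        by (rule C_on_cong[OF open_overlap[OF d c(1)], rotated])
          (auto simp: \<beta>_def transition_def chartD(4)[OF d])
      moreover have "y \<in> ?N" using True y chartD(5,6)[OF d] by (intro image_eqI[of _ _ "point d y"]) auto
      ultimately show ?thesis using open_overlap[OF d c(1)] by blast
    next
      case False
      let ?N = "coord d ` (dom_of d \<inter> - K)"
      have oN: "open ?N" by (rule open_coord_image[OF chart[OF d]]) (use clK in auto)
      have "C_on k ?N (\<lambda>x. 0 :: real)" by simp
      then have "C_on k ?N (\<lambda>x. \<beta> (point d x))"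
        by (rule C_on_cong[OF oN, rotated]) (auto simp: chartD(4)[OF d] \<beta>0)
      moreover have "K \<subseteq> dom_of c" using Vi(1) r chartD(5)[OF c(1)] by (auto simp: K_def)
      then have "y \<in> ?N" using False y chartD(5,6)[OF d] by (intro image_eqI[of _ _ "point d y"]) auto
      ultimately show ?thesis using oN by blast
    qed
  qed
  moreover have "0 \<le> \<beta> q" for q by (simp add: \<beta>_def b_def flat_exp_def)
  moreover have "\<beta> p > 0" using c r by (simp add: \<beta>_def b_def flat_exp_def)
  moreover have "closure {q. \<beta> q \<noteq> 0} \<subseteq> W"
    using closure_minimal[of "{q. \<beta> q \<noteq> 0}" K] clK \<beta>0 KW by blast
  ultimately show ?thesis by (intro exI[of _ \<beta>]) simp
qed

text \<open>
  Finitely many bump functions are enough to have no common zero, by compactness; dividing them by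
  their sum gives the partition.
\<close>

lemma ex_partition_of_unity: "\<exists>N c \<rho>. partition_of_unity A N c \<rho>"
proof -
  have "\<forall>p. \<exists>\<beta>. smooth_fun A \<beta> \<and> (\<forall>q. 0 \<le> \<beta> q) \<and> \<beta> p > 0 \<and> closure {q. \<beta> q \<noteq> 0} \<subseteq> dom_of (chart_at A p)"
    by (intro allI bump_function chartD(1) chart_at)
  from choice[OF this] obtain B where "\<forall>p. smooth_fun A (B p) \<and> (\<forall>q. 0 \<le> B p q) \<and> B p p > 0 \<and>
      closure {q. B p q \<noteq> 0} \<subseteq> dom_of (chart_at A p)" ..
  then have B: "\<And>p. smooth_fun A (B p)" "\<And>p q. 0 \<le> B p q" "\<And>p. B p p > 0"
    "\<And>p. closure {q. B p q \<noteq> 0} \<subseteq> dom_of (chart_at A p)" by simp_all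
  have op: "open {q. 0 < B p q}" for p
    by (rule open_Collect_less[OF continuous_on_const smooth_fun_continuous[OF B(1)]])
  have cov: "UNIV \<subseteq> (\<Union>p\<in>UNIV. {q. 0 < B p q})" using B(3) by auto
  have "\<exists>P. finite P \<and> UNIV \<subseteq> (\<Union>p\<in>P. {q. 0 < B p q})"
    by (rule compactE_image[OF compact_space op cov]) (intro exI conjI)
  then obtain P where P: "finite P" "UNIV \<subseteq> (\<Union>p\<in>P. {q. 0 < B p q})" by auto
  define \<sigma> where "\<sigma> q = (\<Sum>p\<in>P. B p q)" for q
  have \<sigma>: "\<sigma> q > 0" for q
  proof -
    obtain p where "p \<in> P" "0 < B p q" using P(2) by blast
    then show ?thesis unfolding \<sigma>_def by (intro sum_pos2[OF P(1)]) (auto simp: B)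
  qed
  have s\<sigma>: "smooth_fun A (\<lambda>q. inverse (\<sigma> q))"
  proof (rule smooth_fun_inverse)
    show "smooth_fun A \<sigma>" unfolding \<sigma>_def[abs_def] by (rule smooth_fun_sum[OF P(1) B(1)])
    show "\<sigma> q \<noteq> 0" for q using \<sigma>[of q] by simp
  qed
  obtain h where h: "bij_betw h {..<card P} P"
    using ex_bij_betw_nat_finite[OF P(1)] by (auto simp: atLeast0LessThan)
  have "partition_of_unity A (card P) (\<lambda>k. chart_at A (h k)) (\<lambda>k q. B (h k) q * inverse (\<sigma> q))"
    unfolding partition_of_unity_def
  proof (intro conjI allI impI)
    fix p
    have "(\<Sum>k<card P. B (h k) p * inverse (\<sigma> p)) = (\<Sum>k<card P. B (h k) p) * inverse (\<sigma> p)"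
      by (simp add: sum_distrib_right)
    also have "(\<Sum>k<card P. B (h k) p) = \<sigma> p"
      unfolding \<sigma>_def by (rule sum.reindex_bij_betw[OF h])
    finally show "(\<Sum>k<card P. B (h k) p * inverse (\<sigma> p)) = 1" using \<sigma>[of p] by simp
  next
    fix k
    have "{p. B (h k) p * inverse (\<sigma> p) \<noteq> 0} = {p. B (h k) p \<noteq> 0}" using less_imp_neq[OF \<sigma>] by auto
    then show "closure {p. B (h k) p * inverse (\<sigma> p) \<noteq> 0} \<subseteq> dom_of (chart_at A (h k))" using B(4) by simp
  qed (use less_imp_le[OF \<sigma>] B in \<open>auto intro!: chart_at(1) smooth_fun_mult s\<sigma> mult_nonneg_nonneg\<close>)
  then show ?thesis by blast
qed

end

section \<open>Integrals and differentials in charts\<close>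

definition chart_integral :: "('m, 'n::finite) tensor2 \<Rightarrow> ('m, 'n) chart \<Rightarrow> ('m \<Rightarrow> real) \<Rightarrow> real" where
  "chart_integral g c \<phi> = (LINT x:img_of c|lborel. \<phi> (point c x) * sqrt (det (g c (point c x))))"

text \<open>
  One partition of unity computes the integrals for all metrics and all functions. Using
  the same cut-off functions at different times is what allows integrals to be compared chart by chart.
\<close>

lemma (in compact_mfd) integral_dV_partition:
  "\<exists>N c \<rho>. partition_of_unity A N c \<rho> \<and>
    (\<forall>g \<phi>. integral_dV A g \<phi> = (\<Sum>k<N. chart_integral g (c k) (\<lambda>p. \<rho> k p * \<phi> p)))"
proof -
  obtain N c \<rho> where e: "(SOME (N, c, \<rho>). partition_of_unity A N c \<rho>) = (N, c, \<rho>)"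
    by (metis prod_cases3)
  have "case (SOME (N, c, \<rho>). partition_of_unity A N c \<rho>) of (N, c, \<rho>) \<Rightarrow> partition_of_unity A N c \<rho>"
    by (rule someI_ex) (use ex_partition_of_unity in auto)
  then have "partition_of_unity A N c \<rho>" by (simp add: e)
  moreover have "integral_dV A g \<phi> = (\<Sum>k<N. chart_integral g (c k) (\<lambda>p. \<rho> k p * \<phi> p))" for g \<phi>
    by (simp add: integral_dV_def e chart_integral_def)
  ultimately show ?thesis by blast
qed

lemma matrix_inv_symmetric:
  fixes G :: "real^'n^'n"
  assumes "transpose G = G" "det G \<noteq> 0"
  shows "matrix_inv G $ i $ j = matrix_inv G $ j $ i"
proof -
  note G = matrix_inv_inverse[OF assms(2)]
  have "transpose (matrix_inv G) ** G = mat 1"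
    using arg_cong[OF G(1), of transpose] by (simp add: matrix_transpose_mul assms(1))
  then have "transpose (matrix_inv G) ** (G ** matrix_inv G) = matrix_inv G"
    by (simp add: matrix_mul_assoc)
  then have "transpose (matrix_inv G) = matrix_inv G" by (simp add: G)
  then have "transpose (matrix_inv G) $ j $ i = matrix_inv G $ j $ i" by simp
  then show ?thesis by (simp add: transpose_def)
qed

lemma directional_derivative:
  assumes "(F has_derivative F') (at x)"
  shows "((\<lambda>s. F (x + s *\<^sub>R v)) has_real_derivative F' v) (at (0::real))"
proof -
  have "((\<lambda>s. x + s *\<^sub>R v) has_derivative (\<lambda>s. s *\<^sub>R v)) (at 0)" by (auto intro!: derivative_eq_intros)
  moreover have "(F has_derivative F') (at (x + 0 *\<^sub>R v))" using assms by simp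
  ultimately have "((\<lambda>s. F (x + s *\<^sub>R v)) has_derivative (\<lambda>h. F' (h *\<^sub>R v))) (at 0)"
    by (rule has_derivative_compose)
  moreover have "(\<lambda>h. F' (h *\<^sub>R v)) = (*) (F' v)"
    using linear_cmul[OF has_derivative_linear[OF assms]] by (simp add: fun_eq_iff)
  ultimately show ?thesis by (simp add: has_field_derivative_def)
qed

text \<open>
  The contraction \<open>g\<^sup>i\<^sup>j \<Gamma>\<^sup>k\<^sub>i\<^sub>j\<close> with \<open>N\<close> for the inverse metric and \<open>D i\<close> for \<open>\<partial>\<^sub>i g\<close>. The first two terms of the
  Christoffel symbol agree after contraction and add up to \<open>- \<partial>\<^sub>i g\<^sup>i\<^sup>k\<close>; the third contributes
  \<open>- g\<^sup>k\<^sup>l \<partial>\<^sub>l log (sqrt (det g))\<close>.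
\<close>

lemma contracted_christoffel:
  fixes N :: "real^'n^'n" and D :: "'n \<Rightarrow> real^'n^'n"
  assumes sym: "\<And>i j. N $ i $ j = N $ j $ i"
  shows "(\<Sum>i\<in>UNIV. \<Sum>j\<in>UNIV. N $ i $ j * (1/2 * (\<Sum>l\<in>UNIV. N $ k $ l * (D i $ j $ l + D j $ i $ l - D l $ i $ j)))) =
    (\<Sum>i\<in>UNIV. (N ** D i ** N) $ i $ k) - 1/2 * (\<Sum>l\<in>UNIV. N $ l $ k * trace (N ** D l))"
proof -
  have 1: "(\<Sum>i\<in>UNIV. \<Sum>j\<in>UNIV. \<Sum>l\<in>UNIV. N $ i $ j * N $ k $ l * D i $ j $ l) = (\<Sum>i\<in>UNIV. (N ** D i ** N) $ i $ k)"
  proof (rule sum.cong[OF refl])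
    fix i
    have "(N ** D i ** N) $ i $ k = (\<Sum>l\<in>UNIV. \<Sum>j\<in>UNIV. N $ i $ j * N $ k $ l * D i $ j $ l)"
      by (simp add: matrix_matrix_mult_def sum_distrib_right sum_distrib_left sym[of k] mult_ac)
    then show "(\<Sum>j\<in>UNIV. \<Sum>l\<in>UNIV. N $ i $ j * N $ k $ l * D i $ j $ l) = (N ** D i ** N) $ i $ k"
      by (subst sum.swap) simp
  qed
  have 2: "(\<Sum>i\<in>UNIV. \<Sum>j\<in>UNIV. \<Sum>l\<in>UNIV. N $ i $ j * N $ k $ l * D j $ i $ l) =
      (\<Sum>i\<in>UNIV. \<Sum>j\<in>UNIV. \<Sum>l\<in>UNIV. N $ i $ j * N $ k $ l * D i $ j $ l)"
  proof -
    have "(\<Sum>i\<in>UNIV. \<Sum>j\<in>UNIV. \<Sum>l\<in>UNIV. N $ i $ j * N $ k $ l * D j $ i $ l) =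
        (\<Sum>j\<in>UNIV. \<Sum>i\<in>UNIV. \<Sum>l\<in>UNIV. N $ i $ j * N $ k $ l * D j $ i $ l)" by (rule sum.swap)
    also have "\<dots> = (\<Sum>j\<in>UNIV. \<Sum>i\<in>UNIV. \<Sum>l\<in>UNIV. N $ j $ i * N $ k $ l * D j $ i $ l)"
      by (intro sum.cong refl) (subst sym, rule refl)
    finally show ?thesis .
  qed
  have 3: "(\<Sum>i\<in>UNIV. \<Sum>j\<in>UNIV. \<Sum>l\<in>UNIV. N $ i $ j * N $ k $ l * D l $ i $ j) =
      (\<Sum>l\<in>UNIV. N $ l $ k * trace (N ** D l))"
  proof -
    have "N $ l $ k * trace (N ** D l) = (\<Sum>j\<in>UNIV. \<Sum>i\<in>UNIV. N $ i $ j * N $ k $ l * D l $ i $ j)" for l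
    proof -
      have "N $ l $ k * trace (N ** D l) = (\<Sum>j\<in>UNIV. \<Sum>i\<in>UNIV. N $ l $ k * (N $ j $ i * D l $ i $ j))"
        by (simp add: trace_def matrix_matrix_mult_def sum_distrib_left)
      also have "\<dots> = (\<Sum>j\<in>UNIV. \<Sum>i\<in>UNIV. N $ i $ j * N $ k $ l * D l $ i $ j)"
      proof (intro sum.cong refl)
        fix i j
        show "N $ l $ k * (N $ j $ i * D l $ i $ j) = N $ i $ j * N $ k $ l * D l $ i $ j"
          using sym[of l k] sym[of j i] by (simp add: mult_ac)
      qed
      finally show ?thesis .
    qed
    then have "(\<Sum>l\<in>UNIV. N $ l $ k * trace (N ** D l)) =
       (\<Sum>l\<in>UNIV. \<Sum>j\<in>UNIV. \<Sum>i\<in>UNIV. N $ i $ j * N $ k $ l * D l $ i $ j)" by simp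
    also have "\<dots> = (\<Sum>j\<in>UNIV. \<Sum>l\<in>UNIV. \<Sum>i\<in>UNIV. N $ i $ j * N $ k $ l * D l $ i $ j)" by (rule sum.swap)
    also have "\<dots> = (\<Sum>j\<in>UNIV. \<Sum>i\<in>UNIV. \<Sum>l\<in>UNIV. N $ i $ j * N $ k $ l * D l $ i $ j)"
      by (intro sum.cong refl sum.swap)
    also have "\<dots> = (\<Sum>i\<in>UNIV. \<Sum>j\<in>UNIV. \<Sum>l\<in>UNIV. N $ i $ j * N $ k $ l * D l $ i $ j)" by (rule sum.swap)
    finally show ?thesis by simp
  qed
  have "(\<Sum>i\<in>UNIV. \<Sum>j\<in>UNIV. N $ i $ j * (1/2 * (\<Sum>l\<in>UNIV. N $ k $ l * (D i $ j $ l + D j $ i $ l - D l $ i $ j)))) =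
    1/2 * ((\<Sum>i\<in>UNIV. \<Sum>j\<in>UNIV. \<Sum>l\<in>UNIV. N $ i $ j * N $ k $ l * D i $ j $ l) +
      (\<Sum>i\<in>UNIV. \<Sum>j\<in>UNIV. \<Sum>l\<in>UNIV. N $ i $ j * N $ k $ l * D j $ i $ l) -
      (\<Sum>i\<in>UNIV. \<Sum>j\<in>UNIV. \<Sum>l\<in>UNIV. N $ i $ j * N $ k $ l * D l $ i $ j))"
    by (simp add: sum_distrib_left sum.distrib[symmetric] sum_subtractf[symmetric] algebra_simps)
  then show ?thesis unfolding 2 1 3 by simp
qed

text \<open>
  The inner product \<open>\<langle>da, db\<rangle>\<close> of the differentials, computed in the chart \<open>c\<close>.
\<close>

definition cometric :: "('m, 'n::finite) tensor2 \<Rightarrow> ('m, 'n) chart \<Rightarrow> ('m \<Rightarrow> real) \<Rightarrow> ('m \<Rightarrow> real) \<Rightarrow> 'm \<Rightarrow> real" where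
  "cometric g c a b p = differential a c p \<bullet> (ginv g c p *v differential b c p)"

definition chart_laplacian :: "('m, 'n::finite) tensor2 \<Rightarrow> ('m, 'n) chart \<Rightarrow> ('m \<Rightarrow> real) \<Rightarrow> 'm \<Rightarrow> real" where
  "chart_laplacian g c h p = (\<Sum>i\<in>UNIV. \<Sum>j\<in>UNIV. ginv g c p $ i $ j * hessian g h c p $ i $ j)"

context compact_mfd begin

lemma continuous_on_chartI:
  assumes "c \<in> A" "continuous_on (img_of c) (\<lambda>x. \<phi> (point c x))"
  shows "continuous_on (dom_of c) \<phi>"
proof -
  have "continuous_on (dom_of c) (\<lambda>q. \<phi> (point c (coord c q)))"
    using assms(2) chartD(7)[OF assms(1)] by (rule continuous_on_compose2) (use chartD(3)[OF assms(1)] in auto)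
  then show ?thesis by (rule continuous_on_eq) (simp add: chartD(4)[OF assms(1)])
qed

lemma continuous_on_chartD:
  assumes "c \<in> A" "continuous_on (dom_of c) \<phi>"
  shows "continuous_on (img_of c) (\<lambda>x. \<phi> (point c x))"
  using assms(2) chartD(8)[OF assms(1)] by (rule continuous_on_compose2) (use chartD(5)[OF assms(1)] in auto)

lemma pd_has_derivative:
  assumes "smooth_fun A h" "c \<in> A" "p \<in> dom_of c"
  shows "((\<lambda>x. h (point c x)) has_derivative (\<lambda>v. \<Sum>i\<in>UNIV. v $ i * pd c i h p)) (at (coord c p))"
proof -
  let ?D = "frechet_derivative (\<lambda>x. h (point c x)) (at (coord c p))"
  have d: "((\<lambda>x. h (point c x)) has_derivative ?D) (at (coord c p))"
    by (rule C_on_differentiable[OF smooth_funD[OF assms(1,2), of "Suc 0"] chartD(3)[OF assms(2,3)]])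
  have "?D v = (\<Sum>i\<in>UNIV. v $ i * pd c i h p)" for v
  proof -
    have "v = (\<Sum>i\<in>UNIV. v $ i *\<^sub>R axis i 1)" 
      by (simp add: vec_eq_iff axis_def if_distrib cong: if_cong)
    then have "?D v = ?D (\<Sum>i\<in>UNIV. v $ i *\<^sub>R axis i 1)" by simp
    also have "\<dots> = (\<Sum>i\<in>UNIV. v $ i * ?D (axis i 1))"
      by (simp add: linear_sum[OF has_derivative_linear[OF d]] linear_cmul[OF has_derivative_linear[OF d]])
    finally show ?thesis by (simp add: pd_def comp_def)
  qed
  then have "?D = (\<lambda>v. \<Sum>i\<in>UNIV. v $ i * pd c i h p)" by (rule ext)
  with d show ?thesis by simp
qed

lemma pd_eqI:
  assumes "((\<lambda>x. h (point c x)) has_derivative D) (at (coord c p))"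
  shows "pd c i h p = D (axis i 1)"
  using frechet_derivative_at[OF assms] by (simp add: pd_def comp_def)

lemma C_on_pd:
  assumes "c \<in> A" "\<And>k. C_on k (img_of c) (\<lambda>x. h (point c x))"
  shows "C_on k (img_of c) (\<lambda>x. pd c i h (point c x))"
proof -
  have "C_on k (img_of c) (\<lambda>x. frechet_derivative (\<lambda>x. h (point c x)) (at x) (axis i 1))"
    using assms(2)[of "Suc k"] by simp
  then show ?thesis
    by (rule C_on_cong[OF chartD(2)[OF assms(1)], rotated]) (simp add: pd_def comp_def chartD(6)[OF assms(1)])
qed

lemma pd_mult:
  assumes "smooth_fun A a" "smooth_fun A b" "c \<in> A" "p \<in> dom_of c"
  shows "pd c i (\<lambda>p. a p * b p) p = a p * pd c i b p + pd c i a p * b p"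
  using pd_eqI[OF has_derivative_mult[OF pd_has_derivative[OF assms(1,3,4)] pd_has_derivative[OF assms(2-4)]], of i]
  by (simp add: axis_def chartD(4)[OF assms(3,4)] if_distrib[of "\<lambda>x. x * _"] cong: if_cong)

lemma pd_sum:
  assumes "finite I" "\<And>k. k \<in> I \<Longrightarrow> smooth_fun A (a k)" "c \<in> A" "p \<in> dom_of c"
  shows "pd c i (\<lambda>p. \<Sum>k\<in>I. a k p) p = (\<Sum>k\<in>I. pd c i (a k) p)"
  using pd_eqI[OF has_derivative_sum[OF pd_has_derivative[OF assms(2-4)]], of I "\<lambda>k. k" i]
  by (simp add: axis_def if_distrib[of "\<lambda>x. x * _"] cong: if_cong)

lemma pd_const: "pd c i (\<lambda>p. k) p = 0"
  using pd_eqI[of "\<lambda>_. k" c "\<lambda>_. 0" p i] by simp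

lemma pd_eq_0:
  assumes "c \<in> A" "p \<in> dom_of c" "open W" "p \<in> W" "\<And>q. q \<in> W \<Longrightarrow> h q = 0"
  shows "pd c i h p = 0"
proof -
  let ?V = "coord c ` (dom_of c \<inter> W)"
  have "((\<lambda>x. h (point c x)) has_derivative (\<lambda>_. 0)) (at (coord c p))"
  proof (rule has_derivative_transform_within_open[of "\<lambda>_. 0" _ _ _ ?V])
    show "open ?V" by (rule open_coord_image[OF chart[OF assms(1)] assms(3)])
  qed (use assms chartD(4)[OF assms(1)] in auto)
  from pd_eqI[OF this] show ?thesis by simp
qed

lemma transition_has_derivative:
  assumes "c \<in> A" "d \<in> A" "p \<in> dom_of c" "p \<in> dom_of d"
  shows "(transition c d has_derivative frechet_derivative (transition c d) (at (coord c p))) (at (coord c p))"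
  by (rule C_on_differentiable[OF C_on_transition[OF assms(1,2), of "Suc 0"]]) (use assms in auto)

text \<open>
  The chain rule for \<open>h\<close> read in \<open>c\<close> as the composition of \<open>h\<close> read in \<open>d\<close> with the transition map.
\<close>

lemma differential_change:
  assumes h: "smooth_fun A h" and "c \<in> A" "d \<in> A" "p \<in> dom_of c" "p \<in> dom_of d"
  shows "differential h c p = transpose (jacobian (transition c d) (at (coord c p))) *v differential h d p"
proof -
  let ?T = "frechet_derivative (transition c d) (at (coord c p))"
  let ?V = "coord c ` (dom_of c \<inter> dom_of d)"
  have e: "transition c d (coord c p) = coord d p"
    by (simp add: transition_def chartD(4) assms)
  have "((\<lambda>x. h (point d (transition c d x))) has_derivative (\<lambda>v. \<Sum>a\<in>UNIV. ?T v $ a * pd d a h p)) (at (coord c p))"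
    by (rule has_derivative_compose[OF transition_has_derivative[OF assms(2-5)]])
       (simp add: e pd_has_derivative[OF h assms(3,5)])
  then have "((\<lambda>x. h (point c x)) has_derivative (\<lambda>v. \<Sum>a\<in>UNIV. ?T v $ a * pd d a h p)) (at (coord c p))"
    by (rule has_derivative_transform_within_open[OF _ open_overlap[OF assms(2,3)]])
       (use assms chartD(4)[OF assms(2)] chartD(4)[OF assms(3)] in \<open>auto simp: transition_def\<close>)
  from pd_eqI[OF this] show ?thesis
    by (simp add: vec_eq_iff differential_def matrix_vector_mult_def transpose_def jacobian_def matrix_def)
qed

end

locale riemannian = compact_mfd A for A :: "('m::t2_space, 'n::finite) chart set" +
  fixes g :: "('m, 'n) tensor2"
  assumes metric: "riemannian_metric A g"
begin

abbreviation vol :: "('m, 'n) chart \<Rightarrow> real^'n \<Rightarrow> real" where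
  "vol c x \<equiv> sqrt (det (g c (point c x)))"

lemma metric_change:
  assumes "c \<in> A" "d \<in> A" "p \<in> dom_of c" "p \<in> dom_of d"
  shows "g c p = transpose (jacobian (transition c d) (at (coord c p))) ** g d p ** jacobian (transition c d) (at (coord c p))"
  using metric assms unfolding riemannian_metric_def is_tensor2_def Let_def by blast

lemma metric_det_pos: "c \<in> A \<Longrightarrow> p \<in> dom_of c \<Longrightarrow> det (g c p) > 0"
  using metric unfolding riemannian_metric_def by (blast intro: pos_def_det_pos)

lemma ginv_symmetric: "c \<in> A \<Longrightarrow> p \<in> dom_of c \<Longrightarrow> ginv g c p $ i $ j = ginv g c p $ j $ i"
  using metric metric_det_pos[of c p] matrix_inv_symmetric[of "g c p"]
  unfolding riemannian_metric_def ginv_def by fastforce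

lemma C_on_metric: "c \<in> A \<Longrightarrow> C_on k (img_of c) (\<lambda>x. g c (point c x))"
  using metric smooth_on_open[OF chartD(2)] unfolding riemannian_metric_def by blast

lemma metric_image: "c \<in> A \<Longrightarrow> (\<lambda>x. g c (point c x)) ` img_of c \<subseteq> {G. det G > 0}"
  using metric_det_pos[of c] chartD(5)[of c] by auto

lemma C_on_vol: "c \<in> A \<Longrightarrow> C_on k (img_of c) (vol c)"
  by (rule C_on_compose[OF chartD(2) open_det_pos metric_image C_on_sqrt_det C_on_metric])

lemma C_on_ginv: "c \<in> A \<Longrightarrow> C_on k (img_of c) (\<lambda>x. ginv g c (point c x) $ i $ j)"
  unfolding ginv_def
  by (rule C_on_compose[OF chartD(2) open_det_pos metric_image C_on_matrix_inv C_on_metric])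

lemma cometric_change:
  assumes "smooth_fun A a" "smooth_fun A b" "c \<in> A" "d \<in> A" "p \<in> dom_of c" "p \<in> dom_of d"
  shows "cometric g c a b p = cometric g d a b p"
  unfolding cometric_def ginv_def differential_change[OF assms(1,3-6)] differential_change[OF assms(2,3-6)]
  by (rule congruent_pairing[OF metric_change[OF assms(3-6)]]) (use metric_det_pos[OF assms(3,5)] in simp)

lemma C_on_cometric:
  assumes "smooth_fun A a" "smooth_fun A b" "c \<in> A"
  shows "C_on k (img_of c) (\<lambda>x. cometric g c a b (point c x))"
  unfolding cometric_def inner_vec_def matrix_vector_mult_def differential_def
  by (simp add: sum_distrib_left)
     (intro C_on_sum C_on_mult C_on_ginv C_on_pd smooth_funD assms chartD(2) finite)

lemma cometric_eq_sum: "cometric g c a b p = (\<Sum>i\<in>UNIV. pd c i a p * (\<Sum>j\<in>UNIV. ginv g c p $ i $ j * pd c j b p))"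
  by (simp add: cometric_def inner_vec_def matrix_vector_mult_def differential_def)

lemma grad_norm_sq_eq_cometric: "grad_norm_sq A g h p = cometric g (chart_at A p) h h p"
proof -
  let ?c = "chart_at A p"
  have "g ?c p *v (ginv g ?c p *v differential h ?c p) = differential h ?c p"
    using matrix_inv_inverse[of "g ?c p"] metric_det_pos[OF chart_at, of p]
    by (simp add: ginv_def matrix_vector_mul_assoc)
  then show ?thesis
    by (simp add: grad_norm_sq_def gradient_def Let_def cometric_def inner_commute)
qed

lemma chart_integral_cong:
  assumes "c \<in> A" "\<And>p. p \<in> dom_of c \<Longrightarrow> \<phi> p = \<psi> p"
  shows "chart_integral g c \<phi> = chart_integral g c \<psi>"
  unfolding chart_integral_def
  by (rule set_lebesgue_integral_cong) (use assms chartD(2,5)[OF assms(1)] in auto)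

text \<open>
  Chart integrals are used for functions that vanish off a closed subset \<open>K\<close> of the domain of the chart.
  By compactness of the manifold, the image of \<open>K\<close> is compact, and everything is integrable.
\<close>

lemma chart_integrand:
  assumes "c \<in> A" "continuous_on (dom_of c) \<phi>" "closed K" "K \<subseteq> dom_of c" "\<And>p. p \<in> dom_of c - K \<Longrightarrow> \<phi> p = 0"
  shows "continuous_on (img_of c) (\<lambda>x. \<phi> (point c x) * vol c x)"
    "\<And>x. x \<in> img_of c - coord c ` K \<Longrightarrow> \<phi> (point c x) * vol c x = 0"
    "set_integrable lborel (img_of c) (\<lambda>x. \<phi> (point c x) * vol c x)"
    "compact (coord c ` K)" "coord c ` K \<subseteq> img_of c"
proof -
  show c: "continuous_on (img_of c) (\<lambda>x. \<phi> (point c x) * vol c x)"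
    by (intro continuous_on_mult continuous_on_chartD[OF assms(1,2)] C_on_imp_continuous_on[OF C_on_vol[OF assms(1)]])
  show z: "\<phi> (point c x) * vol c x = 0" if "x \<in> img_of c - coord c ` K" for x
  proof -
    have "point c x \<notin> K" using that chartD(6)[OF assms(1), of x] by force
    then show ?thesis using assms(5) chartD(5)[OF assms(1), of x] that by auto
  qed
  show k: "compact (coord c ` K)" by (rule compact_coord_image[OF assms(1,3,4)])
  show s: "coord c ` K \<subseteq> img_of c" using assms(4) by (auto simp: img_of_def)
  show "set_integrable lborel (img_of c) (\<lambda>x. \<phi> (point c x) * vol c x)"
    by (rule set_integrable_compact_support[OF chartD(2)[OF assms(1)] k s c z])
qed

lemma chart_integral_sum:
  assumes "finite I" "c \<in> A" "closed K" "K \<subseteq> dom_of c" "\<And>i. i \<in> I \<Longrightarrow> continuous_on (dom_of c) (\<phi> i)"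
    "\<And>i p. i \<in> I \<Longrightarrow> p \<in> dom_of c - K \<Longrightarrow> \<phi> i p = 0"
  shows "chart_integral g c (\<lambda>p. \<Sum>i\<in>I. \<phi> i p) = (\<Sum>i\<in>I. chart_integral g c (\<phi> i))"
proof -
  have "(LINT x:img_of c|lborel. (\<Sum>i\<in>I. \<phi> i (point c x) * vol c x)) =
      (\<Sum>i\<in>I. LINT x:img_of c|lborel. \<phi> i (point c x) * vol c x)"
    using chart_integrand(3)[OF assms(2,5,3,4,6)] assms(1)
    unfolding set_lebesgue_integral_def set_integrable_def scaleR_sum_right by (intro Bochner_Integration.integral_sum) auto
  then show ?thesis by (simp add: chart_integral_def sum_distrib_right)
qed

text \<open>
  Taking determinants in \<open>G = J\<^sup>T H J\<close> gives \<open>sqrt (det G) = |det J| sqrt (det H)\<close>, which is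
  the factor in the change of variables along the transition map.
\<close>

lemma chart_integral_change:
  assumes "c \<in> A" "d \<in> A" "closed K" "K \<subseteq> dom_of c \<inter> dom_of d"
    and \<phi>: "continuous_on (dom_of c \<inter> dom_of d) \<phi>" "\<And>p. p \<notin> K \<Longrightarrow> \<phi> p = 0"
  shows "chart_integral g c \<phi> = chart_integral g d \<phi>"
proof -
  let ?T = "transition c d" and ?T' = "\<lambda>x. frechet_derivative (transition c d) (at x)"
  let ?Vc = "coord c ` (dom_of c \<inter> dom_of d)" and ?Vd = "coord d ` (dom_of c \<inter> dom_of d)"
  have restrict: "chart_integral g e \<phi> = (LINT x:coord e ` (dom_of c \<inter> dom_of d)|lborel. \<phi> (point e x) * vol e x)"
    and int: "set_integrable lborel (coord e ` (dom_of c \<inter> dom_of d)) (\<lambda>x. \<phi> (point e x) * vol e x)"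
    if e: "e \<in> A" "dom_of c \<inter> dom_of d \<subseteq> dom_of e" for e
  proof -
    let ?V = "coord e ` (dom_of c \<inter> dom_of d)"
    have V: "?V = {x \<in> img_of e. point e x \<in> dom_of c \<inter> dom_of d}"
      by (rule coord_image_eq[OF chart[OF e(1)] e(2)])
    have o: "open ?V"
      using open_coord_image[OF chart[OF e(1)], of "dom_of c \<inter> dom_of d"] e(2) chartD(1) assms(1,2)
      by (simp add: Int_absorb1 open_Int)
    show "chart_integral g e \<phi> = (LINT x:?V|lborel. \<phi> (point e x) * vol e x)"
      unfolding chart_integral_def set_lebesgue_integral_def
    proof (rule Bochner_Integration.integral_cong[OF refl])
      fix x
      show "indicator (img_of e) x *\<^sub>R (\<phi> (point e x) * vol e x) = indicator ?V x *\<^sub>R (\<phi> (point e x) * vol e x)"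
        using \<phi>(2)[of "point e x"] assms(4) V by (auto simp: indicator_def)
    qed
    show "set_integrable lborel ?V (\<lambda>x. \<phi> (point e x) * vol e x)"
    proof (rule set_integrable_compact_support[OF o, of "coord e ` K"])
      show "compact (coord e ` K)" by (rule compact_coord_image[OF e(1) assms(3)]) (use assms(4) e(2) in auto)
      have "continuous_on ?V (\<lambda>x. \<phi> (point e x))"
        by (rule continuous_on_compose2[OF \<phi>(1) continuous_on_subset[OF chartD(8)[OF e(1)]]]) (auto simp: V)
      then show "continuous_on ?V (\<lambda>x. \<phi> (point e x) * vol e x)"
        by (intro continuous_on_mult continuous_on_subset[OF C_on_imp_continuous_on[OF C_on_vol[OF e(1)]]]) (auto simp: V)
      show "\<phi> (point e x) * vol e x = 0" if "x \<in> ?V - coord e ` K" for x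
      proof -
        have "x \<in> img_of e" using that unfolding V by simp
        then have "point e x \<notin> K" using that chartD(6)[OF e(1), of x] by (metis DiffD2 imageI)
        then show ?thesis using \<phi>(2) by simp
      qed
      show "coord e ` K \<subseteq> ?V" by (rule image_mono[OF assms(4)])
    qed
  qed
  have T: "?T ` ?Vc = ?Vd" by (rule transition_image[OF assms(1,2)])
  have der: "(?T has_derivative ?T' x) (at x)" if "x \<in> ?Vc" for x
    using that transition_has_derivative[OF assms(1,2)] by auto
  have inj: "inj_on ?T ?Vc"
  proof (rule inj_on_inverseI[where g="transition d c"])
    fix x assume "x \<in> ?Vc"
    then show "transition d c (?T x) = x"
      using chartD(4)[OF assms(1)] chartD(4)[OF assms(2)] by (auto simp: transition_def)
  qed
  have eq: "\<bar>det (matrix (?T' x))\<bar> * (\<phi> (point d (?T x)) * vol d (?T x)) = \<phi> (point c x) * vol c x" if x: "x \<in> ?Vc" for x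
  proof -
    obtain p where p: "p \<in> dom_of c" "p \<in> dom_of d" "x = coord c p" using x by auto
    have "det (g c p) = (det (matrix (?T' x)))\<^sup>2 * det (g d p)"
      using congruent_matrix_inv(2)[OF metric_change[OF assms(1,2) p(1,2)]] metric_det_pos[OF assms(1) p(1)]
      by (simp add: jacobian_def p(3))
    then have "sqrt (det (g c p)) = \<bar>det (matrix (?T' x))\<bar> * sqrt (det (g d p))" by (simp add: real_sqrt_mult)
    then show ?thesis by (simp add: transition_def p chartD(4) assms)
  qed
  have "chart_integral g d \<phi> = (LINT y:?T ` ?Vc|lborel. \<phi> (point d y) * vol d y)"
    unfolding T by (rule restrict) (use assms in auto)
  also have "\<dots> = (LINT x:?Vc|lborel. \<bar>det (matrix (?T' x))\<bar> * (\<phi> (point d (?T x)) * vol d (?T x)))"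
  proof (rule set_integral_change_of_variables[OF open_overlap[OF assms(1,2)] der inj])
    show "set_integrable lborel (?T ` ?Vc) (\<lambda>x. \<phi> (point d x) * vol d x)"
      unfolding T by (rule int) (use assms in auto)
    have "set_integrable lborel ?Vc (\<lambda>x. \<phi> (point c x) * vol c x)" by (rule int) (use assms in auto)
    then show "set_integrable lborel ?Vc (\<lambda>x. \<bar>det (matrix (?T' x))\<bar> * (\<phi> (point d (?T x)) * vol d (?T x)))"
      by (rule set_integrable_cong[THEN iffD1, OF refl refl, rotated]) (simp add: eq)
  qed
  also have "\<dots> = (LINT x:?Vc|lborel. \<phi> (point c x) * vol c x)"
    by (rule set_lebesgue_integral_cong) (use open_overlap[OF assms(1,2)] eq in auto)
  also have "\<dots> = chart_integral g c \<phi>"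
    by (rule restrict[symmetric]) (use assms in auto)
  finally show ?thesis by simp
qed

end

section \<open>The Laplacian as a divergence and Green's identity\<close>

lemma continuous_on_zero_off:
  fixes \<phi> :: "'a::topological_space \<Rightarrow> real"
  assumes "open S" "closed K" "K \<subseteq> S" "continuous_on S \<phi>" "\<And>p. p \<notin> K \<Longrightarrow> \<phi> p = 0"
  shows "continuous_on UNIV \<phi>"
proof -
  have "continuous_on (- K) \<phi>"
    by (rule continuous_on_eq[OF continuous_on_const[of _ 0]]) (simp add: assms(5))
  then have "continuous_on (S \<union> - K) \<phi>"
    using assms by (intro continuous_on_open_Un) auto
  moreover have "S \<union> - K = UNIV" using assms(3) by auto
  ultimately show ?thesis by simp
qed

context riemannian begin

text \<open>
  The components \<open>sqrt (det g) g\<^sup>i\<^sup>j \<partial>\<^sub>j h\<close> of the gradient as a vector density.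
\<close>

definition flux :: "('m, 'n) chart \<Rightarrow> ('m \<Rightarrow> real) \<Rightarrow> 'n \<Rightarrow> real^'n \<Rightarrow> real" where
  "flux c h i x = (\<Sum>j\<in>UNIV. ginv g c (point c x) $ i $ j * vol c x * pd c j h (point c x))"

lemma C_on_flux: "smooth_fun A h \<Longrightarrow> c \<in> A \<Longrightarrow> C_on k (img_of c) (flux c h i)"
  unfolding flux_def[abs_def]
  by (intro C_on_sum C_on_mult C_on_ginv C_on_vol C_on_pd smooth_funD chartD(2) finite)

text \<open>
  The classical formula \<open>\<partial>\<^sub>i (sqrt (det g) g\<^sup>i\<^sup>j \<partial>\<^sub>j h) = sqrt (det g) \<Delta>h\<close>. The product rule produces
  derivatives of the inverse metric and of the density, and \<open>contracted_christoffel\<close> identifies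
  them with the Christoffel terms of the Hessian.
\<close>

lemma divergence_flux:
  assumes h: "smooth_fun A h" and c: "c \<in> A" and x: "x \<in> img_of c"
  shows "(\<Sum>i\<in>UNIV. frechet_derivative (flux c h i) (at x) (axis i 1)) = chart_laplacian g c h (point c x) * vol c x"
proof -
  define p where "p = point c x"
  have p: "p \<in> dom_of c" "coord c p = x" using chartD(5,6)[OF c x] by (auto simp: p_def)
  define N where "N = ginv g c p"
  define D where "D i = (\<chi> a b. pd c i (\<lambda>q. g c q $ a $ b) p)" for i
  define v where "v = vol c x"
  have sym: "N $ i $ j = N $ j $ i" for i j unfolding N_def by (rule ginv_symmetric[OF c p(1)])
  have flux: "frechet_derivative (flux c h i) (at x) (axis i 1) =
     (\<Sum>j\<in>UNIV. (- (N ** D i ** N) $ i $ j * v + trace (N ** D i) / 2 * v * N $ i $ j) * pd c j h p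
        + N $ i $ j * v * pd c i (pd c j h) p)" for i
  proof -
    let ?z = "\<lambda>s::real. x + s *\<^sub>R axis i 1"
    \<comment> \<open>The partial derivatives are derivatives along coordinate lines, where the curve lemmas for matrices apply.\<close>
    define J where "J = {s. ?z s \<in> img_of c}"
    have "open (?z -` img_of c)"
      by (rule open_vimage[OF chartD(2)[OF c]]) (intro continuous_intros)
    then have J: "open J" "0 \<in> J" using x by (auto simp: J_def vimage_def)
    have at: "at 0 within J = at 0" by (rule at_within_open[OF J(2,1)])
    define M where "M s = g c (point c (?z s))" for s
    have M0: "M 0 = g c p" by (simp add: M_def p_def)
    have dir: "((\<lambda>s. F (?z s)) has_real_derivative frechet_derivative F (at x) (axis i 1)) (at 0 within J)"
      if "C_on (Suc 0) (img_of c) F" for F :: "real^'n \<Rightarrow> real"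
      unfolding at by (rule directional_derivative[OF C_on_differentiable[OF that x]])
    have pdir: "((\<lambda>s. q (point c (?z s))) has_real_derivative pd c i q p) (at 0 within J)"
      if "C_on (Suc 0) (img_of c) (\<lambda>x. q (point c x))" for q :: "'m \<Rightarrow> real"
      using dir[OF that] by (simp add: pd_def p comp_def)
    have dM: "((\<lambda>s. M s $ a $ b) has_real_derivative D i $ a $ b) (at 0 within J)" for a b
      using pdir[of "\<lambda>q. g c q $ a $ b"]
        C_on_compose[OF chartD(2)[OF c] open_UNIV _ C_on_entry C_on_metric[OF c], of "Suc 0" a b]
      by (simp add: D_def M_def)
    have pos: "det (M s) > 0" if "s \<in> J" for s
      unfolding M_def using metric_det_pos[OF c chartD(5)[OF c]] that by (simp add: J_def)
    have dN: "((\<lambda>s. ginv g c (point c (?z s)) $ i $ j) has_real_derivative - (N ** D i ** N) $ i $ j) (at 0 within J)" for j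
      using matrix_inv_derivative[OF dM pos J(2), of i j] by (simp add: M0 M_def ginv_def N_def p_def)
    have dv: "((\<lambda>s. vol c (?z s)) has_real_derivative trace (N ** D i) / 2 * v) (at 0 within J)"
      using sqrt_det_derivative[OF dM pos[OF J(2)]] by (simp add: M0 M_def ginv_def N_def p_def v_def)
    have dh: "((\<lambda>s. pd c j h (point c (?z s))) has_real_derivative pd c i (pd c j h) p) (at 0 within J)" for j
      by (rule pdir[OF C_on_pd[OF c smooth_funD[OF h c]]])
    define E where "E j = ((- (N ** D i ** N) $ i $ j) * v + (trace (N ** D i) / 2 * v) * N $ i $ j) * pd c j h p
        + pd c i (pd c j h) p * (N $ i $ j * v)" for j
    have "((\<lambda>s. ginv g c (point c (?z s)) $ i $ j * vol c (?z s) * pd c j h (point c (?z s)))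
        has_real_derivative E j) (at 0 within J)" for j
      using DERIV_mult[OF DERIV_mult[OF dN[of j] dv] dh[of j]] by (simp add: E_def N_def p_def v_def)
    then have "((\<lambda>s. flux c h i (?z s)) has_real_derivative (\<Sum>j\<in>UNIV. E j)) (at 0 within J)"
      unfolding flux_def by (rule DERIV_sum)
    with dir[OF C_on_flux[OF h c, of "Suc 0" i]]
    have "frechet_derivative (flux c h i) (at x) (axis i 1) = (\<Sum>j\<in>UNIV. E j)"
      unfolding at by (rule DERIV_unique)
    also have "\<dots> = (\<Sum>j\<in>UNIV. (- (N ** D i ** N) $ i $ j * v + trace (N ** D i) / 2 * v * N $ i $ j) * pd c j h p
        + N $ i $ j * v * pd c i (pd c j h) p)"
      unfolding E_def by (intro sum.cong refl) (simp add: mult_ac)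
    finally show ?thesis .
  qed
  have chr: "(\<Sum>i\<in>UNIV. \<Sum>j\<in>UNIV. N $ i $ j * christoffel g c k i j p) =
    (\<Sum>i\<in>UNIV. (N ** D i ** N) $ i $ k - trace (N ** D i) / 2 * N $ i $ k)" for k
  proof -
    have "(\<Sum>i\<in>UNIV. \<Sum>j\<in>UNIV. N $ i $ j * christoffel g c k i j p) =
      (\<Sum>i\<in>UNIV. (N ** D i ** N) $ i $ k) - 1/2 * (\<Sum>l\<in>UNIV. N $ l $ k * trace (N ** D l))"
      using contracted_christoffel[OF sym, of k D] by (simp add: christoffel_def D_def N_def)
    then show ?thesis by (simp add: sum_subtractf sum_distrib_left mult_ac)
  qed
  have "(\<Sum>i\<in>UNIV. \<Sum>j\<in>UNIV. N $ i $ j * (\<Sum>k\<in>UNIV. christoffel g c k i j p * pd c k h p)) =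
     (\<Sum>i\<in>UNIV. \<Sum>j\<in>UNIV. \<Sum>k\<in>UNIV. (N $ i $ j * christoffel g c k i j p) * pd c k h p)"
    by (simp add: sum_distrib_left mult_ac)
  also have "\<dots> = (\<Sum>i\<in>UNIV. \<Sum>k\<in>UNIV. \<Sum>j\<in>UNIV. (N $ i $ j * christoffel g c k i j p) * pd c k h p)"
    by (intro sum.cong refl sum.swap)
  also have "\<dots> = (\<Sum>k\<in>UNIV. \<Sum>i\<in>UNIV. \<Sum>j\<in>UNIV. (N $ i $ j * christoffel g c k i j p) * pd c k h p)"
    by (rule sum.swap)
  also have "\<dots> = (\<Sum>k\<in>UNIV. (\<Sum>i\<in>UNIV. \<Sum>j\<in>UNIV. N $ i $ j * christoffel g c k i j p) * pd c k h p)"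
    by (simp add: sum_distrib_right)
  also have "\<dots> = (\<Sum>k\<in>UNIV. \<Sum>i\<in>UNIV. ((N ** D i ** N) $ i $ k - trace (N ** D i) / 2 * N $ i $ k) * pd c k h p)"
    unfolding chr by (simp only: sum_distrib_right)
  also have "\<dots> = (\<Sum>i\<in>UNIV. \<Sum>k\<in>UNIV. ((N ** D i ** N) $ i $ k - trace (N ** D i) / 2 * N $ i $ k) * pd c k h p)"
    by (rule sum.swap)
  finally have "chart_laplacian g c h p =
     (\<Sum>i\<in>UNIV. \<Sum>j\<in>UNIV. N $ i $ j * pd c i (pd c j h) p) -
     (\<Sum>i\<in>UNIV. \<Sum>k\<in>UNIV. ((N ** D i ** N) $ i $ k - trace (N ** D i) / 2 * N $ i $ k) * pd c k h p)"
    by (simp add: chart_laplacian_def hessian_def N_def right_diff_distrib sum_subtractf)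
  then have "chart_laplacian g c h p = (\<Sum>i\<in>UNIV. \<Sum>j\<in>UNIV. N $ i $ j * pd c i (pd c j h) p -
      ((N ** D i ** N) $ i $ j - trace (N ** D i) / 2 * N $ i $ j) * pd c j h p)"
    by (simp only: sum_subtractf)
  then have "chart_laplacian g c h p * v = (\<Sum>i\<in>UNIV. \<Sum>j\<in>UNIV. (N $ i $ j * pd c i (pd c j h) p -
      ((N ** D i ** N) $ i $ j - trace (N ** D i) / 2 * N $ i $ j) * pd c j h p) * v)"
    by (simp only: sum_distrib_right)
  also have "\<dots> = (\<Sum>i\<in>UNIV. frechet_derivative (flux c h i) (at x) (axis i 1))"
    unfolding flux by (intro sum.cong refl) (simp add: algebra_simps)
  finally have "chart_laplacian g c h p * v = (\<Sum>i\<in>UNIV. frechet_derivative (flux c h i) (at x) (axis i 1))" .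
  then show ?thesis by (simp add: p_def v_def)
qed

lemma continuous_on_chart_laplacian:
  assumes "smooth_fun A h" "c \<in> A"
  shows "continuous_on (dom_of c) (chart_laplacian g c h)"
proof (rule continuous_on_chartI[OF assms(2)])
  have nz: "vol c x \<noteq> 0" if "x \<in> img_of c" for x
    using metric_det_pos[OF assms(2) chartD(5)[OF assms(2) that]] by simp
  have "continuous_on (img_of c) (\<lambda>x. frechet_derivative (flux c h i) (at x) (axis i 1))" for i
    using C_on_flux[OF assms, of "Suc 0" i] by simp
  then have "continuous_on (img_of c) (\<lambda>x. (\<Sum>i\<in>UNIV. frechet_derivative (flux c h i) (at x) (axis i 1)) / vol c x)"
    using nz by (intro continuous_on_divide continuous_on_sum C_on_imp_continuous_on[OF C_on_vol[OF assms(2)]]) auto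
  then show "continuous_on (img_of c) (\<lambda>x. chart_laplacian g c h (point c x))"
    by (rule continuous_on_eq) (use nz in \<open>simp add: divergence_flux[OF assms]\<close>)
qed

lemma zero_off_support: "p \<notin> closure {q. \<phi> q \<noteq> 0} \<Longrightarrow> \<phi> p = 0"
  using closure_subset[of "{q. \<phi> q \<noteq> 0}"] by auto

lemma mult_off_support: "p \<notin> closure {q. \<phi> q \<noteq> 0} \<Longrightarrow> \<phi> p * r = (0::real)"
  using zero_off_support[of p \<phi>] by simp

lemma pd_off_support:
  assumes "c \<in> A" "p \<in> dom_of c" "p \<notin> closure {q. \<phi> q \<noteq> 0}"
  shows "pd c i \<phi> p = 0"
proof (rule pd_eq_0[OF assms(1,2)])
  show "open (- closure {q. \<phi> q \<noteq> 0})" by (rule open_Compl[OF closed_closure])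
  show "p \<in> - closure {q. \<phi> q \<noteq> 0}" using assms(3) by simp
  show "\<phi> q = 0" if "q \<in> - closure {q. \<phi> q \<noteq> 0}" for q
    by (rule zero_off_support) (use that in simp)
qed

lemma cometric_eq_0:
  assumes "c \<in> A" "p \<in> dom_of c" "p \<notin> closure {q. \<phi> q \<noteq> 0}"
  shows "cometric g c \<phi> a p = 0"
  by (simp add: cometric_eq_sum pd_off_support[OF assms])

text \<open>
  The divergence of \<open>\<phi>\<close> times the flux of \<open>a\<close> integrates to zero, and the product rule splits it into
  the two integrands.
\<close>

lemma chart_Green:
  assumes \<phi>: "smooth_fun A \<phi>" and a: "smooth_fun A a" and c: "c \<in> A"
    and K: "closure {q. \<phi> q \<noteq> 0} \<subseteq> dom_of c"
  shows "chart_integral g c (\<lambda>p. \<phi> p * chart_laplacian g c a p) = - chart_integral g c (cometric g c \<phi> a)"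
proof -
  let ?K = "closure {q. \<phi> q \<noteq> 0}" and ?U = "img_of c"
  define F where "F i x = \<phi> (point c x) * flux c a i x" for i x
  define u where "u i x = frechet_derivative (F i) (at x) (axis i 1)" for i x
  have CF: "C_on k ?U (F i)" for k i
    unfolding F_def by (intro C_on_mult chartD(2) c smooth_funD \<phi> C_on_flux a)
  have cK: "compact (coord c ` ?K)" "coord c ` ?K \<subseteq> ?U"
    using compact_coord_image[OF c closed_closure K] K by (auto simp: img_of_def)
  have off: "point c x \<notin> ?K" if "x \<in> ?U - coord c ` ?K" for x
    using that chartD(6)[OF c, of x] by (metis DiffD1 DiffD2 imageI)
  have u: "u i x = \<phi> (point c x) * frechet_derivative (flux c a i) (at x) (axis i 1) + pd c i \<phi> (point c x) * flux c a i x"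
    if x: "x \<in> ?U" for i x
  proof -
    have d\<phi>: "((\<lambda>x. \<phi> (point c x)) has_derivative frechet_derivative (\<lambda>x. \<phi> (point c x)) (at x)) (at x)"
      by (rule C_on_differentiable[OF smooth_funD[OF \<phi> c, of "Suc 0"] x])
    have "(F i has_derivative (\<lambda>v. \<phi> (point c x) * frechet_derivative (flux c a i) (at x) v +
        frechet_derivative (\<lambda>x. \<phi> (point c x)) (at x) v * flux c a i x)) (at x)"
      unfolding F_def[abs_def] by (rule has_derivative_mult[OF d\<phi> C_on_differentiable[OF C_on_flux[OF a c, of "Suc 0"] x]])
    then show ?thesis
      unfolding u_def by (simp add: frechet_derivative_at[symmetric] pd_def comp_def chartD(6)[OF c x])
  qed
  have u0: "u i x = 0" if "x \<in> ?U - coord c ` ?K" for i x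
  proof -
    have p: "point c x \<notin> ?K" and x: "x \<in> ?U" using off[OF that] that by auto
    show ?thesis
      unfolding u[OF x] pd_off_support[OF c chartD(5)[OF c x] p] by (simp add: zero_off_support[OF p])
  qed
  have ui: "set_integrable lborel ?U (u i)" for i
    by (rule set_integrable_compact_support[OF chartD(2)[OF c] cK])
       (use CF[of "Suc 0" i] u0 in \<open>auto simp: u_def\<close>)
  have "(LINT x:?U|lborel. u i x) = 0" for i
    unfolding u_def
    by (rule set_integral_derivative_compact_support[OF chartD(2)[OF c] cK _ CF])
       (simp add: F_def zero_off_support[OF off])
  then have "0 = (\<Sum>i\<in>UNIV. LINT x:?U|lborel. u i x)" by simp
  also have "\<dots> = (LINT x:?U|lborel. \<Sum>i\<in>UNIV. u i x)"
    using ui unfolding set_lebesgue_integral_def set_integrable_def scaleR_sum_right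
    by (intro Bochner_Integration.integral_sum[symmetric]) auto
  also have "\<dots> = (LINT x:?U|lborel. \<phi> (point c x) * chart_laplacian g c a (point c x) * vol c x
      + cometric g c \<phi> a (point c x) * vol c x)"
  proof (rule set_lebesgue_integral_cong)
    show "\<forall>x. x \<in> ?U \<longrightarrow> (\<Sum>i\<in>UNIV. u i x) = \<phi> (point c x) * chart_laplacian g c a (point c x) * vol c x
      + cometric g c \<phi> a (point c x) * vol c x"
    proof (intro allI impI)
      fix x assume x: "x \<in> ?U"
      have "(\<Sum>i\<in>UNIV. u i x) = \<phi> (point c x) * (\<Sum>i\<in>UNIV. frechet_derivative (flux c a i) (at x) (axis i 1))
         + (\<Sum>i\<in>UNIV. pd c i \<phi> (point c x) * flux c a i x)"
        by (simp add: u[OF x] sum.distrib sum_distrib_left)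
      moreover have "(\<Sum>i\<in>UNIV. pd c i \<phi> (point c x) * flux c a i x) = cometric g c \<phi> a (point c x) * vol c x"
        by (simp add: flux_def cometric_eq_sum sum_distrib_left sum_distrib_right mult_ac)
      ultimately show "(\<Sum>i\<in>UNIV. u i x) = \<phi> (point c x) * chart_laplacian g c a (point c x) * vol c x
      + cometric g c \<phi> a (point c x) * vol c x"
        by (simp add: divergence_flux[OF a c x])
    qed
  qed (use chartD(2)[OF c] in auto)
  also have "\<dots> = chart_integral g c (\<lambda>p. \<phi> p * chart_laplacian g c a p) + chart_integral g c (cometric g c \<phi> a)"
    unfolding chart_integral_def
  proof (rule set_integral_add)
    have c\<phi>: "continuous_on (dom_of c) \<phi>"
      by (rule continuous_on_subset[OF smooth_fun_continuous[OF \<phi>] subset_UNIV])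
    show "set_integrable lborel ?U (\<lambda>x. \<phi> (point c x) * chart_laplacian g c a (point c x) * vol c x)"
      by (rule chart_integrand(3)[OF c continuous_on_mult[OF c\<phi> continuous_on_chart_laplacian[OF a c]] closed_closure K])
        (rule mult_off_support, blast)
    show "set_integrable lborel ?U (\<lambda>x. cometric g c \<phi> a (point c x) * vol c x)"
      by (rule chart_integrand(3)[OF c continuous_on_chartI[OF c C_on_imp_continuous_on[OF C_on_cometric[OF \<phi> a c]]] closed_closure K])
        (use cometric_eq_0[OF c] in blast)
  qed
  finally show ?thesis by simp
qed

text \<open>
  If the Laplacians in two charts differed at \<open>p\<close>, their difference would have a constant sign near
  \<open>p\<close>. Testing both with a bump function \<open>\<beta>\<close> supported there gives the same number, since Green's identity
  in a chart turns the integrals into those of \<open>\<langle>d\<beta>, da\<rangle>\<close>, which do not depend on the chart. So the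
  difference times \<open>\<beta>\<close>, a continuous function of constant sign, has integral zero and vanishes at \<open>p\<close>.
\<close>

lemma chart_laplacian_change:
  assumes a: "smooth_fun A a" and c: "c \<in> A" and d: "d \<in> A" and p: "p \<in> dom_of c" "p \<in> dom_of d"
  shows "chart_laplacian g c a p = chart_laplacian g d a p"
proof -
  let ?O = "dom_of c \<inter> dom_of d"
  define \<delta> where "\<delta> q = chart_laplacian g c a q - chart_laplacian g d a q" for q
  have oO: "open ?O" by (rule open_Int[OF chartD(1)[OF c] chartD(1)[OF d]])
  have cl: "continuous_on ?O (chart_laplacian g c a)" "continuous_on ?O (chart_laplacian g d a)"
    by (rule continuous_on_subset[OF continuous_on_chart_laplacian[OF a c]], simp,
        rule continuous_on_subset[OF continuous_on_chart_laplacian[OF a d]], simp)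
  then have c\<delta>: "continuous_on ?O (\<lambda>q. \<delta> q * \<delta> p)" unfolding \<delta>_def by (intro continuous_intros)
  show ?thesis
  proof (rule ccontr)
    assume "chart_laplacian g c a p \<noteq> chart_laplacian g d a p"
    then have \<delta>p: "\<delta> p * \<delta> p > 0" by (simp add: \<delta>_def flip: power2_eq_square)
    \<comment> \<open>Multiplying by \<open>\<delta> p\<close> makes the difference positive near \<open>p\<close>, whatever its sign.\<close>
    define W where "W = ?O \<inter> (\<lambda>q. \<delta> q * \<delta> p) -` {0<..}"
    have W: "open W" "p \<in> W" "W \<subseteq> ?O"
      unfolding W_def using continuous_open_preimage[OF c\<delta> oO open_greaterThan] p \<delta>p by auto
    obtain \<beta> where \<beta>: "smooth_fun A \<beta>" "\<And>q. 0 \<le> \<beta> q" "\<beta> p > 0" "closure {q. \<beta> q \<noteq> 0} \<subseteq> W"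
      using bump_function[OF W(1,2)] by auto
    let ?K = "closure {q. \<beta> q \<noteq> 0}"
    have K: "?K \<subseteq> ?O" "?K \<subseteq> dom_of c" "?K \<subseteq> dom_of d" using \<beta>(4) W(3) by auto
    have c\<beta>: "continuous_on S \<beta>" for S by (rule continuous_on_subset[OF smooth_fun_continuous[OF \<beta>(1)]]) simp
    \<comment> \<open>Off its domain a chart gives arbitrary values, so the integrand is cut off to a global function.\<close>
    define \<phi> where "\<phi> q = (if q \<in> ?O then cometric g c \<beta> a q else 0)" for q
    have \<phi>c: "cometric g c \<beta> a q = \<phi> q" if "q \<in> dom_of c" for q
      using that cometric_eq_0[OF c that, of \<beta> a] K(1) by (auto simp: \<phi>_def)
    have \<phi>d: "cometric g d \<beta> a q = \<phi> q" if "q \<in> dom_of d" for q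
      using that cometric_eq_0[OF d that, of \<beta> a] K(1) cometric_change[OF \<beta>(1) a c d] by (auto simp: \<phi>_def)
    have \<phi>0: "\<phi> q = 0" if "q \<notin> ?K" for q
      using that cometric_eq_0[OF c _ that] by (auto simp: \<phi>_def)
    have \<phi>cont: "continuous_on ?O \<phi>"
      by (rule continuous_on_eq[OF continuous_on_subset[OF continuous_on_chartI[OF c
        C_on_imp_continuous_on[OF C_on_cometric[OF \<beta>(1) a c]]]]]) (auto simp: \<phi>c)
    have Bc: "continuous_on UNIV (\<lambda>q. \<beta> q * chart_laplacian g c a q)"
      and Bd: "continuous_on UNIV (\<lambda>q. \<beta> q * chart_laplacian g d a q)"
      by (rule continuous_on_zero_off[OF oO closed_closure K(1) continuous_on_mult[OF c\<beta> cl(1)]],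
          rule mult_off_support, assumption,
          rule continuous_on_zero_off[OF oO closed_closure K(1) continuous_on_mult[OF c\<beta> cl(2)]],
          rule mult_off_support, assumption)
    have "chart_integral g c (\<lambda>q. \<beta> q * chart_laplacian g c a q) = - chart_integral g c \<phi>"
      using chart_Green[OF \<beta>(1) a c K(2)] chart_integral_cong[OF c \<phi>c] by simp
    also have "chart_integral g c \<phi> = chart_integral g d \<phi>"
      by (rule chart_integral_change[OF c d closed_closure K(1) \<phi>cont \<phi>0])
    also have "- chart_integral g d \<phi> = chart_integral g d (\<lambda>q. \<beta> q * chart_laplacian g d a q)"
      using chart_Green[OF \<beta>(1) a d K(3)] chart_integral_cong[OF d \<phi>d] by simp
    also have "\<dots> = chart_integral g c (\<lambda>q. \<beta> q * chart_laplacian g d a q)"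
      by (rule chart_integral_change[OF c d closed_closure K(1), symmetric])
         (rule continuous_on_subset[OF Bd subset_UNIV], rule mult_off_support)
    finally have eq: "chart_integral g c (\<lambda>q. \<beta> q * chart_laplacian g c a q) = chart_integral g c (\<lambda>q. \<beta> q * chart_laplacian g d a q)" .
    define \<psi> where "\<psi> q = \<beta> q * \<delta> q * \<delta> p" for q
    have \<psi>0: "\<psi> q = 0" if "q \<notin> ?K" for q unfolding \<psi>_def mult.assoc by (rule mult_off_support[OF that])
    have \<psi>nn: "\<psi> q \<ge> 0" for q
    proof (cases "q \<in> ?K")
      case True
      then have "\<delta> q * \<delta> p > 0" using \<beta>(4) by (auto simp: W_def)
      then show ?thesis using \<beta>(2)[of q] by (simp add: \<psi>_def mult.assoc)
    qed (simp add: \<psi>0)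
    have "continuous_on UNIV (\<lambda>q. (\<beta> q * chart_laplacian g c a q - \<beta> q * chart_laplacian g d a q) * \<delta> p)"
      by (intro continuous_on_mult continuous_on_diff Bc Bd continuous_on_const)
    then have \<psi>cont: "continuous_on UNIV \<psi>" by (simp add: \<psi>_def[abs_def] \<delta>_def algebra_simps)
    note int = chart_integrand[OF c continuous_on_subset[OF _ subset_UNIV] closed_closure K(2)]
    have z: "\<beta> q * r q = 0" if "q \<in> dom_of c - ?K" for q and r :: "'m \<Rightarrow> real"
      by (rule mult_off_support) (use that in simp)
    have D: "(LINT x:img_of c|lborel. \<beta> (point c x) * chart_laplacian g c a (point c x) * vol c x
          - \<beta> (point c x) * chart_laplacian g d a (point c x) * vol c x) =
        (LINT x:img_of c|lborel. \<beta> (point c x) * chart_laplacian g c a (point c x) * vol c x) -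
        (LINT x:img_of c|lborel. \<beta> (point c x) * chart_laplacian g d a (point c x) * vol c x)"
      by (intro set_integral_diff(2) int(3)[OF Bc] int(3)[OF Bd] z)
    have "chart_integral g c \<psi> = 0"
    proof -
      have "chart_integral g c \<psi> = (LINT x:img_of c|lborel. \<delta> p * (\<beta> (point c x) * chart_laplacian g c a (point c x) * vol c x
          - \<beta> (point c x) * chart_laplacian g d a (point c x) * vol c x))"
        by (simp add: chart_integral_def \<psi>_def \<delta>_def algebra_simps)
      also have "\<dots> = \<delta> p * (chart_integral g c (\<lambda>q. \<beta> q * chart_laplacian g c a q) - chart_integral g c (\<lambda>q. \<beta> q * chart_laplacian g d a q))"
        unfolding chart_integral_def
        by (simp only: set_integral_mult_right D)
      finally show ?thesis by (simp add: eq)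
    qed
    define \<Psi> where "\<Psi> x = indicator (img_of c) x *\<^sub>R (\<psi> (point c x) * vol c x)" for x
    have "\<Psi> (coord c p) = 0"
    proof (rule continuous_integral_eq_0D[where F=\<Psi>])
      have z': "\<psi> q = 0" if "q \<in> dom_of c - ?K" for q using \<psi>0 that by blast
      show "continuous_on UNIV \<Psi>"
        unfolding \<Psi>_def
        by (rule continuous_on_extend_by_zero[OF chartD(2)[OF c] int(4)[OF \<psi>cont z'] int(5)[OF \<psi>cont z']
            int(1)[OF \<psi>cont z'] int(2)[OF \<psi>cont z']])
      show "integrable lborel \<Psi>"
        using int(3)[OF \<psi>cont z'] unfolding \<Psi>_def set_integrable_def .
      show "0 \<le> \<Psi> x" for x
        using metric_det_pos[OF c chartD(5)[OF c, of x]]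
        by (auto simp: \<Psi>_def indicator_def intro!: mult_nonneg_nonneg \<psi>nn)
      show "(\<integral>x. \<Psi> x \<partial>lborel) = 0"
        using \<open>chart_integral g c \<psi> = 0\<close> by (simp add: chart_integral_def set_lebesgue_integral_def \<Psi>_def)
    qed
    then show False
      using \<beta>(3) \<delta>p metric_det_pos[OF c p(1)] by (simp add: \<psi>_def \<Psi>_def chartD(3,4)[OF c p(1)])
  qed
qed

lemma laplacian_eq_chart:
  assumes "smooth_fun A a" "c \<in> A" "p \<in> dom_of c"
  shows "laplacian A g a p = chart_laplacian g c a p"
  using chart_laplacian_change[OF assms(1) chart_at(1) assms(2) chart_at(2) assms(3)]
  by (simp add: laplacian_def tr_g_def chart_laplacian_def Let_def)

abbreviation grad_inner :: "('m \<Rightarrow> real) \<Rightarrow> ('m \<Rightarrow> real) \<Rightarrow> 'm \<Rightarrow> real" where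
  "grad_inner a b p \<equiv> cometric g (chart_at A p) a b p"

lemma grad_inner_eq:
  assumes "smooth_fun A a" "smooth_fun A b" "c \<in> A" "p \<in> dom_of c"
  shows "grad_inner a b p = cometric g c a b p"
  by (rule cometric_change[OF assms(1,2) chart_at(1) assms(3) chart_at(2) assms(4)])

lemma continuous_on_grad_inner:
  assumes "smooth_fun A a" "smooth_fun A b" "c \<in> A"
  shows "continuous_on (dom_of c) (grad_inner a b)"
  by (rule continuous_on_eq[OF continuous_on_chartI[OF assms(3) C_on_imp_continuous_on[OF C_on_cometric[OF assms]]]])
     (simp add: grad_inner_eq[OF assms])

text \<open>
  Green's identity in the chart \<open>c k\<close>, applied to \<open>\<rho> k * b\<close>, yields the expected integral of
  \<open>\<rho> k \<langle>db, da\<rangle>\<close> and an error \<open>b \<langle>d\<rho>\<^sub>k, da\<rangle>\<close>. The errors live in different charts; a second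
  insertion of the partition of unity moves them to common charts, where they add up to zero because
  \<open>\<Sum>\<^sub>k d\<rho>\<^sub>k = d1 = 0\<close>.
\<close>

theorem Green_identity:
  assumes a: "smooth_fun A a" and b: "smooth_fun A b"
  shows "integral_dV A g (\<lambda>p. b p * laplacian A g a p) = - integral_dV A g (grad_inner b a)"
proof -
  obtain N c \<rho> where P: "partition_of_unity A N c \<rho>"
    and I: "\<And>\<phi>. integral_dV A g \<phi> = (\<Sum>k<N. chart_integral g (c k) (\<lambda>p. \<rho> k p * \<phi> p))"
    using integral_dV_partition by blast
  let ?K = "\<lambda>k. closure {p. \<rho> k p \<noteq> 0}"
  have c: "c k \<in> A" and \<rho>: "smooth_fun A (\<rho> k)" and K: "?K k \<subseteq> dom_of (c k)" if "k < N" for k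
    using P that by (auto simp: partition_of_unity_def)
  have one: "(\<Sum>k<N. \<rho> k p) = 1" for p using P by (simp add: partition_of_unity_def)
  define \<psi> where "\<psi> k p = b p * grad_inner (\<rho> k) a p" for k p
  have \<psi>0: "\<psi> k p = 0" if "p \<notin> ?K k" for k p
    using cometric_eq_0[OF chart_at that] by (simp add: \<psi>_def)
  have bc: "continuous_on S b" for S
    by (rule continuous_on_subset[OF smooth_fun_continuous[OF b]]) simp
  have \<psi>c: "continuous_on (dom_of d) (\<psi> k)" if "k < N" "d \<in> A" for k d
    unfolding \<psi>_def
    by (rule continuous_on_mult[OF bc continuous_on_grad_inner[OF \<rho>[OF that(1)] a that(2)]])
  have \<rho>c: "continuous_on S (\<rho> k)" if "k < N" for k S
    by (rule continuous_on_subset[OF smooth_fun_continuous[OF \<rho>[OF that]]]) simp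
  have \<psi>sum: "(\<Sum>k<N. \<psi> k p) = 0" for p
  proof -
    let ?c = "chart_at A p"
    have "(\<Sum>k<N. pd ?c i (\<rho> k) p) = 0" for i
    proof -
      have "(\<Sum>k<N. pd ?c i (\<rho> k) p) = pd ?c i (\<lambda>p. \<Sum>k<N. \<rho> k p) p"
        using \<rho> by (intro pd_sum[symmetric] chart_at) auto
      then show ?thesis by (simp add: one pd_const)
    qed
    then have "(\<Sum>k<N. differential (\<rho> k) ?c p) = 0"
      by (simp add: vec_eq_iff differential_def)
    then show ?thesis
      unfolding \<psi>_def cometric_def sum_distrib_left[symmetric] inner_sum_left[symmetric] by simp
  qed
  have 1: "chart_integral g (c k) (\<lambda>p. \<rho> k p * (b p * laplacian A g a p)) =
      - (chart_integral g (c k) (\<lambda>p. \<rho> k p * grad_inner b a p) + chart_integral g (c k) (\<psi> k))" if k: "k < N" for k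
  proof -
    note ck = c[OF k]
    have \<rho>b: "smooth_fun A (\<lambda>p. \<rho> k p * b p)" by (rule smooth_fun_mult[OF \<rho>[OF k] b])
    have "closure {p. \<rho> k p * b p \<noteq> 0} \<subseteq> ?K k" by (rule closure_mono) auto
    then have sub: "closure {p. \<rho> k p * b p \<noteq> 0} \<subseteq> dom_of (c k)" using K[OF k] by auto
    have "chart_integral g (c k) (\<lambda>p. \<rho> k p * (b p * laplacian A g a p)) =
        chart_integral g (c k) (\<lambda>p. \<rho> k p * b p * chart_laplacian g (c k) a p)"
      by (rule chart_integral_cong[OF ck]) (simp add: laplacian_eq_chart[OF a ck])
    also have "\<dots> = - chart_integral g (c k) (cometric g (c k) (\<lambda>p. \<rho> k p * b p) a)"
      by (rule chart_Green[OF \<rho>b a ck sub])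
    also have "chart_integral g (c k) (cometric g (c k) (\<lambda>p. \<rho> k p * b p) a) =
        chart_integral g (c k) (\<lambda>p. \<rho> k p * grad_inner b a p + \<psi> k p)"
    proof (rule chart_integral_cong[OF ck])
      fix p assume p: "p \<in> dom_of (c k)"
      have "differential (\<lambda>p. \<rho> k p * b p) (c k) p = \<rho> k p *\<^sub>R differential b (c k) p + b p *\<^sub>R differential (\<rho> k) (c k) p"
        by (simp add: vec_eq_iff differential_def pd_mult[OF \<rho>[OF k] b ck p])
      then show "cometric g (c k) (\<lambda>p. \<rho> k p * b p) a p = \<rho> k p * grad_inner b a p + \<psi> k p"
        unfolding \<psi>_def grad_inner_eq[OF b a ck p] grad_inner_eq[OF \<rho>[OF k] a ck p]
        by (simp add: cometric_def inner_add_left)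
    qed
    also have "\<dots> = chart_integral g (c k) (\<lambda>p. \<rho> k p * grad_inner b a p) + chart_integral g (c k) (\<psi> k)"
      unfolding chart_integral_def distrib_right
    proof (rule set_integral_add)
      show "set_integrable lborel (img_of (c k)) (\<lambda>x. \<rho> k (point (c k) x) * grad_inner b a (point (c k) x) * vol (c k) x)"
        by (rule chart_integrand(3)[OF ck continuous_on_mult[OF \<rho>c[OF k] continuous_on_grad_inner[OF b a ck]] closed_closure K[OF k]])
           (rule mult_off_support, blast)
      show "set_integrable lborel (img_of (c k)) (\<lambda>x. \<psi> k (point (c k) x) * vol (c k) x)"
        by (rule chart_integrand(3)[OF ck \<psi>c[OF k ck] closed_closure K[OF k]]) (simp add: \<psi>0)
    qed
    finally show ?thesis .
  qed
  have 2: "(\<Sum>k<N. chart_integral g (c k) (\<psi> k)) = 0"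
  proof -
    have "chart_integral g (c k) (\<psi> k) = (\<Sum>l<N. chart_integral g (c l) (\<lambda>p. \<rho> l p * \<psi> k p))" if k: "k < N" for k
    proof -
      have "chart_integral g (c k) (\<psi> k) = chart_integral g (c k) (\<lambda>p. \<Sum>l<N. \<rho> l p * \<psi> k p)"
        by (simp add: sum_distrib_right[symmetric] one)
      also have "\<dots> = (\<Sum>l<N. chart_integral g (c k) (\<lambda>p. \<rho> l p * \<psi> k p))"
      proof (rule chart_integral_sum[OF _ c[OF k] closed_closure K[OF k]])
        show "continuous_on (dom_of (c k)) (\<lambda>p. \<rho> l p * \<psi> k p)" if "l \<in> {..<N}" for l
          by (intro continuous_on_mult \<rho>c \<psi>c[OF k c[OF k]]) (use that in simp)
      qed (simp_all add: \<psi>0)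
      also have "\<dots> = (\<Sum>l<N. chart_integral g (c l) (\<lambda>p. \<rho> l p * \<psi> k p))"
      proof (rule sum.cong[OF refl])
        fix l assume "l \<in> {..<N}" then have l: "l < N" by simp
        show "chart_integral g (c k) (\<lambda>p. \<rho> l p * \<psi> k p) = chart_integral g (c l) (\<lambda>p. \<rho> l p * \<psi> k p)"
        proof (rule chart_integral_change[OF c[OF k] c[OF l]])
          show "closed (?K k \<inter> ?K l)" by auto
          show "?K k \<inter> ?K l \<subseteq> dom_of (c k) \<inter> dom_of (c l)" using K[OF k] K[OF l] by auto
          show "continuous_on (dom_of (c k) \<inter> dom_of (c l)) (\<lambda>p. \<rho> l p * \<psi> k p)"
            by (intro continuous_on_mult \<rho>c l continuous_on_subset[OF \<psi>c[OF k c[OF k]]]) auto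
          show "\<rho> l p * \<psi> k p = 0" if "p \<notin> ?K k \<inter> ?K l" for p
            using that \<psi>0[of p k] zero_off_support[of p "\<rho> l"] by auto
        qed
      qed
      finally show ?thesis .
    qed
    then have "(\<Sum>k<N. chart_integral g (c k) (\<psi> k)) = (\<Sum>k<N. \<Sum>l<N. chart_integral g (c l) (\<lambda>p. \<rho> l p * \<psi> k p))" by simp
    also have "\<dots> = (\<Sum>l<N. \<Sum>k<N. chart_integral g (c l) (\<lambda>p. \<rho> l p * \<psi> k p))" by (rule sum.swap)
    also have "\<dots> = (\<Sum>l<N. chart_integral g (c l) (\<lambda>p. \<Sum>k<N. \<rho> l p * \<psi> k p))"
    proof (rule sum.cong[OF refl])
      fix l assume "l \<in> {..<N}" then have l: "l < N" by simp
      show "(\<Sum>k<N. chart_integral g (c l) (\<lambda>p. \<rho> l p * \<psi> k p)) =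
          chart_integral g (c l) (\<lambda>p. \<Sum>k<N. \<rho> l p * \<psi> k p)"
      proof (rule chart_integral_sum[OF _ c[OF l] closed_closure K[OF l], symmetric])
        show "continuous_on (dom_of (c l)) (\<lambda>p. \<rho> l p * \<psi> k p)" if "k \<in> {..<N}" for k
          by (intro continuous_on_mult \<rho>c[OF l] \<psi>c c[OF l]) (use that in simp)
      qed (simp, rule mult_off_support, blast)
    qed
    also have "\<dots> = 0"
      by (simp add: sum_distrib_left[symmetric] \<psi>sum chart_integral_def)
    finally show ?thesis .
  qed
  have "(\<Sum>k<N. chart_integral g (c k) (\<lambda>p. \<rho> k p * (b p * laplacian A g a p))) =
    - ((\<Sum>k<N. chart_integral g (c k) (\<lambda>p. \<rho> k p * grad_inner b a p)) + (\<Sum>k<N. chart_integral g (c k) (\<psi> k)))"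
    using 1 by (simp add: sum_negf[symmetric] sum.distrib[symmetric])
  then show ?thesis unfolding I 2 by simp
qed

end

section \<open>Limits in time of integrals over a chart\<close>

lemma continuous_on_locally:
  fixes f :: "'a::metric_space \<Rightarrow> 'b::topological_space"
  assumes "\<And>z. z \<in> S \<Longrightarrow> \<exists>N. open N \<and> z \<in> N \<and> continuous_on (S \<inter> N) f"
  shows "continuous_on S f"
  unfolding continuous_on_eq_continuous_within
proof
  fix z assume z: "z \<in> S"
  then obtain N where N: "open N" "z \<in> N" "continuous_on (S \<inter> N) f" using assms by blast
  have "at z within (S \<inter> N) = at z within S"
    by (rule at_within_nhd[of z N]) (use N in auto)
  then show "continuous (at z within S) f"
    using N z unfolding continuous_on_eq_continuous_within by (metis IntI)
qed

lemma smooth_on_imp_continuous_on: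
  assumes "smooth_on S f" shows "continuous_on S f"
proof (rule continuous_on_locally)
  fix z assume "z \<in> S"
  then obtain N F where N: "open N" "z \<in> N" "\<forall>k. C_on k N F" "\<forall>y\<in>S \<inter> N. F y = f y"
    using assms unfolding smooth_on_def by blast
  have "continuous_on N F" using C_on_imp_continuous_on N(3) by blast
  then have "continuous_on (S \<inter> N) F" by (rule continuous_on_subset) simp
  then have "continuous_on (S \<inter> N) f" by (rule continuous_on_eq) (use N(4) in simp)
  then show "\<exists>N. open N \<and> z \<in> N \<and> continuous_on (S \<inter> N) f" using N by blast
qed

text \<open>
  A local smooth extension in time and space has the same spatial derivatives as \<open>H\<close> at the
  times in \<open>J\<close>, because the chart is open. So these are jointly continuous even at an end point of \<open>J\<close>.
\<close>

lemma continuous_on_partial_derivative: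
  fixes H :: "real \<times> 'a::euclidean_space \<Rightarrow> real"
  assumes H: "smooth_on (J \<times> U) H" and U: "open U"
  shows "continuous_on (J \<times> U) (\<lambda>z. frechet_derivative (\<lambda>y. H (fst z, y)) (at (snd z)) v)"
proof (rule continuous_on_locally)
  fix z assume z: "z \<in> J \<times> U"
  then obtain N F where N: "open N" "z \<in> N" "\<forall>k. C_on k N F" "\<forall>y\<in>J \<times> U \<inter> N. F y = H y"
    using H unfolding smooth_on_def by blast
  have C1: "C_on (Suc 0) N F" using N(3) by blast
  have "continuous_on N (\<lambda>z. frechet_derivative F (at z) (0, v))" using C1 by simp
  then have "continuous_on (J \<times> U \<inter> N) (\<lambda>z. frechet_derivative F (at z) (0, v))"
    by (rule continuous_on_subset) simp
  then have "continuous_on (J \<times> U \<inter> N) (\<lambda>z. frechet_derivative (\<lambda>y. H (fst z, y)) (at (snd z)) v)"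
  proof (rule continuous_on_eq)
    fix w assume w: "w \<in> J \<times> U \<inter> N"
    obtain s x where sx: "w = (s, x)" by (cases w)
    have x: "x \<in> U" "s \<in> J" "(s, x) \<in> N" using w sx by auto
    have "((\<lambda>y. (s, y)) has_derivative (\<lambda>h. (0, h))) (at x)"
      by (intro has_derivative_Pair has_derivative_const has_derivative_ident)
    from has_derivative_compose[OF this C_on_differentiable[OF C1 x(3)]]
    have "((\<lambda>y. F (s, y)) has_derivative (\<lambda>h. frechet_derivative F (at (s, x)) (0, h))) (at x)" .
    moreover have "open (U \<inter> (\<lambda>y. (s, y)) -` N)"
      by (intro open_Int U open_vimage N(1) continuous_intros)
    ultimately have "((\<lambda>y. H (s, y)) has_derivative (\<lambda>h. frechet_derivative F (at (s, x)) (0, h))) (at x)"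
      by (rule has_derivative_transform_within_open) (use x N(4) in auto)
    from frechet_derivative_at[OF this]
    show "frechet_derivative F (at w) (0, v) = frechet_derivative (\<lambda>y. H (fst w, y)) (at (snd w)) v"
      by (simp add: sx fun_eq_iff)
  qed
  then show "\<exists>N. open N \<and> z \<in> N \<and>
     continuous_on (J \<times> U \<inter> N) (\<lambda>z. frechet_derivative (\<lambda>y. H (fst z, y)) (at (snd z)) v)"
    using N by blast
qed

text \<open>
  The time derivative of a local smooth extension is bounded on a compact product of two balls. The
  mean value estimate is applied to the extension along the first ball, which is convex, whereas \<open>J\<close> is an
  arbitrary set of times.
\<close>

lemma smooth_on_Lipschitz_in_time_locally:
  fixes H :: "real \<times> 'a::euclidean_space \<Rightarrow> real"
  assumes H: "smooth_on (J \<times> U) H" and "t \<in> J" "x \<in> U"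
  shows "\<exists>r>0. \<exists>L\<ge>0. \<forall>s\<in>J. \<forall>y\<in>U. \<bar>s - t\<bar> < r \<longrightarrow> y \<in> ball x r \<longrightarrow> \<bar>H (s, y) - H (t, y)\<bar> \<le> L * \<bar>s - t\<bar>"
proof -
  obtain N F where N: "open N" "(t, x) \<in> N" "\<forall>k. C_on k N F" "\<forall>y\<in>J \<times> U \<inter> N. F y = H y"
    using H assms(2,3) unfolding smooth_on_def by (metis mem_Sigma_iff)
  have C1: "C_on (Suc 0) N F" using N(3) by blast
  obtain A B where AB: "open A" "open B" "(t, x) \<in> A \<times> B" "A \<times> B \<subseteq> N"
    using open_prod_elim[OF N(1,2)] by blast
  obtain r1 where r1: "r1 > 0" "cball t r1 \<subseteq> A" using AB open_contains_cball by (metis mem_Sigma_iff)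
  obtain r2 where r2: "r2 > 0" "cball x r2 \<subseteq> B" using AB open_contains_cball by (metis mem_Sigma_iff)
  define r where "r = min r1 r2"
  have r: "r > 0" using r1 r2 by (simp add: r_def)
  have "cball t r \<subseteq> cball t r1" "cball x r \<subseteq> cball x r2" by (auto simp: r_def)
  then have "cball t r \<times> cball x r \<subseteq> A \<times> B" using r1 r2 by (intro Sigma_mono) auto
  then have sub: "cball t r \<times> cball x r \<subseteq> N" using AB(4) by (rule order_trans)
  have "continuous_on N (\<lambda>z. frechet_derivative F (at z) (1, 0))" using C1 by simp
  then have "continuous_on (cball t r \<times> cball x r) (\<lambda>z. frechet_derivative F (at z) (1, 0))"
    using sub by (rule continuous_on_subset)
  then have "bounded ((\<lambda>z. frechet_derivative F (at z) (1, 0)) ` (cball t r \<times> cball x r))"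
    by (intro compact_imp_bounded compact_continuous_image compact_Times compact_cball)
  then obtain L where L: "L > 0" "\<And>z. z \<in> cball t r \<times> cball x r \<Longrightarrow> \<bar>frechet_derivative F (at z) (1, 0)\<bar> \<le> L"
    by (force simp: bounded_pos)
  have "\<bar>H (s, y) - H (t, y)\<bar> \<le> L * \<bar>s - t\<bar>" if s: "s \<in> J" "y \<in> U" "\<bar>s - t\<bar> < r" "y \<in> ball x r" for s y
  proof -
    have st: "s \<in> cball t r" "t \<in> cball t r" using s r by (auto simp: dist_real_def abs_minus_commute)
    have y: "y \<in> cball x r" using s by auto
    have "norm (F (s, y) - F (t, y)) \<le> L * norm (s - t)"
    proof (rule field_differentiable_bound[of "cball t r" "\<lambda>s. F (s, y)" "\<lambda>s. frechet_derivative F (at (s, y)) (1, 0)"])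
      show "convex (cball t r)" by simp
      fix \<sigma> assume \<sigma>: "\<sigma> \<in> cball t r"
      then have m: "(\<sigma>, y) \<in> cball t r \<times> cball x r" using y by simp
      show "norm (frechet_derivative F (at (\<sigma>, y)) (1, 0)) \<le> L" using L(2)[OF m] by simp
      have d: "(F has_derivative frechet_derivative F (at (\<sigma>, y))) (at (\<sigma>, y))"
        by (rule C_on_differentiable[OF C1]) (use m sub in blast)
      have "((\<lambda>s. (s, y)) has_derivative (\<lambda>h. (h, 0))) (at \<sigma>)"
        by (intro has_derivative_Pair has_derivative_const has_derivative_ident)
      from has_derivative_compose[OF this d]
      have "((\<lambda>s. F (s, y)) has_derivative (\<lambda>h. frechet_derivative F (at (\<sigma>, y)) (h, 0))) (at \<sigma>)" .
      moreover have "(\<lambda>h. frechet_derivative F (at (\<sigma>, y)) (h, 0)) = (*) (frechet_derivative F (at (\<sigma>, y)) (1, 0))"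
      proof
        fix h
        show "frechet_derivative F (at (\<sigma>, y)) (h, 0) = frechet_derivative F (at (\<sigma>, y)) (1, 0) * h"
          using linear_cmul[OF has_derivative_linear[OF d], of h "(1, 0)"] by simp
      qed
      ultimately have "((\<lambda>s. F (s, y)) has_field_derivative frechet_derivative F (at (\<sigma>, y)) (1, 0)) (at \<sigma>)"
        by (simp only: has_field_derivative_def)
      then show "((\<lambda>s. F (s, y)) has_field_derivative frechet_derivative F (at (\<sigma>, y)) (1, 0)) (at \<sigma> within cball t r)"
        by (rule has_field_derivative_at_within)
    qed (use st in auto)
    moreover have "(s, y) \<in> N" "(t, y) \<in> N" using st y sub by auto
    then have "F (s, y) = H (s, y)" "F (t, y) = H (t, y)" using N(4) s assms(2) by auto
    ultimately show ?thesis by simp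
  qed
  then show ?thesis using r L(1) by (intro exI[of _ r] exI[of _ L] conjI ballI impI) auto
qed

lemma smooth_on_Lipschitz_in_time:
  fixes H :: "real \<times> 'a::euclidean_space \<Rightarrow> real"
  assumes H: "smooth_on (J \<times> U) H" and t: "t \<in> J" and K: "compact K" "K \<subseteq> U"
  shows "\<exists>r>0. \<exists>L\<ge>0. \<forall>s\<in>J. \<forall>y\<in>K. \<bar>s - t\<bar> < r \<longrightarrow> \<bar>H (s, y) - H (t, y)\<bar> \<le> L * \<bar>s - t\<bar>"
proof -
  have "\<forall>x\<in>K. \<exists>r L. r > 0 \<and> L \<ge> 0 \<and> (\<forall>s\<in>J. \<forall>y\<in>U. \<bar>s - t\<bar> < r \<longrightarrow> y \<in> ball x r \<longrightarrow> \<bar>H (s, y) - H (t, y)\<bar> \<le> L * \<bar>s - t\<bar>)"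
    using smooth_on_Lipschitz_in_time_locally[OF H t] K(2) by blast
  from bchoice[OF this] obtain r where "\<forall>x\<in>K. \<exists>L. r x > 0 \<and> L \<ge> 0 \<and> (\<forall>s\<in>J. \<forall>y\<in>U. \<bar>s - t\<bar> < r x \<longrightarrow> y \<in> ball x (r x) \<longrightarrow> \<bar>H (s, y) - H (t, y)\<bar> \<le> L * \<bar>s - t\<bar>)" ..
  from bchoice[OF this] obtain L where rL: "\<forall>x\<in>K. r x > 0 \<and> L x \<ge> 0 \<and> (\<forall>s\<in>J. \<forall>y\<in>U. \<bar>s - t\<bar> < r x \<longrightarrow> y \<in> ball x (r x) \<longrightarrow> \<bar>H (s, y) - H (t, y)\<bar> \<le> L x * \<bar>s - t\<bar>)" ..
  have "K \<subseteq> (\<Union>x\<in>K. ball x (r x))" using rL by force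
  then have "\<exists>D. D \<subseteq> K \<and> finite D \<and> K \<subseteq> (\<Union>x\<in>D. ball x (r x))"
    by (rule compactE_image[OF K(1) open_ball]) (intro exI conjI)
  then obtain D where D: "D \<subseteq> K" "finite D" "K \<subseteq> (\<Union>x\<in>D. ball x (r x))" by blast
  \<comment> \<open>The 1 is there in case \<open>K\<close>, and with it the subcover, is empty.\<close>
  define \<epsilon> where "\<epsilon> = Min (insert 1 (r ` D))"
  have \<epsilon>: "\<epsilon> > 0" "\<And>x. x \<in> D \<Longrightarrow> \<epsilon> \<le> r x" unfolding \<epsilon>_def using D rL by (auto simp: subset_iff)
  define M where "M = (\<Sum>x\<in>D. L x)"
  have M: "M \<ge> 0" "\<And>x. x \<in> D \<Longrightarrow> L x \<le> M"
    unfolding M_def using D rL by (auto intro!: sum_nonneg member_le_sum)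
  have "\<bar>H (s, y) - H (t, y)\<bar> \<le> M * \<bar>s - t\<bar>" if s: "s \<in> J" "y \<in> K" "\<bar>s - t\<bar> < \<epsilon>" for s y
  proof -
    obtain x where x: "x \<in> D" "y \<in> ball x (r x)" using D(3) s(2) by blast
    have "\<bar>s - t\<bar> < r x" using \<epsilon>(2)[OF x(1)] s(3) by linarith
    moreover have "x \<in> K" "y \<in> U" using x D(1) s(2) K(2) by auto
    ultimately have "\<bar>H (s, y) - H (t, y)\<bar> \<le> L x * \<bar>s - t\<bar>" using rL s(1) x(2) by blast
    also have "\<dots> \<le> M * \<bar>s - t\<bar>" by (rule mult_right_mono[OF M(2)[OF x(1)]]) simp
    finally show ?thesis .
  qed
  then show ?thesis using \<epsilon>(1) M(1) by (intro exI[of _ \<epsilon>] exI[of _ M] conjI ballI impI) auto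
qed

text \<open>
  A convergent sequence of times together with its limit is compact.
\<close>

lemma bounded_along_sequence:
  fixes \<alpha> :: "real \<times> 'a::euclidean_space \<Rightarrow> real"
  assumes "continuous_on (J \<times> U) \<alpha>" "compact K" "K \<subseteq> U" "\<And>n. s n \<in> J" "s \<longlonglongrightarrow> t" "t \<in> J"
  shows "\<exists>B\<ge>0. \<forall>n. \<forall>x\<in>K. \<bar>\<alpha> (s n, x)\<bar> \<le> B"
proof -
  have "compact (insert t (range s) \<times> K)"
    by (intro compact_Times compact_sequence_with_limit assms)
  moreover have "insert t (range s) \<times> K \<subseteq> J \<times> U" using assms by auto
  ultimately have "bounded (\<alpha> ` (insert t (range s) \<times> K))"
    by (intro compact_imp_bounded compact_continuous_image continuous_on_subset[OF assms(1)])
  then obtain B where "B > 0" "\<forall>z\<in>insert t (range s) \<times> K. \<bar>\<alpha> z\<bar> \<le> B"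
    by (force simp: bounded_pos)
  then show ?thesis by (intro exI[of _ B]) auto
qed

lemma tendsto_along_sequence:
  fixes \<alpha> :: "real \<times> 'a::euclidean_space \<Rightarrow> real"
  assumes "continuous_on (J \<times> U) \<alpha>" "x \<in> U" "\<And>n. s n \<in> J" "s \<longlonglongrightarrow> t" "t \<in> J"
  shows "(\<lambda>n. \<alpha> (s n, x)) \<longlonglongrightarrow> \<alpha> (t, x)"
  by (rule continuous_on_tendsto_compose[OF assms(1)])
     (use assms in \<open>auto intro!: tendsto_Pair\<close>)

lemma dominated_convergence_compact_support:
  fixes G :: "nat \<Rightarrow> 'a::euclidean_space \<Rightarrow> real"
  assumes U: "open U" and K: "compact K" "K \<subseteq> U"
    and G: "\<And>n. continuous_on U (G n)" "\<And>n x. x \<in> U - K \<Longrightarrow> G n x = 0"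
    and B: "eventually (\<lambda>n. \<forall>x\<in>K. \<bar>G n x\<bar> \<le> B) sequentially"
    and lim: "\<And>x. x \<in> U \<Longrightarrow> (\<lambda>n. G n x) \<longlonglongrightarrow> g x"
  shows "set_integrable lborel U g" "(\<lambda>n. LINT x:U|lborel. G n x) \<longlonglongrightarrow> (LINT x:U|lborel. g x)"
proof -
  obtain n0 where n0: "\<And>n. n \<ge> n0 \<Longrightarrow> \<forall>x\<in>K. \<bar>G n x\<bar> \<le> B" using B by (auto simp: eventually_sequentially)
  \<comment> \<open>The bound holds only eventually; dropping finitely many terms does not change the limit.\<close>
  define E where "E n x = indicator U x *\<^sub>R G (n + n0) x" for n x
  have mE: "E n \<in> borel_measurable lborel" for n
    unfolding E_def
    using borel_measurable_continuous_onI[OF continuous_on_extend_by_zero[OF U K G(1) G(2)]] by simp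
  have limE: "(\<lambda>n. E n x) \<longlonglongrightarrow> indicator U x *\<^sub>R g x" for x
  proof (cases "x \<in> U")
    case True
    have "(\<lambda>n. G (n + n0) x) \<longlonglongrightarrow> g x" using LIMSEQ_ignore_initial_segment[OF lim[OF True]] .
    then show ?thesis using True by (simp add: E_def)
  qed (simp add: E_def)
  have mg: "(\<lambda>x. indicator U x *\<^sub>R g x) \<in> borel_measurable lborel"
    by (rule borel_measurable_LIMSEQ_real[OF limE mE])
  have iK: "integrable lborel (\<lambda>x::'a. \<bar>B\<bar> * indicator K x)"
    using emeasure_compact_finite[OF K(1)] K(1)
    by (intro integrable_mult_right integrable_real_indicator) (auto simp: borel_compact)
  have bound: "norm (E n x) \<le> \<bar>B\<bar> * indicator K x" for n x
  proof (cases "x \<in> K")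
    case True
    then have "\<bar>G (n + n0) x\<bar> \<le> B" using n0[of "n + n0"] by simp
    then show ?thesis using True K(2) by (auto simp: E_def indicator_def)
  next
    case False
    then show ?thesis using G(2)[of x] by (cases "x \<in> U") (auto simp: E_def)
  qed
  show "set_integrable lborel U g"
    unfolding set_integrable_def
    by (rule integrable_dominated_convergence[where s=E, OF mg mE iK]) (use limE bound in auto)
  have "(\<lambda>n. \<integral>x. E n x \<partial>lborel) \<longlonglongrightarrow> (\<integral>x. indicator U x *\<^sub>R g x \<partial>lborel)"
    by (rule integral_dominated_convergence[where s=E, OF mg mE iK]) (use limE bound in auto)
  then have "(\<lambda>n. LINT x:U|lborel. G (n + n0) x) \<longlonglongrightarrow> (LINT x:U|lborel. g x)"
    by (simp add: E_def set_lebesgue_integral_def)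
  then show "(\<lambda>n. LINT x:U|lborel. G n x) \<longlonglongrightarrow> (LINT x:U|lborel. g x)"
    by (rule LIMSEQ_offset)
qed

lemma continuous_on_slice:
  assumes "continuous_on (J \<times> U) \<alpha>" "s \<in> J"
  shows "continuous_on U (\<lambda>x. \<alpha> (s, x))"
  by (rule continuous_on_compose2[OF assms(1)]) (use assms(2) in \<open>auto intro!: continuous_intros\<close>)

lemma integral_along_sequence:
  fixes \<alpha> :: "real \<times> 'a::euclidean_space \<Rightarrow> real"
  assumes U: "open U" and K: "compact K" "K \<subseteq> U"
    and \<rho>: "continuous_on U \<rho>" "\<And>x. x \<in> U - K \<Longrightarrow> \<rho> x = 0"
    and \<alpha>: "continuous_on (J \<times> U) \<alpha>"
    and s: "\<And>n. s n \<in> J" "s \<longlonglongrightarrow> t" "t \<in> J"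
  shows "(\<lambda>n. LINT x:U|lborel. \<rho> x * \<alpha> (s n, x)) \<longlonglongrightarrow> (LINT x:U|lborel. \<rho> x * \<alpha> (t, x))"
proof -
  obtain B where B: "B \<ge> 0" "\<forall>n. \<forall>x\<in>K. \<bar>\<alpha> (s n, x)\<bar> \<le> B"
    using bounded_along_sequence[OF \<alpha> K s] by blast
  have "bounded (\<rho> ` K)"
    by (intro compact_imp_bounded compact_continuous_image continuous_on_subset[OF \<rho>(1)] K)
  then obtain C where C: "C > 0" "\<forall>x\<in>K. \<bar>\<rho> x\<bar> \<le> C" by (force simp: bounded_pos)
  show ?thesis
  proof (rule dominated_convergence_compact_support(2)[OF U K])
    show "continuous_on U (\<lambda>x. \<rho> x * \<alpha> (s n, x))" for n
      by (rule continuous_on_mult[OF \<rho>(1) continuous_on_slice[OF \<alpha> s(1)]])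
    show "eventually (\<lambda>n. \<forall>x\<in>K. \<bar>\<rho> x * \<alpha> (s n, x)\<bar> \<le> C * B) sequentially"
      using B C by (intro always_eventually allI ballI) (auto simp: abs_mult intro!: mult_mono)
    show "(\<lambda>n. \<rho> x * \<alpha> (s n, x)) \<longlonglongrightarrow> \<rho> x * \<alpha> (t, x)" if "x \<in> U" for x
      by (intro tendsto_mult tendsto_const tendsto_along_sequence[OF \<alpha> that s])
  qed (simp add: \<rho>(2))
qed

text \<open>
  The factors \<open>\<alpha>\<close> are bounded and the difference quotients of \<open>H\<close> are eventually bounded by a Lipschitz
  constant, both uniformly on \<open>K\<close>, so dominated convergence applies. The finite sum stays inside the
  integral, as in the density of the Dirichlet energy. Integrability of the limit is part of the
  conclusion because \<open>H'\<close> is a pointwise derivative, without any continuity in \<open>x\<close>.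
\<close>

lemma integral_difference_quotient:
  fixes \<alpha> H :: "'i \<Rightarrow> real \<times> 'a::euclidean_space \<Rightarrow> real"
  assumes U: "open U" and K: "compact K" "K \<subseteq> U"
    and \<rho>: "continuous_on U \<rho>" "\<And>x. x \<in> U - K \<Longrightarrow> \<rho> x = 0" and I: "finite I"
    and \<alpha>: "\<And>m. m \<in> I \<Longrightarrow> continuous_on (J \<times> U) (\<alpha> m)"
    and H: "\<And>m. m \<in> I \<Longrightarrow> smooth_on (J \<times> U) (H m)"
    and H': "\<And>m x. m \<in> I \<Longrightarrow> x \<in> U \<Longrightarrow> ((\<lambda>s. H m (s, x)) has_real_derivative H' m x) (at t within J)"
    and s: "\<And>n. s n \<in> J" "s \<longlonglongrightarrow> t" "t \<in> J" and st: "\<And>n. s n \<noteq> t"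
  shows "set_integrable lborel U (\<lambda>x. \<rho> x * (\<Sum>m\<in>I. \<alpha> m (t, x) * H' m x))"
    and "(\<lambda>n. LINT x:U|lborel. \<rho> x * (\<Sum>m\<in>I. \<alpha> m (s n, x) * ((H m (s n, x) - H m (t, x)) / (s n - t))))
      \<longlonglongrightarrow> (LINT x:U|lborel. \<rho> x * (\<Sum>m\<in>I. \<alpha> m (t, x) * H' m x))"
proof -
  let ?q = "\<lambda>m n x. (H m (s n, x) - H m (t, x)) / (s n - t)"
  have "\<forall>m\<in>I. \<exists>B. B \<ge> 0 \<and> (\<forall>n. \<forall>x\<in>K. \<bar>\<alpha> m (s n, x)\<bar> \<le> B)"
    using bounded_along_sequence[OF \<alpha> K s] by blast
  from bchoice[OF this] obtain B where B: "\<forall>m\<in>I. B m \<ge> 0 \<and> (\<forall>n. \<forall>x\<in>K. \<bar>\<alpha> m (s n, x)\<bar> \<le> B m)" ..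
  have "\<forall>m\<in>I. \<exists>L. L \<ge> 0 \<and> eventually (\<lambda>n. \<forall>x\<in>K. \<bar>?q m n x\<bar> \<le> L) sequentially"
  proof
    fix m assume m: "m \<in> I"
    obtain r L where rL: "r > 0" "L \<ge> 0" "\<forall>s\<in>J. \<forall>y\<in>K. \<bar>s - t\<bar> < r \<longrightarrow> \<bar>H m (s, y) - H m (t, y)\<bar> \<le> L * \<bar>s - t\<bar>"
      using smooth_on_Lipschitz_in_time[OF H[OF m] s(3) K] by blast
    have "eventually (\<lambda>n. \<bar>s n - t\<bar> < r) sequentially"
      using tendstoD[OF s(2) rL(1)] by (simp add: dist_real_def)
    then have "eventually (\<lambda>n. \<forall>x\<in>K. \<bar>?q m n x\<bar> \<le> L) sequentially"
    proof (rule eventually_mono, intro ballI)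
      fix n x assume "\<bar>s n - t\<bar> < r" "x \<in> K"
      then have "\<bar>H m (s n, x) - H m (t, x)\<bar> \<le> L * \<bar>s n - t\<bar>" using rL(3) s(1) by blast
      then show "\<bar>?q m n x\<bar> \<le> L" using st[of n] by (simp add: pos_divide_le_eq)
    qed
    then show "\<exists>L. L \<ge> 0 \<and> eventually (\<lambda>n. \<forall>x\<in>K. \<bar>?q m n x\<bar> \<le> L) sequentially" using rL(2) by blast
  qed
  from bchoice[OF this] obtain L where L: "\<forall>m\<in>I. L m \<ge> 0 \<and> eventually (\<lambda>n. \<forall>x\<in>K. \<bar>?q m n x\<bar> \<le> L m) sequentially" ..
  then have evL: "eventually (\<lambda>n. \<forall>m\<in>I. \<forall>x\<in>K. \<bar>?q m n x\<bar> \<le> L m) sequentially"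
    by (intro eventually_ball_finite I) blast
  have "bounded (\<rho> ` K)"
    by (intro compact_imp_bounded compact_continuous_image continuous_on_subset[OF \<rho>(1)] K)
  then obtain C where C: "C > 0" "\<forall>x\<in>K. \<bar>\<rho> x\<bar> \<le> C" by (force simp: bounded_pos)
  have cont: "continuous_on U (\<lambda>x. \<rho> x * (\<Sum>m\<in>I. \<alpha> m (s n, x) * ?q m n x))" for n
    unfolding divide_inverse
    by (intro continuous_on_mult continuous_on_sum continuous_on_diff continuous_on_const \<rho>(1)
        continuous_on_slice[OF \<alpha> s(1)] continuous_on_slice[OF smooth_on_imp_continuous_on[OF H] s(1)]
        continuous_on_slice[OF smooth_on_imp_continuous_on[OF H] s(3)])
  have ev: "eventually (\<lambda>n. \<forall>x\<in>K. \<bar>\<rho> x * (\<Sum>m\<in>I. \<alpha> m (s n, x) * ?q m n x)\<bar> \<le> C * (\<Sum>m\<in>I. B m * L m)) sequentially"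
    using evL
  proof (rule eventually_mono, intro ballI)
    fix n x assume n: "\<forall>m\<in>I. \<forall>x\<in>K. \<bar>?q m n x\<bar> \<le> L m" and x: "x \<in> K"
    have "\<bar>\<Sum>m\<in>I. \<alpha> m (s n, x) * ?q m n x\<bar> \<le> (\<Sum>m\<in>I. \<bar>\<alpha> m (s n, x)\<bar> * \<bar>?q m n x\<bar>)"
      using sum_abs[of "\<lambda>m. \<alpha> m (s n, x) * ?q m n x" I] by (simp only: abs_mult)
    also have "\<dots> \<le> (\<Sum>m\<in>I. B m * L m)"
      using B L n x by (intro sum_mono mult_mono) auto
    finally have "\<bar>\<rho> x\<bar> * \<bar>\<Sum>m\<in>I. \<alpha> m (s n, x) * ?q m n x\<bar> \<le> C * (\<Sum>m\<in>I. B m * L m)"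
      using C x by (intro mult_mono) auto
    then show "\<bar>\<rho> x * (\<Sum>m\<in>I. \<alpha> m (s n, x) * ?q m n x)\<bar> \<le> C * (\<Sum>m\<in>I. B m * L m)"
      by (simp only: abs_mult)
  qed
  have fs: "filterlim s (at t within J) sequentially"
    using s st by (auto simp: filterlim_at)
  have lim: "(\<lambda>n. \<rho> x * (\<Sum>m\<in>I. \<alpha> m (s n, x) * ?q m n x)) \<longlonglongrightarrow> \<rho> x * (\<Sum>m\<in>I. \<alpha> m (t, x) * H' m x)"
    if x: "x \<in> U" for x
  proof (intro tendsto_mult tendsto_const tendsto_sum)
    fix m assume m: "m \<in> I"
    show "(\<lambda>n. \<alpha> m (s n, x)) \<longlonglongrightarrow> \<alpha> m (t, x)" by (rule tendsto_along_sequence[OF \<alpha>[OF m] x s])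
    have "((\<lambda>\<sigma>. (H m (\<sigma>, x) - H m (t, x)) / (\<sigma> - t)) \<longlongrightarrow> H' m x) (at t within J)"
      using H'[OF m x] by (simp add: has_field_derivative_iff)
    from filterlim_compose[OF this fs] show "(\<lambda>n. ?q m n x) \<longlonglongrightarrow> H' m x" .
  qed
  have z: "\<rho> x * (\<Sum>m\<in>I. \<alpha> m (s n, x) * ?q m n x) = 0" if "x \<in> U - K" for n x
    using \<rho>(2)[OF that] by simp
  note dc = dominated_convergence_compact_support[where G="\<lambda>n x. \<rho> x * (\<Sum>m\<in>I. \<alpha> m (s n, x) * ?q m n x)",
      OF U K cont z ev lim]
  show "set_integrable lborel U (\<lambda>x. \<rho> x * (\<Sum>m\<in>I. \<alpha> m (t, x) * H' m x))" by (rule dc(1))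
  show "(\<lambda>n. LINT x:U|lborel. \<rho> x * (\<Sum>m\<in>I. \<alpha> m (s n, x) * ?q m n x))
      \<longlonglongrightarrow> (LINT x:U|lborel. \<rho> x * (\<Sum>m\<in>I. \<alpha> m (t, x) * H' m x))" by (rule dc(2))
qed

section \<open>Variation of the eigenvalue\<close>

lemma set_integral_difference_quotient:
  fixes a b :: "'a::euclidean_space \<Rightarrow> real"
  assumes "set_integrable lborel U a" "set_integrable lborel U b"
  shows "((LINT x:U|lborel. a x) - (LINT x:U|lborel. b x)) / h = (LINT x:U|lborel. (a x - b x) / h)"
  by (simp add: set_integral_diff(2)[OF assms, symmetric])

lemma quadratic_form_inverse:
  fixes N S :: "real^'n^'n"
  assumes "\<And>i j. N $ i $ j = N $ j $ i"
  shows "(N *v a) \<bullet> (S *v (N *v a)) = (\<Sum>i\<in>UNIV. \<Sum>j\<in>UNIV. (N ** S ** N) $ i $ j * (a $ i * a $ j))"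
proof -
  have "transpose N = N" using assms by (simp add: transpose_def vec_eq_iff)
  then have "(N *v a) \<bullet> (S *v (N *v a)) = a \<bullet> (N *v (S *v (N *v a)))"
    using inner_transpose[of N a] by simp
  then show ?thesis
    unfolding sum_mult_matrix_vector by (simp add: matrix_vector_mul_assoc matrix_mul_assoc)
qed

lemma (in riemannian) cometric_commute:
  assumes "c \<in> A" "p \<in> dom_of c"
  shows "cometric g c a b p = cometric g c b a p"
proof -
  have "transpose (ginv g c p) = ginv g c p"
    using ginv_symmetric[OF assms] by (simp add: transpose_def vec_eq_iff)
  then show ?thesis
    unfolding cometric_def using inner_transpose[of "ginv g c p"] by (metis inner_commute)
qed

lemma (in compact_mfd) integral_dV_mult: "integral_dV A g (\<lambda>p. k * \<phi> p) = k * integral_dV A g \<phi>"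
proof -
  obtain N c \<rho> where "partition_of_unity A N c \<rho>"
    and I: "\<And>g \<phi>. integral_dV A g \<phi> = (\<Sum>k<N. chart_integral g (c k) (\<lambda>p. \<rho> k p * \<phi> p))"
    using integral_dV_partition by blast
  have "chart_integral g c (\<lambda>p. \<rho> p * (k * \<phi> p)) = k * chart_integral g c (\<lambda>p. \<rho> p * \<phi> p)" for c \<rho>
  proof -
    have "chart_integral g c (\<lambda>p. \<rho> p * (k * \<phi> p)) =
       (LINT x:img_of c|lborel. k * (\<rho> (point c x) * \<phi> (point c x) * sqrt (det (g c (point c x)))))"
      by (simp add: chart_integral_def mult_ac)
    then show ?thesis by (simp add: chart_integral_def)
  qed
  then show ?thesis by (simp add: I sum_distrib_left)
qed

locale eigenvalue_flow = compact_mfd A for A :: "('m::t2_space, 'n::finite) chart set" +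
  fixes J :: "real set" and g :: "real \<Rightarrow> ('m, 'n) tensor2" and u f :: "real \<Rightarrow> 'm \<Rightarrow> real"
    and lam :: "real \<Rightarrow> real"
  assumes interval: "is_interval J" and nontrivial: "\<exists>a\<in>J. \<exists>b\<in>J. a < b"
    and flow: "harmonic_ricci_flow A J g u"
    and lam: "smooth_on J lam" and f_family: "smooth_fun_family A J f"
    and eigen: "\<forall>t\<in>J. eigenfunction A (g t) (lam t) (f t)"
begin

abbreviation S :: "real \<Rightarrow> ('m, 'n) tensor2" where "S t \<equiv> S_tensor (g t) (u t)"
abbreviation R :: "real \<Rightarrow> 'm \<Rightarrow> real" where "R t \<equiv> S_scalar A (g t) (u t)"
abbreviation Q :: "real \<Rightarrow> 'm \<Rightarrow> real" where
  "Q t \<equiv> tensor_inner A (g t) (S t) (outer (differential (f t)) (differential (f t)))"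
abbreviation vol_at :: "real \<Rightarrow> ('m, 'n) chart \<Rightarrow> real^'n \<Rightarrow> real" where
  "vol_at t c x \<equiv> sqrt (det (g t c (point c x)))"

lemma riem: "t \<in> J \<Longrightarrow> riemannian A (g t)"
  using flow by (intro riemannian.intro compact_mfd_axioms riemannian_axioms.intro)
    (simp add: harmonic_ricci_flow_def smooth_metric_family_def)

lemma f_smooth: "t \<in> J \<Longrightarrow> smooth_fun A (f t)"
  using eigen by (simp add: eigenfunction_def)

lemma limit_point: assumes "t \<in> J" shows "t islimpt J"
proof (rule connected_imp_perfect)
  show "connected J" using interval by (rule is_interval_connected)
  show "J \<noteq> {x}" for x using nontrivial by force
qed (rule assms)

lemma metric_entry_derivative:
  assumes "t \<in> J" "c \<in> A" "p \<in> dom_of c"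
  shows "((\<lambda>s. g s c p) has_vector_derivative (-2) *\<^sub>R S t c p) (at t within J)"
    "((\<lambda>s. g s c p $ i $ j) has_real_derivative ((-2) *\<^sub>R S t c p) $ i $ j) (at t within J)"
proof -
  have "((\<lambda>s. g s c p) has_vector_derivative
      (-2) *\<^sub>R ricci (g t) c p + 4 *\<^sub>R outer (differential (u t)) (differential (u t)) c p) (at t within J)"
    using flow assms by (simp add: harmonic_ricci_flow_def)
  moreover have "(-2) *\<^sub>R ricci (g t) c p + 4 *\<^sub>R outer (differential (u t)) (differential (u t)) c p = (-2) *\<^sub>R S t c p"
    by (simp add: S_tensor_def scaleR_diff_right)
  ultimately show 1: "((\<lambda>s. g s c p) has_vector_derivative (-2) *\<^sub>R S t c p) (at t within J)" by simp
  have "bounded_linear (\<lambda>M::real^'n^'n. M $ i $ j)"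
    by (rule bounded_linear_compose[OF bounded_linear_vec_nth bounded_linear_vec_nth])
  from bounded_linear.has_vector_derivative[OF this 1]
  show "((\<lambda>s. g s c p $ i $ j) has_real_derivative ((-2) *\<^sub>R S t c p) $ i $ j) (at t within J)"
    by (simp only: has_real_derivative_iff_has_vector_derivative)
qed

text \<open>
  The metric at every time transforms with the same Jacobian, which does not depend on time. So does its
  time derivative \<open>- 2 \<S>\<close>; this gives the tensor law for \<open>\<S>\<close>, and with it for the Ricci part, without
  computing with curvature.
\<close>

lemma S_change:
  assumes "t \<in> J" "c \<in> A" "d \<in> A" "p \<in> dom_of c" "p \<in> dom_of d"
  defines "T \<equiv> jacobian (transition c d) (at (coord c p))"
  shows "S t c p = transpose T ** S t d p ** T"
proof -
  have g: "g s c p = transpose T ** g s d p ** T" if "s \<in> J" for s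
    unfolding T_def by (rule riemannian.metric_change[OF riem[OF that] assms(2-5)])
  have bl: "bounded_linear (\<lambda>M::real^'n^'n. transpose T ** M ** T)"
    by (intro linear_conv_bounded_linear[THEN iffD1] linearI)
       (simp_all add: matrix_matrix_mult_def vec_eq_iff distrib_left distrib_right sum.distrib
          sum_distrib_left sum_distrib_right mult_ac)
  have "((\<lambda>s. transpose T ** g s d p ** T) has_vector_derivative transpose T ** ((-2) *\<^sub>R S t d p) ** T) (at t within J)"
    by (rule bounded_linear.has_vector_derivative[OF bl metric_entry_derivative(1)[OF assms(1,3,5)]])
  then have "((\<lambda>s. g s c p) has_vector_derivative transpose T ** ((-2) *\<^sub>R S t d p) ** T) (at t within J)"
    by (rule has_vector_derivative_transform[OF assms(1) g, rotated])
  then have "(-2) *\<^sub>R S t c p = transpose T ** ((-2) *\<^sub>R S t d p) ** T"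
    using metric_entry_derivative(1)[OF assms(1,2,4)] limit_point[OF assms(1)]
    by (intro vector_derivative_unique_within) (auto simp: trivial_limit_within)
  also have "\<dots> = (-2) *\<^sub>R (transpose T ** S t d p ** T)"
    using linear_cmul[OF bounded_linear.linear[OF bl]] .
  finally show ?thesis by simp
qed

lemma S_scalar_chart:
  assumes "t \<in> J" "c \<in> A" "p \<in> dom_of c"
  shows "R t p = trace (ginv (g t) c p ** S t c p)"
proof -
  interpret riemannian A "g t" by (rule riem[OF assms(1)])
  let ?d = "chart_at A p"
  have d: "?d \<in> A" "p \<in> dom_of ?d" by (rule chart_at)+
  have inv: "invertible (g t ?d p)" using metric_det_pos[OF d] by (simp add: invertible_det_nz)
  have "R t p = (\<Sum>i\<in>UNIV. \<Sum>j\<in>UNIV. ginv (g t) ?d p $ i $ j * S t ?d p $ i $ j)"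
    unfolding S_scalar_eq_trace[of "g t" A p, OF inv] tr_g_def Let_def ..
  also have "\<dots> = (\<Sum>j\<in>UNIV. \<Sum>i\<in>UNIV. ginv (g t) ?d p $ i $ j * S t ?d p $ i $ j)"
    by (rule sum.swap)
  also have "\<dots> = trace (ginv (g t) ?d p ** S t ?d p)"
    by (simp add: trace_def matrix_matrix_mult_def ginv_symmetric[OF d])
  also have "\<dots> = trace (ginv (g t) c p ** S t c p)"
    using metric_det_pos[OF d] unfolding ginv_def S_change[OF assms(1) d(1) assms(2) d(2) assms(3)]
    by (intro congruent_trace[OF metric_change[OF d(1) assms(2) d(2) assms(3)]]) simp
  finally show ?thesis .
qed

lemma tensor_inner_chart:
  assumes t: "t \<in> J" and h: "smooth_fun A h" and c: "c \<in> A" "p \<in> dom_of c"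
  shows "tensor_inner A (g t) (S t) (outer (differential h) (differential h)) p =
    (\<Sum>i\<in>UNIV. \<Sum>j\<in>UNIV. (ginv (g t) c p ** S t c p ** ginv (g t) c p) $ i $ j * (pd c i h p * pd c j h p))"
proof -
  interpret riemannian A "g t" by (rule riem[OF t])
  let ?d = "chart_at A p"
  have d: "?d \<in> A" "p \<in> dom_of ?d" by (rule chart_at)+
  let ?N = "ginv (g t) ?d p" and ?a = "differential h ?d p"
  have "(?N *v ?a) \<bullet> (S t ?d p *v (?N *v ?a)) =
    (\<Sum>i\<in>UNIV. \<Sum>j\<in>UNIV. S t ?d p $ i $ j * ((?N *v ?a) $ i * (?N *v ?a) $ j))"
    by (rule sum_mult_matrix_vector[symmetric])
  also have "\<dots> = tensor_inner A (g t) (S t) (outer (differential h) (differential h)) p"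
    unfolding tensor_inner_def Let_def
  proof (intro sum.cong refl)
    fix i j
    have eq: "(?N *v ?a) $ i * (?N *v ?a) $ j = (\<Sum>k\<in>UNIV. \<Sum>l\<in>UNIV. (?N $ i $ k * ?a $ k) * (?N $ j $ l * ?a $ l))"
      by (simp add: matrix_vector_mult_def sum_product)
    show "S t ?d p $ i $ j * ((?N *v ?a) $ i * (?N *v ?a) $ j) =
      (\<Sum>k\<in>UNIV. \<Sum>l\<in>UNIV. ?N $ i $ k * ?N $ j $ l * S t ?d p $ i $ j * outer (differential h) (differential h) ?d p $ k $ l)"
      unfolding eq sum_distrib_left by (intro sum.cong refl) (simp add: outer_def)
  qed
  finally have "tensor_inner A (g t) (S t) (outer (differential h) (differential h)) p =
     (?N *v ?a) \<bullet> (S t ?d p *v (?N *v ?a))" ..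
  also have "\<dots> = (ginv (g t) c p *v differential h c p) \<bullet> (S t c p *v (ginv (g t) c p *v differential h c p))"
    using metric_det_pos[OF d]
    unfolding ginv_def S_change[OF t d(1) c(1) d(2) c(2)] differential_change[OF h d(1) c(1) d(2) c(2)]
    by (intro congruent_quadratic[OF metric_change[OF d(1) c(1) d(2) c(2)]]) simp
  also have "\<dots> = (\<Sum>i\<in>UNIV. \<Sum>j\<in>UNIV. (ginv (g t) c p ** S t c p ** ginv (g t) c p) $ i $ j *
      (differential h c p $ i * differential h c p $ j))"
    by (rule quadratic_form_inverse[OF ginv_symmetric[OF c]])
  finally show ?thesis by (simp add: differential_def)
qed

text \<open>
  Jacobi's formula with \<open>\<partial>\<^sub>t g = - 2 \<S>\<close>: the density decays at the rate \<open>tr\<^sub>g \<S> = S\<close>.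
\<close>

lemma vol_derivative:
  assumes "t \<in> J" "c \<in> A" "x \<in> img_of c"
  shows "((\<lambda>s. vol_at s c x) has_real_derivative - R t (point c x) * vol_at t c x) (at t within J)"
proof -
  have p: "point c x \<in> dom_of c" by (rule chartD(5)[OF assms(2,3)])
  have "((\<lambda>s. vol_at s c x) has_real_derivative
     trace (matrix_inv (g t c (point c x)) ** ((-2) *\<^sub>R S t c (point c x))) / 2 * vol_at t c x) (at t within J)"
    by (rule sqrt_det_derivative[OF metric_entry_derivative(2)[OF assms(1,2) p] riemannian.metric_det_pos[OF riem[OF assms(1)] assms(2) p]])
  moreover have "trace (M ** ((-2) *\<^sub>R B)) / 2 = - trace (M ** B)" for M B :: "real^'n^'n"
    by (simp add: trace_def matrix_matrix_mult_def sum_distrib_left[symmetric] mult.left_commute[of _ "2::real"] sum_negf)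
  ultimately show ?thesis by (simp add: S_scalar_chart[OF assms(1,2) p] ginv_def)
qed

text \<open>
  The density of the Dirichlet energy, \<open>\<partial>\<^sub>t (g\<^sup>i\<^sup>j dV) = (2 \<S>\<^sup>i\<^sup>j - S g\<^sup>i\<^sup>j) dV\<close>; these are the two gradient
  terms of the variation formula.
\<close>

lemma ginv_vol_derivative:
  assumes "t \<in> J" "c \<in> A" "x \<in> img_of c"
  defines "p \<equiv> point c x"
  shows "((\<lambda>s. ginv (g s) c p $ i $ j * vol_at s c x) has_real_derivative
     (2 * (ginv (g t) c p ** S t c p ** ginv (g t) c p) $ i $ j - R t p * ginv (g t) c p $ i $ j) * vol_at t c x) (at t within J)"
proof -
  have p: "p \<in> dom_of c" unfolding p_def by (rule chartD(5)[OF assms(2,3)])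
  have "((\<lambda>s. ginv (g s) c p $ i $ j) has_real_derivative
     - (ginv (g t) c p ** ((-2) *\<^sub>R S t c p) ** ginv (g t) c p) $ i $ j) (at t within J)"
    unfolding ginv_def
    by (rule matrix_inv_derivative[OF metric_entry_derivative(2)[OF assms(1,2) p] riemannian.metric_det_pos[OF riem assms(2) p] assms(1)])
  from DERIV_mult[OF this vol_derivative[OF assms(1-3)]]
  have "((\<lambda>s. ginv (g s) c p $ i $ j * vol_at s c x) has_real_derivative
    ginv (g t) c p $ i $ j * (- R t p * vol_at t c x) + - (ginv (g t) c p ** ((-2) *\<^sub>R S t c p) ** ginv (g t) c p) $ i $ j * vol_at t c x) (at t within J)"
    by (simp add: p_def mult.commute add.commute)
  moreover have "(M ** ((-2) *\<^sub>R B) ** M) $ i $ j = - 2 * (M ** B ** M) $ i $ j" for M B :: "real^'n^'n"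
    by (simp add: matrix_matrix_mult_def sum_distrib_left sum_distrib_right mult_ac sum_negf)
  ultimately show ?thesis by (simp add: algebra_simps)
qed

lemma smooth_metric_chart:
  assumes "c \<in> A"
  shows "smooth_on (J \<times> img_of c) (\<lambda>z. g (fst z) c (point c (snd z)))"
    "(\<lambda>z. g (fst z) c (point c (snd z))) ` (J \<times> img_of c) \<subseteq> {G. det G > 0}"
  using flow assms riemannian.metric_det_pos[OF riem assms chartD(5)[OF assms]]
  by (auto simp: harmonic_ricci_flow_def smooth_metric_family_def case_prod_beta')

lemma smooth_vol:
  assumes "c \<in> A" shows "smooth_on (J \<times> img_of c) (\<lambda>z. vol_at (fst z) c (snd z))"
  by (rule smooth_on_compose[OF smooth_metric_chart(1)[OF assms] open_det_pos C_on_sqrt_det smooth_metric_chart(2)[OF assms]])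

lemma smooth_ginv_vol:
  assumes "c \<in> A"
  shows "smooth_on (J \<times> img_of c) (\<lambda>z. ginv (g (fst z)) c (point c (snd z)) $ i $ j * vol_at (fst z) c (snd z))"
  unfolding ginv_def
  by (rule smooth_on_compose[OF smooth_metric_chart(1)[OF assms] open_det_pos
      C_on_mult[OF open_det_pos C_on_matrix_inv C_on_sqrt_det] smooth_metric_chart(2)[OF assms]])

lemma smooth_f_chart:
  assumes "c \<in> A" shows "smooth_on (J \<times> img_of c) (\<lambda>z. f (fst z) (point c (snd z)))"
  using f_family assms by (simp add: smooth_fun_family_def case_prod_beta')

lemma continuous_f_chart:
  assumes "c \<in> A" shows "continuous_on (J \<times> img_of c) (\<lambda>z. f (fst z) (point c (snd z)))"
  by (rule smooth_on_imp_continuous_on[OF smooth_f_chart[OF assms]])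

lemma continuous_pd_f_chart:
  assumes "c \<in> A" shows "continuous_on (J \<times> img_of c) (\<lambda>z. pd c i (f (fst z)) (point c (snd z)))"
proof -
  have "continuous_on (J \<times> img_of c) (\<lambda>z. frechet_derivative (\<lambda>y. f (fst z) (point c y)) (at (snd z)) (axis i 1))"
    using continuous_on_partial_derivative[OF smooth_f_chart[OF assms] chartD(2)[OF assms]] by simp
  then show ?thesis
    by (rule continuous_on_eq) (auto simp: pd_def comp_def chartD(6)[OF assms])
qed

text \<open>
  The weak form of the eigenvalue equation, with test function \<open>b\<close>.
\<close>

lemma eigenvalue_Green:
  assumes s: "s \<in> J" and b: "smooth_fun A b"
  shows "lam s * integral_dV A (g s) (\<lambda>p. b p * f s p) = integral_dV A (g s) (\<lambda>p. cometric (g s) (chart_at A p) b (f s) p)"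
proof -
  interpret riemannian A "g s" by (rule riem[OF s])
  have "laplacian A (g s) (f s) p = - lam s * f s p" for p
    using eigen s by (auto simp: eigenfunction_def) (metis minus_minus)
  then have "b p * laplacian A (g s) (f s) p = - lam s * (b p * f s p)" for p by simp
  then have "- lam s * integral_dV A (g s) (\<lambda>p. b p * f s p) = - integral_dV A (g s) (grad_inner b (f s))"
    using Green_identity[OF f_smooth[OF s] b] by (simp only: integral_dV_mult)
  then show ?thesis by simp
qed

end

context eigenvalue_flow begin

text \<open>
  The contribution of one chart, with a cut-off function \<open>\<rho>\<close>, to the limits along a sequence of
  times. A sequence suffices because \<open>\<lambda>\<close> is known to be differentiable, and it is what dominated
  convergence applies to.
\<close>

context
  fixes t :: real and s :: "nat \<Rightarrow> real" and c :: "('m, 'n) chart" and \<rho> :: "'m \<Rightarrow> real"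
  assumes t: "t \<in> J" and sJ: "\<And>n. s n \<in> J" and lim: "s \<longlonglongrightarrow> t" and st: "\<And>n. s n \<noteq> t"
    and c: "c \<in> A" and \<rho>: "smooth_fun A \<rho>" and supp: "closure {p. \<rho> p \<noteq> 0} \<subseteq> dom_of c"
begin

private abbreviation "U \<equiv> img_of c"
private abbreviation "K \<equiv> coord c ` closure {p. \<rho> p \<noteq> 0}"
private abbreviation "r \<equiv> \<lambda>x. \<rho> (point c x)"

private lemma cutoff: "compact K" "K \<subseteq> U" "continuous_on U r" "\<And>x. x \<in> U - K \<Longrightarrow> r x = 0"
proof -
  show "compact K" by (rule compact_coord_image[OF c closed_closure supp])
  show "K \<subseteq> U" using supp by (auto simp: img_of_def)
  show "continuous_on U r" by (rule C_on_imp_continuous_on[OF smooth_funD[OF \<rho> c]])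
  fix x assume x: "x \<in> U - K"
  then have "point c x \<notin> closure {p. \<rho> p \<noteq> 0}" using chartD(6)[OF c, of x] by (metis DiffD1 DiffD2 imageI)
  then show "r x = 0" using closure_subset[of "{p. \<rho> p \<noteq> 0}"] by blast
qed

private lemma continuous_frozen:
  assumes "continuous_on U h" shows "continuous_on (J \<times> U) (\<lambda>z. h (snd z))"
  by (rule continuous_on_compose2[OF assms continuous_on_snd[OF continuous_on_id]]) auto

private lemma continuous_f: "continuous_on U (\<lambda>x. f t (point c x))"
  by (rule C_on_imp_continuous_on[OF smooth_funD[OF f_smooth[OF t] c]])

private lemma continuous_pd_f: "continuous_on U (\<lambda>x. pd c i (f t) (point c x))"
  by (rule C_on_imp_continuous_on[OF C_on_pd[OF c smooth_funD[OF f_smooth[OF t] c]]])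

private lemma integrable_product:
  assumes \<sigma>: "\<sigma> \<in> J" and h: "continuous_on (dom_of c) h"
  shows "set_integrable lborel U (\<lambda>x. \<rho> (point c x) * h (point c x) * vol_at \<sigma> c x)"
proof (rule riemannian.chart_integrand(3)[OF riem[OF \<sigma>] c _ closed_closure supp])
  show "continuous_on (dom_of c) (\<lambda>p. \<rho> p * h p)"
    by (rule continuous_on_mult[OF continuous_on_subset[OF smooth_fun_continuous[OF \<rho>] subset_UNIV] h])
  show "\<rho> p * h p = 0" if "p \<in> dom_of c - closure {p. \<rho> p \<noteq> 0}" for p
    using that closure_subset[of "{p. \<rho> p \<noteq> 0}"] by (cases "\<rho> p = 0") auto
qed

private lemma continuous_ff: "continuous_on (dom_of c) (\<lambda>p. f t p * f (s n) p)"
  by (rule continuous_on_mult[OF continuous_on_subset[OF smooth_fun_continuous[OF f_smooth[OF t]] subset_UNIV]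
        continuous_on_subset[OF smooth_fun_continuous[OF f_smooth[OF sJ]] subset_UNIV]])

lemma chart_mass_tendsto:
  "(\<lambda>n. chart_integral (g (s n)) c (\<lambda>p. \<rho> p * (f t p * f (s n) p))) \<longlonglongrightarrow>
    chart_integral (g t) c (\<lambda>p. \<rho> p * (f t p)\<^sup>2)"
proof -
  let ?\<alpha> = "\<lambda>z. f t (point c (snd z)) * f (fst z) (point c (snd z)) * vol_at (fst z) c (snd z)"
  have "continuous_on (J \<times> U) ?\<alpha>"
    by (rule continuous_on_mult[OF continuous_on_mult[OF continuous_frozen[OF continuous_f] continuous_f_chart[OF c]]
          smooth_on_imp_continuous_on[OF smooth_vol[OF c]]])
  from integral_along_sequence[OF chartD(2)[OF c] cutoff this sJ lim t]
  show ?thesis by (simp add: chart_integral_def power2_eq_square mult_ac)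
qed

lemma chart_mass_quotient_tendsto:
  "(\<lambda>n. (chart_integral (g (s n)) c (\<lambda>p. \<rho> p * (f t p * f (s n) p))
        - chart_integral (g t) c (\<lambda>p. \<rho> p * (f t p * f (s n) p))) / (s n - t)) \<longlonglongrightarrow>
    - chart_integral (g t) c (\<lambda>p. \<rho> p * (R t p * (f t p)\<^sup>2))"
proof -
  let ?\<alpha> = "\<lambda>(_::unit) z. f t (point c (snd z)) * f (fst z) (point c (snd z))"
  let ?H = "\<lambda>(_::unit) z. vol_at (fst z) c (snd z)"
  let ?H' = "\<lambda>(_::unit) x. - R t (point c x) * vol_at t c x"
  have \<alpha>: "continuous_on (J \<times> U) (?\<alpha> m)" for m
    by (rule continuous_on_mult[OF continuous_frozen[OF continuous_f] continuous_f_chart[OF c]])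
  have H': "((\<lambda>\<sigma>. ?H m (\<sigma>, x)) has_real_derivative ?H' m x) (at t within J)" if "x \<in> U" for m x
    using vol_derivative[OF t c that] by simp
  have conv: "(\<lambda>n. LINT x:U|lborel. r x * (\<Sum>m\<in>{()}. ?\<alpha> m (s n, x) * ((?H m (s n, x) - ?H m (t, x)) / (s n - t))))
      \<longlonglongrightarrow> (LINT x:U|lborel. r x * (\<Sum>m\<in>{()}. ?\<alpha> m (t, x) * ?H' m x))"
    by (rule integral_difference_quotient(2)[OF chartD(2)[OF c] cutoff _ \<alpha> smooth_vol[OF c] H' sJ lim t st]) auto
  have quot: "(LINT x:U|lborel. r x * (\<Sum>m\<in>{()}. ?\<alpha> m (s n, x) * ((?H m (s n, x) - ?H m (t, x)) / (s n - t)))) =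
      (chart_integral (g (s n)) c (\<lambda>p. \<rho> p * (f t p * f (s n) p))
        - chart_integral (g t) c (\<lambda>p. \<rho> p * (f t p * f (s n) p))) / (s n - t)" for n
    unfolding chart_integral_def
      set_integral_difference_quotient[OF integrable_product[OF sJ continuous_ff] integrable_product[OF t continuous_ff]]
    by (simp add: right_diff_distrib mult_ac)
  have lim_eq: "(LINT x:U|lborel. r x * (\<Sum>m\<in>{()}. ?\<alpha> m (t, x) * ?H' m x)) =
      - chart_integral (g t) c (\<lambda>p. \<rho> p * (R t p * (f t p)\<^sup>2))"
    unfolding chart_integral_def set_lebesgue_integral_def Bochner_Integration.integral_minus[symmetric]
    by (simp add: power2_eq_square mult_ac)
  show ?thesis using conv unfolding quot lim_eq .
qed

text \<open>
  The integrand of the energy is \<open>\<Sum>\<^sub>i\<^sub>j \<partial>\<^sub>if(t) \<partial>\<^sub>jf(s)\<close> times the coefficients \<open>g\<^sup>i\<^sup>j dV\<close>, so the sum of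
  difference quotients is indexed by pairs. To split the limit into the two integrals of the claim, one of
  them must be known to exist. The integrand \<open>S |\<nabla>f|\<^sup>2 dV\<close> qualifies, being itself a limit of difference
  quotients, those of the volume density times \<open>- |\<nabla>f|\<^sup>2\<close>.
\<close>

lemma chart_energy_quotient_tendsto:
  "(\<lambda>n. (chart_integral (g (s n)) c (\<lambda>p. \<rho> p * cometric (g (s n)) (chart_at A p) (f t) (f (s n)) p)
        - chart_integral (g t) c (\<lambda>p. \<rho> p * cometric (g t) (chart_at A p) (f t) (f (s n)) p)) / (s n - t)) \<longlonglongrightarrow>
    2 * chart_integral (g t) c (\<lambda>p. \<rho> p * Q t p)
    - chart_integral (g t) c (\<lambda>p. \<rho> p * (R t p * grad_norm_sq A (g t) (f t) p))"
proof -
  interpret gt: riemannian A "g t" by (rule riem[OF t])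
  let ?e = "\<lambda>\<sigma> n p. cometric (g \<sigma>) (chart_at A p) (f t) (f (s n)) p"
  let ?\<alpha> = "\<lambda>m z. pd c (fst m) (f t) (point c (snd z)) * pd c (snd m) (f (fst z)) (point c (snd z))"
  let ?H = "\<lambda>m z. ginv (g (fst z)) c (point c (snd z)) $ fst m $ snd m * vol_at (fst z) c (snd z)"
  let ?N = "\<lambda>x. ginv (g t) c (point c x)"
  let ?H' = "\<lambda>m x. (2 * (?N x ** S t c (point c x) ** ?N x) $ fst m $ snd m - R t (point c x) * ?N x $ fst m $ snd m) * vol_at t c x"
  have \<alpha>: "continuous_on (J \<times> U) (?\<alpha> m)" for m
    by (rule continuous_on_mult[OF continuous_frozen[OF continuous_pd_f] continuous_pd_f_chart[OF c]])
  have H': "((\<lambda>\<sigma>. ?H m (\<sigma>, x)) has_real_derivative ?H' m x) (at t within J)" if "x \<in> U" for m x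
    using ginv_vol_derivative[OF t c that, of "fst m" "snd m"] by simp
  have pairs: "(\<Sum>m\<in>UNIV. F (fst m) (snd m)) = (\<Sum>i\<in>UNIV. \<Sum>j\<in>UNIV. F i j)" for F :: "'n \<Rightarrow> 'n \<Rightarrow> real"
    by (simp add: sum.cartesian_product case_prod_beta')
  note quotient = integral_difference_quotient[where I="UNIV :: ('n \<times> 'n) set" and \<alpha>="?\<alpha>" and H="?H" and H'="?H'",
      OF chartD(2)[OF c] cutoff finite \<alpha> smooth_ginv_vol[OF c] H' sJ lim t st]

  have energy: "\<rho> (point c x) * ?e \<sigma> n (point c x) * vol_at \<sigma> c x = r x * (\<Sum>m\<in>UNIV. ?\<alpha> m (s n, x) * ?H m (\<sigma>, x))"
    if "\<sigma> \<in> J" "x \<in> U" for \<sigma> n x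
  proof -
    have "?e \<sigma> n (point c x) * vol_at \<sigma> c x = (\<Sum>i\<in>UNIV. \<Sum>j\<in>UNIV. pd c i (f t) (point c x) * pd c j (f (s n)) (point c x)
        * (ginv (g \<sigma>) c (point c x) $ i $ j * vol_at \<sigma> c x))"
      unfolding riemannian.grad_inner_eq[OF riem[OF that(1)] f_smooth[OF t] f_smooth[OF sJ] c chartD(5)[OF c that(2)]]
      unfolding riemannian.cometric_eq_sum[OF riem[OF that(1)]]
      by (simp add: sum_distrib_left sum_distrib_right mult_ac)
    then show ?thesis unfolding pairs[symmetric] by (simp add: mult.assoc)
  qed
  have quotient_sum: "k * (\<Sum>m\<in>UNIV. a m * ((b m - d m) / h)) =
      k * ((\<Sum>m\<in>UNIV. a m * b m) - (\<Sum>m\<in>UNIV. a m * d m)) / h"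
    for k h :: real and a b d :: "'n \<times> 'n \<Rightarrow> real"
  proof -
    have "(\<Sum>m\<in>UNIV. a m * ((b m - d m) / h)) = ((\<Sum>m\<in>UNIV. a m * b m) - (\<Sum>m\<in>UNIV. a m * d m)) / h"
      by (simp add: sum_subtractf[symmetric] sum_divide_distrib right_diff_distrib)
    then show ?thesis by simp
  qed
  have ce: "continuous_on (dom_of c) (?e \<sigma> n)" if "\<sigma> \<in> J" for \<sigma> n
    by (rule riemannian.continuous_on_grad_inner[OF riem[OF that] f_smooth[OF t] f_smooth[OF sJ] c])
  have "(LINT x:U|lborel. r x * (\<Sum>m\<in>UNIV. ?\<alpha> m (s n, x) * ((?H m (s n, x) - ?H m (t, x)) / (s n - t)))) =
     (chart_integral (g (s n)) c (\<lambda>p. \<rho> p * ?e (s n) n p) - chart_integral (g t) c (\<lambda>p. \<rho> p * ?e t n p)) / (s n - t)" for n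
    unfolding chart_integral_def
      set_integral_difference_quotient[OF integrable_product[OF sJ ce[OF sJ]] integrable_product[OF t ce[OF t]]]
  proof (rule set_lebesgue_integral_cong)
    show "\<forall>x. x \<in> U \<longrightarrow> r x * (\<Sum>m\<in>UNIV. ?\<alpha> m (s n, x) * ((?H m (s n, x) - ?H m (t, x)) / (s n - t))) =
       (\<rho> (point c x) * ?e (s n) n (point c x) * vol_at (s n) c x - \<rho> (point c x) * ?e t n (point c x) * vol_at t c x) / (s n - t)"
    proof (intro allI impI)
      fix x assume x: "x \<in> U"
      have "r x * (\<Sum>m\<in>UNIV. ?\<alpha> m (s n, x) * ((?H m (s n, x) - ?H m (t, x)) / (s n - t))) =
        r x * ((\<Sum>m\<in>UNIV. ?\<alpha> m (s n, x) * ?H m (s n, x)) - (\<Sum>m\<in>UNIV. ?\<alpha> m (s n, x) * ?H m (t, x))) / (s n - t)"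
        by (rule quotient_sum)
      then show "r x * (\<Sum>m\<in>UNIV. ?\<alpha> m (s n, x) * ((?H m (s n, x) - ?H m (t, x)) / (s n - t))) =
       (\<rho> (point c x) * ?e (s n) n (point c x) * vol_at (s n) c x - \<rho> (point c x) * ?e t n (point c x) * vol_at t c x) / (s n - t)"
        unfolding energy[OF sJ x] energy[OF t x] by (simp only: right_diff_distrib)
    qed
  qed (use chartD(2)[OF c] in auto)
  note conv = quotient(2)[unfolded this]

  let ?G = "grad_norm_sq A (g t) (f t)"
  let ?lim = "\<lambda>x. r x * (\<Sum>m\<in>UNIV. ?\<alpha> m (t, x) * ?H' m x)"
  let ?mid = "\<lambda>x. r x * (?G (point c x) * (- R t (point c x) * vol_at t c x))"
  have G: "?G p = cometric (g t) c (f t) (f t) p" if "p \<in> dom_of c" for p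
    unfolding gt.grad_norm_sq_eq_cometric by (rule gt.grad_inner_eq[OF f_smooth[OF t] f_smooth[OF t] c that])
  have cG: "continuous_on U (\<lambda>x. ?G (point c x))"
    by (rule continuous_on_eq[OF C_on_imp_continuous_on[OF gt.C_on_cometric[OF f_smooth[OF t] f_smooth[OF t] c]]])
       (simp add: G chartD(5)[OF c])
  have "set_integrable lborel U (\<lambda>x. r x * (\<Sum>m\<in>{()}. (\<lambda>(_::unit) z. ?G (point c (snd z))) m (t, x) * (\<lambda>(_::unit) x. - R t (point c x) * vol_at t c x) m x))"
    by (rule integral_difference_quotient(1)[OF chartD(2)[OF c] cutoff _ continuous_frozen[OF cG] smooth_vol[OF c] _ sJ lim t st])
       (use vol_derivative[OF t c] in auto)
  then have mid: "set_integrable lborel U ?mid" by simp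
  have pt: "?lim x - ?mid x = 2 * (\<rho> (point c x) * Q t (point c x) * vol_at t c x)" if x: "x \<in> U" for x
  proof -
    have p: "point c x \<in> dom_of c" by (rule chartD(5)[OF c x])
    let ?p = "point c x"
    have "(\<Sum>m\<in>UNIV. ?\<alpha> m (t, x) * ?H' m x) =
      (\<Sum>i\<in>UNIV. \<Sum>j\<in>UNIV. pd c i (f t) ?p * pd c j (f t) ?p * ((2 * (?N x ** S t c ?p ** ?N x) $ i $ j - R t ?p * ?N x $ i $ j) * vol_at t c x))"
      unfolding pairs[symmetric] by simp
    also have "\<dots> = (2 * (\<Sum>i\<in>UNIV. \<Sum>j\<in>UNIV. (?N x ** S t c ?p ** ?N x) $ i $ j * (pd c i (f t) ?p * pd c j (f t) ?p))
       - R t ?p * (\<Sum>i\<in>UNIV. pd c i (f t) ?p * (\<Sum>j\<in>UNIV. ?N x $ i $ j * pd c j (f t) ?p))) * vol_at t c x"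
      unfolding sum_distrib_left left_diff_distrib sum_distrib_right sum_subtractf[symmetric]
      by (intro sum.cong refl) (simp add: algebra_simps)
    also have "\<dots> = (2 * Q t ?p - R t ?p * ?G ?p) * vol_at t c x"
      unfolding tensor_inner_chart[OF t f_smooth[OF t] c p] G[OF p] gt.cometric_eq_sum ..
    finally have e: "(\<Sum>m\<in>UNIV. ?\<alpha> m (t, x) * ?H' m x) = (2 * Q t ?p - R t ?p * ?G ?p) * vol_at t c x" .
    show ?thesis unfolding e by (simp add: algebra_simps)
  qed
  have "2 * chart_integral (g t) c (\<lambda>p. \<rho> p * Q t p) = (LINT x:U|lborel. ?lim x - ?mid x)"
  proof -
    have "2 * chart_integral (g t) c (\<lambda>p. \<rho> p * Q t p) = (LINT x:U|lborel. 2 * (\<rho> (point c x) * Q t (point c x) * vol_at t c x))"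
      by (simp only: chart_integral_def set_integral_mult_right)
    also have "\<dots> = (LINT x:U|lborel. ?lim x - ?mid x)"
      by (rule set_lebesgue_integral_cong) (use chartD(2)[OF c] pt in auto)
    finally show ?thesis .
  qed
  also have "\<dots> = (LINT x:U|lborel. ?lim x) - (LINT x:U|lborel. ?mid x)"
    by (rule set_integral_diff(2)[OF quotient(1) mid])
  also have "(LINT x:U|lborel. ?mid x) = - chart_integral (g t) c (\<lambda>p. \<rho> p * (R t p * ?G p))"
    unfolding chart_integral_def set_lebesgue_integral_def Bochner_Integration.integral_minus[symmetric]
    by (simp add: mult_ac)
  finally have "(LINT x:U|lborel. ?lim x) = 2 * chart_integral (g t) c (\<lambda>p. \<rho> p * Q t p)
    - chart_integral (g t) c (\<lambda>p. \<rho> p * (R t p * ?G p))" by simp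
  with conv show ?thesis by simp
qed

end

text \<open>
  With \<open>X \<sigma> n\<close> and \<open>E \<sigma> n\<close> the integrals of \<open>f(t) f(s\<^sub>n)\<close> and \<open>\<langle>df(t), df(s\<^sub>n)\<rangle>\<close> for the metric
  at time \<open>\<sigma>\<close>, the weak equations read \<open>\<lambda>(s\<^sub>n) X s\<^sub>n n = E s\<^sub>n n\<close> and \<open>\<lambda>(t) X t n = E t n\<close>. Their
  difference, divided by \<open>s\<^sub>n - t\<close>, has a limit term by term.
\<close>

theorem eigenvalue_variation:
  assumes t: "t \<in> J"
  shows "vector_derivative lam (at t within J) * integral_dV A (g t) (\<lambda>p. (f t p)\<^sup>2) =
      lam t * integral_dV A (g t) (\<lambda>p. R t p * (f t p)\<^sup>2)
      - integral_dV A (g t) (\<lambda>p. R t p * grad_norm_sq A (g t) (f t) p)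
      + 2 * integral_dV A (g t) (Q t)"
proof -
  interpret gt: riemannian A "g t" by (rule riem[OF t])
  obtain s where "\<forall>n. s n \<in> J - {t}" and lim: "s \<longlonglongrightarrow> t"
    using limit_point[OF t] unfolding islimpt_sequential by blast
  then have sJ: "s n \<in> J" and st: "s n \<noteq> t" for n by auto
  obtain N c \<rho> where P: "partition_of_unity A N c \<rho>"
    and I: "\<And>g \<phi>. integral_dV A g \<phi> = (\<Sum>k<N. chart_integral g (c k) (\<lambda>p. \<rho> k p * \<phi> p))"
    using integral_dV_partition by blast
  have cut: "c k \<in> A" "smooth_fun A (\<rho> k)" "closure {p. \<rho> k p \<noteq> 0} \<subseteq> dom_of (c k)" if "k < N" for k
    using P that by (auto simp: partition_of_unity_def)
  define X where "X \<sigma> n = integral_dV A (g \<sigma>) (\<lambda>p. f t p * f (s n) p)" for \<sigma> n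
  define E where "E \<sigma> n = integral_dV A (g \<sigma>) (\<lambda>p. cometric (g \<sigma>) (chart_at A p) (f t) (f (s n)) p)" for \<sigma> n

  have Xs: "(\<lambda>n. X (s n) n) \<longlonglongrightarrow> integral_dV A (g t) (\<lambda>p. (f t p)\<^sup>2)"
    unfolding X_def I by (intro tendsto_sum chart_mass_tendsto t sJ lim st cut) auto
  have Xq: "(\<lambda>n. (X (s n) n - X t n) / (s n - t)) \<longlonglongrightarrow> - integral_dV A (g t) (\<lambda>p. R t p * (f t p)\<^sup>2)"
    unfolding X_def I sum_subtractf[symmetric] sum_divide_distrib sum_negf[symmetric]
    by (intro tendsto_sum chart_mass_quotient_tendsto t sJ lim st cut) auto
  have Eq: "(\<lambda>n. (E (s n) n - E t n) / (s n - t)) \<longlonglongrightarrow> 2 * integral_dV A (g t) (Q t)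
      - integral_dV A (g t) (\<lambda>p. R t p * grad_norm_sq A (g t) (f t) p)"
    unfolding E_def I sum_subtractf[symmetric] sum_divide_distrib sum_distrib_left
    by (intro tendsto_sum chart_energy_quotient_tendsto t sJ lim st cut) auto

  have Gs: "lam (s n) * X (s n) n = E (s n) n" for n
    unfolding X_def E_def by (rule eigenvalue_Green[OF sJ f_smooth[OF t]])
  have Gt: "lam t * X t n = E t n" for n
    using eigenvalue_Green[OF t f_smooth[OF sJ], of n]
    unfolding X_def E_def gt.cometric_commute[OF chart_at, of _ "f (s n)"] by (simp add: mult.commute)

  obtain D where D: "(lam has_real_derivative D) (at t within J)"
  proof -
    obtain M F where M: "open M" "t \<in> M" "\<forall>k. C_on k M F" "\<forall>y\<in>J \<inter> M. F y = lam y"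
      using lam t unfolding smooth_on_def by blast
    have "C_on (Suc 0) M F" using M(3) by blast
    then have "F differentiable (at t)" using M(2) by simp
    then obtain D where "(F has_real_derivative D) (at t)" by (auto simp: real_differentiable_def)
    then have "(F has_real_derivative D) (at t within J)" by (rule has_field_derivative_at_within)
    moreover obtain \<epsilon> where "\<epsilon> > 0" "ball t \<epsilon> \<subseteq> M" using M(1,2) open_contains_ball by blast
    ultimately have "(lam has_real_derivative D) (at t within J)"
      using t M(4) by (intro has_field_derivative_transform_within[of F D t J \<epsilon> lam]) (auto simp: dist_commute subset_iff)
    then show thesis by (rule that)
  qed
  have vd: "vector_derivative lam (at t within J) = D"
    using D limit_point[OF t] unfolding has_real_derivative_iff_has_vector_derivative
    by (intro vector_derivative_within) (auto simp: trivial_limit_within)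
  have fs: "filterlim s (at t within J) sequentially"
    using sJ lim st by (auto simp: filterlim_at)
  have lq: "(\<lambda>n. (lam (s n) - lam t) / (s n - t)) \<longlonglongrightarrow> D"
    using filterlim_compose[OF D[unfolded has_field_derivative_iff] fs] .

  \<comment> \<open>The discrete product rule for \<open>\<lambda> X\<close>.\<close>
  have split: "(lam (s n) - lam t) / (s n - t) * X (s n) n + lam t * ((X (s n) n - X t n) / (s n - t)) =
     (E (s n) n - E t n) / (s n - t)" for n
  proof -
    have "(lam (s n) - lam t) / (s n - t) * X (s n) n + lam t * ((X (s n) n - X t n) / (s n - t)) =
      ((lam (s n) - lam t) * X (s n) n + lam t * (X (s n) n - X t n)) / (s n - t)"
      by (simp add: add_divide_distrib)
    also have "(lam (s n) - lam t) * X (s n) n + lam t * (X (s n) n - X t n) = E (s n) n - E t n"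
      unfolding Gs[symmetric] Gt[symmetric] by (simp add: algebra_simps)
    finally show ?thesis .
  qed
  have "(\<lambda>n. (E (s n) n - E t n) / (s n - t)) \<longlonglongrightarrow>
     D * integral_dV A (g t) (\<lambda>p. (f t p)\<^sup>2) + lam t * (- integral_dV A (g t) (\<lambda>p. R t p * (f t p)\<^sup>2))"
    unfolding split[symmetric] by (intro tendsto_add tendsto_mult tendsto_const lq Xs Xq)
  from LIMSEQ_unique[OF this Eq] show ?thesis by (simp add: vd algebra_simps)
qed

end

theorem theorem1p5:
  fixes A :: "('m::t2_space, 'n::finite) chart set"
    and J :: "real set"
    and g :: "real \<Rightarrow> ('m, 'n) tensor2"
    and u f :: "real \<Rightarrow> 'm \<Rightarrow> real"
    and lam :: "real \<Rightarrow> real"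
  assumes "compact_manifold A"
    and "is_interval J" and "\<exists>a\<in>J. \<exists>b\<in>J. a < b"
    and "harmonic_ricci_flow A J g u"
    and "smooth_on J lam"
    and "smooth_fun_family A J f"
    and "\<forall>t\<in>J. eigenfunction A (g t) (lam t) (f t)"
  shows "\<forall>t\<in>J. vector_derivative lam (at t within J) * integral_dV A (g t) (\<lambda>p. (f t p)\<^sup>2) =
      lam t * integral_dV A (g t) (\<lambda>p. S_scalar A (g t) (u t) p * (f t p)\<^sup>2)
      - integral_dV A (g t) (\<lambda>p. S_scalar A (g t) (u t) p * grad_norm_sq A (g t) (f t) p)
      + 2 * integral_dV A (g t) (\<lambda>p. tensor_inner A (g t) (S_tensor (g t) (u t))
              (outer (differential (f t)) (differential (f t))) p)"
proof -
  interpret eigenvalue_flow A J g u f lam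
    by (intro eigenvalue_flow.intro compact_mfd.intro eigenvalue_flow_axioms.intro assms)
  show ?thesis using eigenvalue_variation by blast
qed

end
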